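(* Let $\Lambda$ be a finite abelian group and $P$ a manifold. Then the following assertions hold: (a) If $(C^{\infty}(P),\Lambda,\alpha)$ is a trivial noncommutative principal $\Lambda$-bundle, and $\sigma:P\times\Lambda\rightarrow P$ denotes the induced (smooth, free and proper) action of $\Lambda$ on $P$, where $\sigma(p,\lambda)$ is the unique point of $P$ with $\delta_{\sigma(p,\lambda)}=\delta_p\circ\alpha(\lambda)$, then the corresponding principal bundle $(P,P/\Lambda,\Lambda,\mathrm{pr},\sigma)$, where $\mathrm{pr}:P\to P/\Lambda$ is the orbit map, is trivial. (b) Conversely, if $(P,M,\Lambda,q,\sigma)$ is a trivial principal $\Lambda$-bundle (total space $P$, base manifold $M$, projection $q$, right action $\sigma:P\times\Lambda\to P$), then the corresponding dynamical system $(C^{\infty}(P),\Lambda,\alpha)$ defined by \[\alpha:\Lambda\times C^{\infty}(P)\rightarrow C^{\infty}(P),\quad \alpha(\lambda,f)(p):=f(\sigma(p,\lambda)),\] is a trivial noncommutative principal $\Lambda$-bundle.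
   Context: Manifolds are finite-dimensional, paracompact, second countable and smooth; algebras are associative and complex; $C^\infty(P)$ is the algebra of smooth complex-valued functions with its usual locally convex topology. For $p\in P$, $\delta_p$ denotes the point evaluation $f\mapsto f(p)$; the map $p\mapsto\delta_p$ is a bijection of $P$ onto the set of nonzero algebra homomorphisms $C^{\infty}(P)\to\mathbb{C}$. A dynamical system $(A,\Lambda,\alpha)$ consists of a unital locally convex algebra $A$ and a group homomorphism $\alpha:\Lambda\to\mathrm{Aut}(A)$ inducing a continuous action of $\Lambda$ on $A$. For a character $\chi\in\widehat{\Lambda}=\mathrm{Hom}(\Lambda,\mathbb{T})$ the isotypic component is $A_\chi=\{a\in A:\alpha(\lambda)a=\chi(\lambda)a\ \forall\lambda\in\Lambda\}$. Let $\{\lambda_1,\ldots,\lambda_k\}$ be a set of generators of $\Lambda$ of minimal cardinality, of orders $n_1,\ldots,n_k$, such that $\Lambda$ is the internal direct product of the cyclic subgroups $\langle\lambda_i\rangle$. Define $\widehat{\lambda}_i\in\widehat{\Lambda}$ by $\widehat{\lambda}_i(\lambda_i)=\exp(2\pi i/n_i)$ (imaginary unit in the exponent) and $\widehat{\lambda}_i(\lambda_j)=1$ for $j\neq i$. A dynamical system $(A,\Lambda,\alpha)$ is called a trivial noncommutative principal $\Lambda$-bundle if there exists such a set of generators for which each isotypic component $A_{\widehat{\lambda}_i}$, $i=1,\ldots,k$, contains an invertible element $a_i$ satisfying $a_i^{n_i}=1_A$. A principal $\Lambda$-bundle over $M$ is trivial if it is equivalent, as a principal bundle over $M$, to $M\times\Lambda$.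 *)

theory Defs
  imports
    "HOL-Analysis.Analysis"
    "HOL-Algebra.Module"
    "HOL-Algebra.Bij"
    "HOL-Algebra.Product_Groups"
    "HOL-Algebra.Generated_Groups"
    "HOL-Algebra.Multiplicative_Group"
begin

section \<open>Smooth manifolds\<close>

primrec iter_deriv ::
  "'e::real_normed_vector list \<Rightarrow> ('e \<Rightarrow> 'f::real_normed_vector) \<Rightarrow> 'e \<Rightarrow> 'f" where
  "iter_deriv [] f = f"
| "iter_deriv (v # vs) f = (\<lambda>x. frechet_derivative (iter_deriv vs f) (at x) v)"

text \<open>Meant for open \<open>S\<close> and finite-dimensional \<open>'e\<close>. Differentiability at every order makes all
  iterated directional derivatives continuous, so this is the usual notion of class \<open>C\<^sup>\<infinity>\<close>.\<close>

definition smooth_on ::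
  "'e::real_normed_vector set \<Rightarrow> ('e \<Rightarrow> 'f::real_normed_vector) \<Rightarrow> bool" where
  "smooth_on S f \<longleftrightarrow> (\<forall>vs. \<forall>x\<in>S. iter_deriv vs f differentiable (at x))"

text \<open>A chart is a pair of a domain \<open>U\<close> and a map \<open>\<phi>\<close> whose values outside \<open>U\<close> are irrelevant.
  The model space is a finite-dimensional inner product space rather than a member of
  \<open>euclidean_space\<close>, because the latter class excludes dimension \<open>0\<close>.\<close>

record ('a, 'e) manifold =
  mtop :: "'a topology"
  atlas :: "('a set \<times> ('a \<Rightarrow> 'e)) set"

abbreviation man_space :: "('a, 'e, 'm) manifold_scheme \<Rightarrow> 'a set" where
  "man_space M \<equiv> topspace (mtop M)"

definition is_chart :: "'a topology \<Rightarrow> 'a set \<times> ('a \<Rightarrow> 'e::real_inner) \<Rightarrow> bool" where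
  "is_chart X = (\<lambda>(U, \<phi>). openin X U \<and> open (\<phi> ` U) \<and>
     homeomorphic_map (subtopology X U) (top_of_set (\<phi> ` U)) \<phi>)"

definition paracompact_space :: "'a topology \<Rightarrow> bool" where
  "paracompact_space X \<longleftrightarrow> (\<forall>\<U>. (\<forall>U\<in>\<U>. openin X U) \<and> \<Union>\<U> = topspace X \<longrightarrow>
     (\<exists>\<V>. (\<forall>V\<in>\<V>. openin X V \<and> (\<exists>U\<in>\<U>. V \<subseteq> U)) \<and> \<Union>\<V> = topspace X \<and> locally_finite_in X \<V>))"

definition smooth_manifold :: "('a, 'e::real_inner) manifold \<Rightarrow> bool" where
  "smooth_manifold M \<longleftrightarrow>
     (\<exists>B::'e set. finite B \<and> span B = UNIV) \<and>
     Hausdorff_space (mtop M) \<and> second_countable (mtop M) \<and> paracompact_space (mtop M) \<and>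
     (\<forall>c\<in>atlas M. is_chart (mtop M) c) \<and>
     \<Union>(fst ` atlas M) = man_space M \<and>
     (\<forall>(U, \<phi>)\<in>atlas M. \<forall>(V, \<psi>)\<in>atlas M. smooth_on (\<phi> ` (U \<inter> V)) (\<psi> \<circ> inv_into U \<phi>))"

definition smooth_map ::
  "('a, 'e::real_inner) manifold \<Rightarrow> ('b, 'f::real_inner) manifold \<Rightarrow> ('a \<Rightarrow> 'b) \<Rightarrow> bool" where
  "smooth_map M N F \<longleftrightarrow> continuous_map (mtop M) (mtop N) F \<and>
     (\<forall>(U, \<phi>)\<in>atlas M. \<forall>(V, \<psi>)\<in>atlas N.
        smooth_on (\<phi> ` (U \<inter> F -` V)) (\<psi> \<circ> F \<circ> inv_into U \<phi>))"

definition diffeomorphism ::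
  "('a, 'e::real_inner) manifold \<Rightarrow> ('b, 'f::real_inner) manifold \<Rightarrow> ('a \<Rightarrow> 'b) \<Rightarrow> bool" where
  "diffeomorphism M N F \<longleftrightarrow> smooth_map M N F \<and>
     (\<exists>G. smooth_map N M G \<and> (\<forall>x\<in>man_space M. G (F x) = x) \<and> (\<forall>y\<in>man_space N. F (G y) = y))"

definition open_submanifold :: "('a, 'e) manifold \<Rightarrow> 'a set \<Rightarrow> ('a, 'e) manifold" where
  "open_submanifold M W =
     \<lparr>mtop = subtopology (mtop M) W, atlas = (\<lambda>(U, \<phi>). (U \<inter> W, \<phi>)) ` atlas M\<rparr>"

text \<open>The product of a manifold with a discrete group (a zero-dimensional manifold).\<close>

definition prod_discrete ::
  "('a, 'e) manifold \<Rightarrow> ('g, 'z) monoid_scheme \<Rightarrow> ('a \<times> 'g, 'e) manifold" where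
  "prod_discrete M \<Lambda> =
     \<lparr>mtop = prod_topology (mtop M) (discrete_topology (carrier \<Lambda>)),
      atlas = {(U \<times> {g}, \<phi> \<circ> fst) | U \<phi> g. (U, \<phi>) \<in> atlas M \<and> g \<in> carrier \<Lambda>}\<rparr>"


section \<open>Principal bundles with discrete structure group\<close>

definition smooth_right_action ::
  "('a, 'e::real_inner) manifold \<Rightarrow> ('g, 'z) monoid_scheme \<Rightarrow> ('a \<times> 'g \<Rightarrow> 'a) \<Rightarrow> bool" where
  "smooth_right_action P \<Lambda> \<sigma> \<longleftrightarrow> smooth_map (prod_discrete P \<Lambda>) P \<sigma> \<and>
     (\<forall>p\<in>man_space P. \<sigma> (p, \<one>\<^bsub>\<Lambda>\<^esub>) = p) \<and>
     (\<forall>p\<in>man_space P. \<forall>g\<in>carrier \<Lambda>. \<forall>h\<in>carrier \<Lambda>. \<sigma> (\<sigma> (p, g), h) = \<sigma> (p, g \<otimes>\<^bsub>\<Lambda>\<^esub> h))"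

definition free_action ::
  "('a, 'e) manifold \<Rightarrow> ('g, 'z) monoid_scheme \<Rightarrow> ('a \<times> 'g \<Rightarrow> 'a) \<Rightarrow> bool" where
  "free_action P \<Lambda> \<sigma> \<longleftrightarrow>
     (\<forall>p\<in>man_space P. \<forall>g\<in>carrier \<Lambda>. \<sigma> (p, g) = p \<longrightarrow> g = \<one>\<^bsub>\<Lambda>\<^esub>)"

definition proper_action ::
  "('a, 'e) manifold \<Rightarrow> ('g, 'z) monoid_scheme \<Rightarrow> ('a \<times> 'g \<Rightarrow> 'a) \<Rightarrow> bool" where
  "proper_action P \<Lambda> \<sigma> \<longleftrightarrow>
     proper_map (mtop (prod_discrete P \<Lambda>)) (prod_topology (mtop P) (mtop P))
       (\<lambda>(p, g). (p, \<sigma> (p, g)))"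

definition bundle_equivalence ::
  "('g, 'z) monoid_scheme \<Rightarrow>
   ('a, 'e::real_inner) manifold \<Rightarrow> ('a \<Rightarrow> 'm) \<Rightarrow> ('a \<times> 'g \<Rightarrow> 'a) \<Rightarrow>
   ('b, 'f::real_inner) manifold \<Rightarrow> ('b \<Rightarrow> 'm) \<Rightarrow> ('b \<times> 'g \<Rightarrow> 'b) \<Rightarrow> ('a \<Rightarrow> 'b) \<Rightarrow> bool" where
  "bundle_equivalence \<Lambda> P q \<sigma> P' q' \<sigma>' \<Phi> \<longleftrightarrow> diffeomorphism P P' \<Phi> \<and>
     (\<forall>p\<in>man_space P. q' (\<Phi> p) = q p) \<and>
     (\<forall>p\<in>man_space P. \<forall>g\<in>carrier \<Lambda>. \<Phi> (\<sigma> (p, g)) = \<sigma>' (\<Phi> p, g))"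

definition product_action :: "('g, 'z) monoid_scheme \<Rightarrow> ('m \<times> 'g) \<times> 'g \<Rightarrow> 'm \<times> 'g" where
  "product_action \<Lambda> = (\<lambda>((m, g), h). (m, g \<otimes>\<^bsub>\<Lambda>\<^esub> h))"

definition principal_bundle ::
  "('a, 'e::real_inner) manifold \<Rightarrow> ('m, 'f::real_inner) manifold \<Rightarrow> ('g, 'z) monoid_scheme \<Rightarrow>
   ('a \<Rightarrow> 'm) \<Rightarrow> ('a \<times> 'g \<Rightarrow> 'a) \<Rightarrow> bool" where
  "principal_bundle P M \<Lambda> q \<sigma> \<longleftrightarrow>
     smooth_manifold P \<and> smooth_manifold M \<and> group \<Lambda> \<and>
     smooth_map P M q \<and> q ` man_space P = man_space M \<and> smooth_right_action P \<Lambda> \<sigma> \<and>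
     (\<forall>m\<in>man_space M. \<exists>U \<Phi>. openin (mtop M) U \<and> m \<in> U \<and>
        bundle_equivalence \<Lambda> (open_submanifold P (q -` U)) q \<sigma>
          (prod_discrete (open_submanifold M U) \<Lambda>) fst (product_action \<Lambda>) \<Phi>)"

definition trivial_principal_bundle ::
  "('a, 'e::real_inner) manifold \<Rightarrow> ('m, 'f::real_inner) manifold \<Rightarrow> ('g, 'z) monoid_scheme \<Rightarrow>
   ('a \<Rightarrow> 'm) \<Rightarrow> ('a \<times> 'g \<Rightarrow> 'a) \<Rightarrow> bool" where
  "trivial_principal_bundle P M \<Lambda> q \<sigma> \<longleftrightarrow> principal_bundle P M \<Lambda> q \<sigma> \<and>
     (\<exists>\<Phi>. bundle_equivalence \<Lambda> P q \<sigma> (prod_discrete M \<Lambda>) fst (product_action \<Lambda>) \<Phi>)"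

definition orbit_map :: "('g, 'z) monoid_scheme \<Rightarrow> ('a \<times> 'g \<Rightarrow> 'a) \<Rightarrow> 'a \<Rightarrow> 'a set" where
  "orbit_map \<Lambda> \<sigma> p = (\<lambda>g. \<sigma> (p, g)) ` carrier \<Lambda>"

text \<open>The orbit space with the quotient topology. Its charts are those of \<open>P\<close>, restricted to open
  sets on which the orbit map is injective and pushed forward along it. For a free action of a finite
  group this is the smooth structure for which the orbit map is a local diffeomorphism.\<close>

definition orbit_manifold ::
  "('a, 'e) manifold \<Rightarrow> ('g, 'z) monoid_scheme \<Rightarrow> ('a \<times> 'g \<Rightarrow> 'a) \<Rightarrow> ('a set, 'e) manifold" where
  "orbit_manifold P \<Lambda> \<sigma> =
     (let pr = orbit_map \<Lambda> \<sigma> in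
      \<lparr>mtop = topology (\<lambda>W. W \<subseteq> pr ` man_space P \<and> openin (mtop P) {p \<in> man_space P. pr p \<in> W}),
       atlas = {(pr ` V, \<phi> \<circ> inv_into V pr) | U V \<phi>.
                  (U, \<phi>) \<in> atlas P \<and> V \<subseteq> U \<and> openin (mtop P) V \<and> inj_on pr V}\<rparr>)"


section \<open>Locally convex algebras and dynamical systems\<close>

definition complex_ring :: "complex ring" where
  "complex_ring = \<lparr>carrier = UNIV, mult = (*), one = 1, zero = 0, add = (+)\<rparr>"

record 'b top_algebra = "(complex, 'b) module" +
  alg_top :: "'b topology"

definition complex_algebra :: "('b, 't) top_algebra_scheme \<Rightarrow> bool" where
  "complex_algebra A \<longleftrightarrow> Ring.ring A \<and> Module.module complex_ring A \<and>
     (\<forall>c. \<forall>x\<in>carrier A. \<forall>y\<in>carrier A.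
        (c \<odot>\<^bsub>A\<^esub> x) \<otimes>\<^bsub>A\<^esub> y = c \<odot>\<^bsub>A\<^esub> (x \<otimes>\<^bsub>A\<^esub> y) \<and>
        x \<otimes>\<^bsub>A\<^esub> (c \<odot>\<^bsub>A\<^esub> y) = c \<odot>\<^bsub>A\<^esub> (x \<otimes>\<^bsub>A\<^esub> y))"

definition seminorm_of :: "('b, 't) top_algebra_scheme \<Rightarrow> ('b \<Rightarrow> real) \<Rightarrow> bool" where
  "seminorm_of A q \<longleftrightarrow>
     (\<forall>x\<in>carrier A. 0 \<le> q x) \<and>
     (\<forall>x\<in>carrier A. \<forall>y\<in>carrier A. q (x \<oplus>\<^bsub>A\<^esub> y) \<le> q x + q y) \<and>
     (\<forall>c. \<forall>x\<in>carrier A. q (c \<odot>\<^bsub>A\<^esub> x) = cmod c * q x)"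

definition seminorm_topology ::
  "('b, 'r) ring_scheme \<Rightarrow> ('b \<Rightarrow> real) set \<Rightarrow> 'b topology" where
  "seminorm_topology A Q = topology_generated_by
     (insert (carrier A)
       {{y \<in> carrier A. q (y \<ominus>\<^bsub>A\<^esub> x) < e} | q x e. q \<in> Q \<and> x \<in> carrier A \<and> 0 < e})"

definition locally_convex_algebra :: "('b, 't) top_algebra_scheme \<Rightarrow> bool" where
  "locally_convex_algebra A \<longleftrightarrow> complex_algebra A \<and>
     (\<exists>Q. (\<forall>q\<in>Q. seminorm_of A q) \<and> alg_top A = seminorm_topology A Q) \<and>
     Hausdorff_space (alg_top A) \<and>
     continuous_map (prod_topology (alg_top A) (alg_top A)) (alg_top A) (\<lambda>(x, y). x \<otimes>\<^bsub>A\<^esub> y)"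

definition algebra_AutGroup :: "('b, 't) top_algebra_scheme \<Rightarrow> ('b \<Rightarrow> 'b) monoid" where
  "algebra_AutGroup A = BijGroup (carrier A)
     \<lparr>carrier := {f \<in> Bij (carrier A) \<inter> ring_hom A A.
                    \<forall>c. \<forall>x\<in>carrier A. f (c \<odot>\<^bsub>A\<^esub> x) = c \<odot>\<^bsub>A\<^esub> f x}\<rparr>"

text \<open>The acting group carries the discrete topology.\<close>

definition dynamical_system ::
  "('b, 't) top_algebra_scheme \<Rightarrow> ('g, 'z) monoid_scheme \<Rightarrow> ('g \<Rightarrow> 'b \<Rightarrow> 'b) \<Rightarrow> bool" where
  "dynamical_system A \<Lambda> \<alpha> \<longleftrightarrow>
     locally_convex_algebra A \<and> group \<Lambda> \<and> \<alpha> \<in> hom \<Lambda> (algebra_AutGroup A) \<and>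
     continuous_map (prod_topology (discrete_topology (carrier \<Lambda>)) (alg_top A)) (alg_top A)
       (\<lambda>(g, a). \<alpha> g a)"

definition circle_group :: "complex monoid" where
  "circle_group = \<lparr>carrier = {z. cmod z = 1}, mult = (*), one = 1\<rparr>"

definition characters :: "('g, 'z) monoid_scheme \<Rightarrow> ('g \<Rightarrow> complex) set" where
  "characters \<Lambda> = hom \<Lambda> circle_group \<inter> extensional (carrier \<Lambda>)"

definition isotypic_component ::
  "('b, 't) top_algebra_scheme \<Rightarrow> ('g, 'z) monoid_scheme \<Rightarrow> ('g \<Rightarrow> 'b \<Rightarrow> 'b) \<Rightarrow>
   ('g \<Rightarrow> complex) \<Rightarrow> 'b set" where
  "isotypic_component A \<Lambda> \<alpha> \<theta> =
     {a \<in> carrier A. \<forall>g\<in>carrier \<Lambda>. \<alpha> g a = \<theta> g \<odot>\<^bsub>A\<^esub> a}"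

definition adapted_generators :: "('g, 'z) monoid_scheme \<Rightarrow> 'g set \<Rightarrow> bool" where
  "adapted_generators \<Lambda> S \<longleftrightarrow>
     finite S \<and> S \<subseteq> carrier \<Lambda> \<and> generate \<Lambda> S = carrier \<Lambda> \<and>
     (\<forall>T. finite T \<and> T \<subseteq> carrier \<Lambda> \<and> generate \<Lambda> T = carrier \<Lambda> \<longrightarrow> card S \<le> card T) \<and>
     (\<lambda>x. finprod \<Lambda> x S) \<in> iso (product_group S (\<lambda>s. subgroup_generated \<Lambda> {s})) \<Lambda>"

definition dual_generator :: "('g, 'z) monoid_scheme \<Rightarrow> 'g set \<Rightarrow> 'g \<Rightarrow> 'g \<Rightarrow> complex" where
  "dual_generator \<Lambda> S s = (THE \<theta>. \<theta> \<in> characters \<Lambda> \<and>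
     \<theta> s = exp (2 * of_real pi * \<i> / of_nat (group.ord \<Lambda> s)) \<and> (\<forall>t\<in>S - {s}. \<theta> t = 1))"

definition trivial_nc_principal_bundle ::
  "('b, 't) top_algebra_scheme \<Rightarrow> ('g, 'z) monoid_scheme \<Rightarrow> ('g \<Rightarrow> 'b \<Rightarrow> 'b) \<Rightarrow> bool" where
  "trivial_nc_principal_bundle A \<Lambda> \<alpha> \<longleftrightarrow> dynamical_system A \<Lambda> \<alpha> \<and>
     (\<exists>S. adapted_generators \<Lambda> S \<and>
        (\<forall>s\<in>S. \<exists>a\<in>isotypic_component A \<Lambda> \<alpha> (dual_generator \<Lambda> S s).
           a \<in> Units A \<and> a [^]\<^bsub>A\<^esub> group.ord \<Lambda> s = \<one>\<^bsub>A\<^esub>))"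


section \<open>The locally convex algebra of smooth functions\<close>

text \<open>Functions on \<open>P\<close> are extensional, so that they are determined by their values on \<open>P\<close>.\<close>

definition smooth_functions :: "('a, 'e::real_inner) manifold \<Rightarrow> ('a \<Rightarrow> complex) set" where
  "smooth_functions P =
     {f \<in> extensional (man_space P). \<forall>(U, \<phi>)\<in>atlas P. smooth_on (\<phi> ` U) (f \<circ> inv_into U \<phi>)}"

definition smooth_function_ring :: "('a, 'e::real_inner) manifold \<Rightarrow> ('a \<Rightarrow> complex) ring" where
  "smooth_function_ring P =
     \<lparr>carrier = smooth_functions P,
      mult = (\<lambda>f g. \<lambda>p\<in>man_space P. f p * g p), one = (\<lambda>p\<in>man_space P. 1),
      zero = (\<lambda>p\<in>man_space P. 0), add = (\<lambda>f g. \<lambda>p\<in>man_space P. f p + g p)\<rparr>"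

text \<open>The usual topology: uniform convergence of all derivatives on compact subsets of charts.\<close>

definition smooth_seminorms ::
  "('a, 'e::real_inner) manifold \<Rightarrow> (('a \<Rightarrow> complex) \<Rightarrow> real) set" where
  "smooth_seminorms P =
     {(\<lambda>f. SUP x\<in>K. cmod (iter_deriv vs (f \<circ> inv_into U \<phi>) x)) | U \<phi> K vs.
        (U, \<phi>) \<in> atlas P \<and> compact K \<and> K \<noteq> {} \<and> K \<subseteq> \<phi> ` U}"

definition smooth_algebra :: "('a, 'e::real_inner) manifold \<Rightarrow> ('a \<Rightarrow> complex) top_algebra" where
  "smooth_algebra P =
     \<lparr>carrier = carrier (smooth_function_ring P), mult = mult (smooth_function_ring P),
      one = one (smooth_function_ring P), zero = zero (smooth_function_ring P),
      add = add (smooth_function_ring P), smult = (\<lambda>c f. \<lambda>p\<in>man_space P. c * f p),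
      alg_top = seminorm_topology (smooth_function_ring P) (smooth_seminorms P)\<rparr>"

definition point_evaluation ::
  "('a, 'e::real_inner) manifold \<Rightarrow> 'a \<Rightarrow> ('a \<Rightarrow> complex) \<Rightarrow> complex" where
  "point_evaluation P p = (\<lambda>f\<in>smooth_functions P. f p)"

definition induced_action ::
  "('a, 'e::real_inner) manifold \<Rightarrow> ('g \<Rightarrow> ('a \<Rightarrow> complex) \<Rightarrow> ('a \<Rightarrow> complex)) \<Rightarrow> 'a \<times> 'g \<Rightarrow> 'a" where
  "induced_action P \<alpha> = (\<lambda>(p, g). THE x. x \<in> man_space P \<and>
     point_evaluation P x = compose (smooth_functions P) (point_evaluation P p) (\<alpha> g))"

definition pullback_action ::
  "('a, 'e::real_inner) manifold \<Rightarrow> ('a \<times> 'g \<Rightarrow> 'a) \<Rightarrow> 'g \<Rightarrow> ('a \<Rightarrow> complex) \<Rightarrow> ('a \<Rightarrow> complex)" where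
  "pullback_action P \<sigma> g = (\<lambda>f\<in>smooth_functions P. \<lambda>p\<in>man_space P. f (\<sigma> (p, g)))"

end

theory Submission
  imports Defs
begin

text \<open>
  (a) Since \<open>\<alpha>(g)\<close> is continuous, \<open>\<delta>\<^sub>p \<circ> \<alpha>(g)\<close> is a continuous character, so it kills all functions that
  vanish near some compact set \<open>K\<close>. If it were not an evaluation, finitely many functions \<open>h\<^sub>i\<close> in its
  kernel would have no common zero on \<open>K\<close>; cutting off away from \<open>K\<close>, the function
  \<open>\<Sum>|h\<^sub>i|\<^sup>2 + \<Prod>(1 - \<beta>\<^sub>i)\<close> would be invertible and lie in the kernel. This gives \<open>\<sigma>\<close>, which is smooth because
  its coordinates are images under \<open>\<alpha>(g)\<close> of cut-off coordinate functions. The given elements \<open>a\<^sub>s\<close> have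
  values in the roots of unity of order \<open>n\<^sub>s\<close>, and the dual generators identify the group with the product of these groups of
  roots of unity; hence the \<open>a\<^sub>s\<close> combine to a locally constant map \<open>\<tau>\<close> from \<open>P\<close> to the group with
  \<open>\<tau>(\<sigma>(p, g)) = \<tau>(p) g\<close>, and \<open>p \<mapsto> (pr p, \<tau> p)\<close> is a global trivialization.

  (b) A trivialization \<open>\<Phi>\<close> gives the elements \<open>p \<mapsto> \<theta>\<^sub>s(snd (\<Phi> p))\<close> for the dual generators \<open>\<theta>\<^sub>s\<close> of an adapted
  generating set, which exists by Rado's proof of the structure theorem. Continuity of multiplication and
  of the action comes from the Leibniz rule and from a chain rule for iterated derivatives.
\<close>

section \<open>Calculus of smooth maps\<close>

subsection \<open>Iterated derivatives\<close>

text \<open>The obstacle in (a) is that the points \<open>\<sigma>(p, g)\<close> have to be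
  constructed. The classical proof that characters are evaluations uses an exhaustion function to
  reach a compact set. Here a neighbourhood of zero does it: it involves finitely many seminorms,
  each living on one compact set in one chart, and a character that is bounded on it must, by
  scaling, kill whatever vanishes near these sets. The sheet where \<open>\<tau>\<close> is the unit
  is open and meets every orbit exactly once. The orbit space takes its separation and countability
  properties from this sheet, and its smooth structure is compared with that of \<open>P\<close> by
  translations. The obstacle in (b) is the topology. Iterated derivatives are taken along fixed
  vectors, while the chain rule differentiates the outer function along a moving one. Expanding the
  moving vector in a fixed orthogonal set repairs this, with coefficients depending on the inner map
  only; so the estimates for pullbacks are uniform in the function. On the group side, generators
  are handled as families over a fixed index set, so that their number never grows and minimal
  cardinality survives.\<close>

lemma iter_deriv_append: "iter_deriv (us @ vs) f = iter_deriv us (iter_deriv vs f)"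
  by (induction us) auto

text \<open>\<open>frechet_derivative\<close> is a choice from the predicate
  \<open>has_derivative\<close>, so equality follows once the two predicates agree, at points of
  non-differentiability too.\<close>

lemma frechet_derivative_cong_open:
  assumes "open S" "x \<in> S" "\<And>y. y \<in> S \<Longrightarrow> f y = g y"
  shows "frechet_derivative f (at x) = frechet_derivative g (at x)"
proof -
  have "(f has_derivative D) (at x) \<longleftrightarrow> (g has_derivative D) (at x)" for D
    using assms has_derivative_transform_within_open by (metis (no_types, lifting))
  then show ?thesis
    by (simp add: frechet_derivative_def)
qed

lemma differentiable_cong_open:
  assumes "open S" "x \<in> S" "\<And>y. y \<in> S \<Longrightarrow> f y = g y" "f differentiable (at x)"
  shows "g differentiable (at x)"
  using assms has_derivative_transform_within_open unfolding differentiable_def by metis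

lemma iter_deriv_cong_open:
  assumes "open S" "\<And>y. y \<in> S \<Longrightarrow> f y = g y" "x \<in> S"
  shows "iter_deriv vs f x = iter_deriv vs g x"
  using assms(3)
proof (induction vs arbitrary: x)
  case Nil
  then show ?case using assms by simp
next
  case (Cons v vs)
  then show ?case
    using frechet_derivative_cong_open[OF assms(1) Cons.prems, of "iter_deriv vs f" "iter_deriv vs g"] by simp
qed

lemma smooth_on_subset: "smooth_on S f \<Longrightarrow> T \<subseteq> S \<Longrightarrow> smooth_on T f"
  unfolding smooth_on_def by blast

lemma smooth_on_local:
  assumes "\<And>x. x \<in> S \<Longrightarrow> \<exists>T g. open T \<and> x \<in> T \<and> smooth_on T g \<and> (\<forall>y\<in>T. f y = g y)"
  shows "smooth_on S f"
  unfolding smooth_on_def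
proof (intro allI ballI)
  fix vs x
  assume "x \<in> S"
  then obtain T g where T: "open T" "x \<in> T" "smooth_on T g" "\<And>y. y \<in> T \<Longrightarrow> f y = g y"
    using assms by metis
  have "iter_deriv vs g differentiable (at x)"
    using T unfolding smooth_on_def by blast
  moreover have "\<And>y. y \<in> T \<Longrightarrow> iter_deriv vs g y = iter_deriv vs f y"
    using iter_deriv_cong_open[OF T(1)] T(4) by metis
  ultimately show "iter_deriv vs f differentiable (at x)"
    using differentiable_cong_open[OF T(1,2)] by blast
qed

lemma smooth_on_cong:
  assumes "smooth_on S f" "open S" "\<And>x. x \<in> S \<Longrightarrow> g x = f x"
  shows "smooth_on S g"
  using assms smooth_on_local by metis

text \<open>The last entry of the list is differentiated first. Splitting lists at the end therefore
  exposes the derivative of \<open>f\<close> itself, and all further derivatives are derivatives of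
  that function.\<close>

lemma smooth_on_rec:
  "smooth_on S f \<longleftrightarrow> (\<forall>x\<in>S. f differentiable (at x)) \<and>
     (\<forall>v. smooth_on S (\<lambda>x. frechet_derivative f (at x) v))"
proof safe
  show "f differentiable (at x)" if "smooth_on S f" "x \<in> S" for x
    using that unfolding smooth_on_def by (metis iter_deriv.simps(1))
  show "smooth_on S (\<lambda>x. frechet_derivative f (at x) v)" if "smooth_on S f" for v
    unfolding smooth_on_def
  proof (intro allI ballI)
    fix vs x assume "x \<in> S"
    then have "iter_deriv (vs @ [v]) f differentiable (at x)"
      using that unfolding smooth_on_def by blast
    then show "iter_deriv vs (\<lambda>x. frechet_derivative f (at x) v) differentiable (at x)"
      by (simp add: iter_deriv_append)
  qed
  assume *: "\<forall>x\<in>S. f differentiable (at x)" "\<forall>v. smooth_on S (\<lambda>x. frechet_derivative f (at x) v)"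
  show "smooth_on S f"
    unfolding smooth_on_def
  proof (intro allI ballI)
    fix vs x assume x: "x \<in> S"
    show "iter_deriv vs f differentiable (at x)"
    proof (cases vs rule: rev_cases)
      case Nil
      then show ?thesis using * x by simp
    next
      case (snoc us v)
      then show ?thesis using *(2) x unfolding smooth_on_def by (simp add: iter_deriv_append)
    qed
  qed
qed

lemma smooth_on_frechet_derivative:
  "smooth_on S f \<Longrightarrow> smooth_on S (\<lambda>x. frechet_derivative f (at x) v)"
  using smooth_on_rec by blast

lemma smooth_on_iter_deriv: "smooth_on S f \<Longrightarrow> smooth_on S (iter_deriv vs f)"
  by (induction vs) (auto intro: smooth_on_frechet_derivative)

lemma smooth_on_imp_differentiable: "smooth_on S f \<Longrightarrow> x \<in> S \<Longrightarrow> f differentiable (at x)"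
  using smooth_on_rec by blast

lemma smooth_on_imp_continuous_on: "smooth_on S f \<Longrightarrow> continuous_on S f"
  by (meson continuous_at_imp_continuous_on differentiable_imp_continuous_within
      smooth_on_imp_differentiable)

lemma smooth_on_imp_has_derivative:
  "smooth_on S f \<Longrightarrow> x \<in> S \<Longrightarrow> (f has_derivative frechet_derivative f (at x)) (at x)"
  using frechet_derivative_works smooth_on_imp_differentiable by blast

subsection \<open>Finite orders of differentiability\<close>

text \<open>Differentiability of all directional derivatives of order at most \<open>n\<close>. The
  product and chain rules are proved by induction on this order, each differentiation costing one;
  \<open>smooth_on\<close> offers no such measure.\<close>

primrec diff_order ::
  "nat \<Rightarrow> 'e::real_normed_vector set \<Rightarrow> ('e \<Rightarrow> 'f::real_normed_vector) \<Rightarrow> bool" where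
  "diff_order 0 S f \<longleftrightarrow> (\<forall>x\<in>S. f differentiable (at x))"
| "diff_order (Suc n) S f \<longleftrightarrow> (\<forall>x\<in>S. f differentiable (at x)) \<and>
     (\<forall>v. diff_order n S (\<lambda>x. frechet_derivative f (at x) v))"

lemma diff_order_imp_differentiable: "diff_order n S f \<Longrightarrow> x \<in> S \<Longrightarrow> f differentiable (at x)"
  by (cases n) auto

lemma diff_order_Suc_imp: "diff_order (Suc n) S f \<Longrightarrow> diff_order n S f"
  by (induction n arbitrary: f) auto

lemma diff_order_iff_iter_deriv:
  "diff_order n S f \<longleftrightarrow> (\<forall>vs. length vs \<le> n \<longrightarrow> (\<forall>x\<in>S. iter_deriv vs f differentiable (at x)))"
proof (induction n arbitrary: f)
  case 0
  then show ?case by simp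
next
  case (Suc n)
  show ?case (is "_ = ?R")
  proof
    assume L: "diff_order (Suc n) S f"
    show ?R
    proof (intro allI impI)
      fix vs :: "'a list" assume "length vs \<le> Suc n"
      with L Suc.IH show "\<forall>x\<in>S. iter_deriv vs f differentiable (at x)"
        by (cases vs rule: rev_cases) (auto simp: iter_deriv_append)
    qed
  next
    assume R: ?R
    have "diff_order n S (\<lambda>x. frechet_derivative f (at x) v)" for v
      unfolding Suc.IH using R[THEN spec, of "_ @ [v]"] by (simp add: iter_deriv_append)
    moreover have "\<forall>x\<in>S. f differentiable (at x)"
      using R[THEN spec, of "[]"] by simp
    ultimately show "diff_order (Suc n) S f" by simp
  qed
qed

lemma smooth_on_iff_diff_order: "smooth_on S f \<longleftrightarrow> (\<forall>n. diff_order n S f)"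
  unfolding smooth_on_def diff_order_iff_iter_deriv by blast

lemma diff_order_cong:
  assumes "open S" "\<And>x. x \<in> S \<Longrightarrow> g x = f x" "diff_order n S f"
  shows "diff_order n S g"
proof -
  have "iter_deriv vs g differentiable (at x)"
    if "iter_deriv vs f differentiable (at x)" "x \<in> S" for vs x
    by (rule differentiable_cong_open[OF assms(1) that(2) _ that(1)])
      (metis iter_deriv_cong_open assms(1,2))
  then show ?thesis
    using assms(3) unfolding diff_order_iff_iter_deriv by blast
qed

text \<open>Allows the derivative to be given by a formula \<open>D\<close>: uniqueness of
  derivatives turns the chosen \<open>frechet_derivative\<close> into \<open>D x\<close> on the open
  set.\<close>

lemma diff_order_SucI:
  assumes "open S" "\<And>x. x \<in> S \<Longrightarrow> (f has_derivative D x) (at x)"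
    and "\<And>v. diff_order n S (\<lambda>x. D x v)"
  shows "diff_order (Suc n) S f"
proof -
  have "diff_order n S (\<lambda>x. frechet_derivative f (at x) v)" for v
    using frechet_derivative_at[OF assms(2)] by (intro diff_order_cong[OF assms(1) _ assms(3)[of v]]) metis
  moreover have "\<forall>x\<in>S. f differentiable (at x)"
    using assms(2) differentiableI by blast
  ultimately show ?thesis by simp
qed

lemma diff_order_has_derivative:
  "diff_order n S f \<Longrightarrow> x \<in> S \<Longrightarrow> (f has_derivative frechet_derivative f (at x)) (at x)"
  using diff_order_imp_differentiable frechet_derivative_works by blast

lemma diff_order_const: "diff_order n S (\<lambda>x. c)"
  by (induction n arbitrary: c) auto

lemma diff_order_bounded_linear:
  assumes "bounded_linear L" "open S"
  shows "diff_order n S L"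
proof (cases n)
  case 0
  then show ?thesis
    using bounded_linear_imp_differentiable[OF assms(1)] by auto
next
  case (Suc m)
  show ?thesis
    unfolding Suc
    by (rule diff_order_SucI[OF assms(2) bounded_linear_imp_has_derivative[OF assms(1)] diff_order_const])
qed

lemma diff_order_add:
  assumes "open S" "diff_order n S f" "diff_order n S g"
  shows "diff_order n S (\<lambda>x. f x + g x)"
  using assms(2,3)
proof (induction n arbitrary: f g)
  case 0
  then show ?case by (auto intro: differentiable_add)
next
  case (Suc n)
  show ?case
    by (rule diff_order_SucI[OF assms(1) has_derivative_add[OF diff_order_has_derivative[OF Suc.prems(1)]
          diff_order_has_derivative[OF Suc.prems(2)]]]) (use Suc in auto)
qed

lemma diff_order_bilinear:
  assumes "bounded_bilinear prd" "open S" "diff_order n S f" "diff_order n S g"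
  shows "diff_order n S (\<lambda>x. prd (f x) (g x))"
  using assms(3,4)
proof (induction n arbitrary: f g)
  case 0
  then show ?case
    using bounded_bilinear.FDERIV[OF assms(1)] unfolding diff_order.simps differentiable_def by metis
next
  case (Suc n)
  show ?case
  proof (rule diff_order_SucI[OF assms(2) bounded_bilinear.FDERIV[OF assms(1)
        diff_order_has_derivative[OF Suc.prems(1)] diff_order_has_derivative[OF Suc.prems(2)]]])
    fix v
    have "diff_order n S (\<lambda>x. prd (f x) (frechet_derivative g (at x) v))"
      using Suc.prems(1)[THEN diff_order_Suc_imp] Suc.prems(2) by (intro Suc.IH) auto
    moreover have "diff_order n S (\<lambda>x. prd (frechet_derivative f (at x) v) (g x))"
      using Suc.prems(2)[THEN diff_order_Suc_imp] Suc.prems(1) by (intro Suc.IH) auto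
    ultimately show "diff_order n S (\<lambda>x. prd (f x) (frechet_derivative g (at x) v) +
        prd (frechet_derivative f (at x) v) (g x))"
      by (rule diff_order_add[OF assms(2)])
  qed
qed

lemma diff_order_sum:
  assumes "open S" "\<And>i. i \<in> I \<Longrightarrow> diff_order n S (f i)"
  shows "diff_order n S (\<lambda>x. \<Sum>i\<in>I. f i x)"
  using assms(2)
  by (induction I rule: infinite_finite_induct) (auto intro: diff_order_const diff_order_add assms(1))

lemma diff_order_linear_comp:
  assumes "bounded_linear L" "open S" "diff_order n S f"
  shows "diff_order n S (\<lambda>x. L (f x))"
  using assms(3)
proof (induction n arbitrary: f)
  case 0
  then show ?case
    using bounded_linear.has_derivative[OF assms(1)] unfolding diff_order.simps differentiable_def by metis
next
  case (Suc n)
  show ?case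
    by (rule diff_order_SucI[OF assms(2) bounded_linear.has_derivative[OF assms(1)
          diff_order_has_derivative[OF Suc.prems]]]) (use Suc in auto)
qed

subsection \<open>Finite-dimensional inner product spaces\<close>

text \<open>Gram-Schmidt gives a spanning orthogonal set, and the coefficients follow by taking
  inner products. The set may contain the zero vector, whose term is zero whatever its
  coefficient.\<close>

lemma finite_dim_expansion:
  assumes "\<exists>B::'e::real_inner set. finite B \<and> span B = UNIV"
  obtains C :: "'e::real_inner set" where "finite C" "\<And>v. (\<Sum>c\<in>C. (v \<bullet> c / (c \<bullet> c)) *\<^sub>R c) = v"
proof -
  obtain B :: "'e set" where B: "finite B" "span B = UNIV"
    using assms by blast
  obtain C :: "'e set" where C: "finite C" "span C = UNIV" "pairwise orthogonal C"
    using basis_orthogonal[OF B(1)] B(2) by auto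
  have "(\<Sum>c\<in>C. (v \<bullet> c / (c \<bullet> c)) *\<^sub>R c) = v" for v
  proof -
    have "v \<in> span C" using C by simp
    then obtain u where u: "v = (\<Sum>c\<in>C. u c *\<^sub>R c)"
      using span_finite[OF C(1)] by auto
    have "(v \<bullet> c / (c \<bullet> c)) *\<^sub>R c = u c *\<^sub>R c" if "c \<in> C" for c
    proof -
      have "v \<bullet> c = (\<Sum>d\<in>C. u d * (d \<bullet> c))"
        unfolding u by (simp add: inner_sum_left)
      also have "\<dots> = (\<Sum>d\<in>C. if d = c then u c * (c \<bullet> c) else 0)"
        using C(3) that by (intro sum.cong) (auto simp: pairwise_def orthogonal_def)
      also have "\<dots> = u c * (c \<bullet> c)"
        using C(1) that by simp
      finally show ?thesis by (cases "c = 0") auto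
    qed
    then have "(\<Sum>c\<in>C. (v \<bullet> c / (c \<bullet> c)) *\<^sub>R c) = (\<Sum>c\<in>C. u c *\<^sub>R c)"
      by (intro sum.cong refl)
    then show ?thesis
      by (simp only: u[symmetric])
  qed
  then show thesis by (rule that[OF C(1)])
qed

text \<open>The coefficients of the expansion are bounded on the ball, so the ball is a closed
  subset of a box of coefficients, and such a box is a finite sum of compact segments.\<close>

lemma compact_cball_finite_dim:
  fixes a :: "'e::real_inner"
  assumes "\<exists>B::'e set. finite B \<and> span B = UNIV"
  shows "compact (cball a r)"
proof -
  obtain C :: "'e set" where C: "finite C" "\<And>v. (\<Sum>c\<in>C. (v \<bullet> c / (c \<bullet> c)) *\<^sub>R c) = v"
    using finite_dim_expansion[OF assms] by blast
  define box where "box R D = {\<Sum>c\<in>D. t c *\<^sub>R c | t. \<forall>c\<in>D. \<bar>t c\<bar> \<le> R c}" for R :: "'e \<Rightarrow> real" and D :: "'e set"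
  have box: "compact (box R D)" if "finite D" for R D
    using that
  proof (induction D)
    case empty
    have "box R {} = {0}" unfolding box_def by auto
    then show ?case by simp
  next
    case (insert d D)
    have seg: "compact ((\<lambda>t. t *\<^sub>R d) ` {-R d..R d})"
      by (intro compact_continuous_image continuous_intros compact_Icc)
    have "box R (insert d D) = {x + y | x y. x \<in> (\<lambda>t. t *\<^sub>R d) ` {-R d..R d} \<and> y \<in> box R D}"
    proof safe
      fix x assume "x \<in> box R (insert d D)"
      then obtain t where t: "x = (\<Sum>c\<in>insert d D. t c *\<^sub>R c)" "\<forall>c\<in>insert d D. \<bar>t c\<bar> \<le> R c"
        unfolding box_def by blast
      have "x = t d *\<^sub>R d + (\<Sum>c\<in>D. t c *\<^sub>R c)"
        using t insert by simp
      moreover have "(\<Sum>c\<in>D. t c *\<^sub>R c) \<in> box R D"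
        using t unfolding box_def by blast
      moreover have "t d \<in> {-R d..R d}" using t by auto
      ultimately show "\<exists>xa y. x = xa + y \<and> xa \<in> (\<lambda>t. t *\<^sub>R d) ` {-R d..R d} \<and> y \<in> box R D"
        by blast
    next
      fix s y assume s: "s \<in> {-R d..R d}" and "y \<in> box R D"
      then obtain t where t: "y = (\<Sum>c\<in>D. t c *\<^sub>R c)" "\<forall>c\<in>D. \<bar>t c\<bar> \<le> R c"
        unfolding box_def by blast
      have "(\<Sum>c\<in>insert d D. (t(d := s)) c *\<^sub>R c) = s *\<^sub>R d + y"
        using insert t by (auto intro!: sum.cong)
      moreover have "\<forall>c\<in>insert d D. \<bar>(t(d := s)) c\<bar> \<le> R c"
        using s t by auto
      ultimately show "s *\<^sub>R d + y \<in> box R (insert d D)"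
        unfolding box_def by (intro CollectI exI[of _ "t(d := s)"]) simp
    qed
    then show ?case
      using compact_sums[OF seg insert.IH] by simp
  qed
  \<comment> \<open>The side lengths are the Cauchy-Schwarz bounds for the coefficients of a vector
    of norm at most \<open>r\<close>.\<close>
  have "cball 0 r \<subseteq> box (\<lambda>c. r * norm c / (c \<bullet> c)) C"
  proof
    fix v :: 'e assume "v \<in> cball 0 r"
    then have "\<bar>v \<bullet> c / (c \<bullet> c)\<bar> \<le> r * norm c / (c \<bullet> c)" for c
      using Cauchy_Schwarz_ineq2[of v c] mult_right_mono[of "norm v" r "norm c"]
      by (simp add: abs_divide divide_right_mono)
    then show "v \<in> box (\<lambda>c. r * norm c / (c \<bullet> c)) C"
      unfolding box_def using C(2)[of v, symmetric]
      by (intro CollectI exI[of _ "\<lambda>c. v \<bullet> c / (c \<bullet> c)"]) simp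
  qed
  then have "compact (cball (0::'e) r)"
    using box[OF C(1)] by (metis closed_cball compact_Int_closed inf.absorb_iff2)
  then have "compact ((+) a ` cball 0 r)"
    by (rule compact_translation)
  then show ?thesis
    by simp
qed

lemma linear_finite_dim_expansion:
  assumes "linear L" "(\<Sum>c\<in>C. (v \<bullet> c / (c \<bullet> c)) *\<^sub>R c) = v"
  shows "L v = (\<Sum>c\<in>C. (v \<bullet> c / (c \<bullet> c)) *\<^sub>R L c)"
  by (subst assms(2)[symmetric]) (simp add: linear_sum[OF assms(1)] linear_scale[OF assms(1)])

subsection \<open>Closure properties of smooth maps\<close>

text \<open>Finite-dimensionality enters through the chain rule
  \<open>D\<^sub>v (g \<circ> f) = \<Sum>\<^sub>c (D\<^sub>v f \<bullet> c / c \<bullet> c) (D\<^sub>c g \<circ> f)\<close> over an orthogonal basis, which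
  expresses the derivative by directional derivatives of \<open>g\<close> along fixed vectors.\<close>

lemma has_derivative_comp_expansion:
  fixes g :: "'e::real_inner \<Rightarrow> 'f::real_normed_vector"
  assumes C: "\<And>v. (\<Sum>c\<in>C. (v \<bullet> c / (c \<bullet> c)) *\<^sub>R c) = v"
    and f: "(f has_derivative Df) (at x)" and g: "g differentiable (at (f x))"
  shows "((\<lambda>x. g (f x)) has_derivative
     (\<lambda>v. \<Sum>c\<in>C. (Df v \<bullet> c / (c \<bullet> c)) *\<^sub>R frechet_derivative g (at (f x)) c)) (at x)"
proof -
  have "((\<lambda>x. g (f x)) has_derivative (\<lambda>v. frechet_derivative g (at (f x)) (Df v))) (at x)"
    using diff_chain_at[OF f g[unfolded frechet_derivative_works]] by (simp add: o_def)
  moreover have "frechet_derivative g (at (f x)) (Df v) =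
      (\<Sum>c\<in>C. (Df v \<bullet> c / (c \<bullet> c)) *\<^sub>R frechet_derivative g (at (f x)) c)" for v
    by (rule linear_finite_dim_expansion[OF linear_frechet_derivative[OF g] C])
  ultimately show ?thesis by simp
qed

text \<open>Only \<open>g\<close> is generalised in the induction: after one differentiation the
  composites that occur are those of \<open>f\<close> with directional derivatives of
  \<open>g\<close> along basis vectors, and these have order one less.\<close>

lemma diff_order_comp:
  fixes g :: "'e::real_inner \<Rightarrow> 'f::real_normed_vector"
  assumes fd: "\<exists>B::'e set. finite B \<and> span B = UNIV" and "open S"
    and "f ` S \<subseteq> T" "diff_order n S f" "diff_order n T g"
  shows "diff_order n S (\<lambda>x. g (f x))"
proof -
  obtain C :: "'e set" where C: "finite C" "\<And>v. (\<Sum>c\<in>C. (v \<bullet> c / (c \<bullet> c)) *\<^sub>R c) = v"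
    using finite_dim_expansion[OF fd] by blast
  show ?thesis
    using assms(4,5)
  proof (induction n arbitrary: g)
    case 0
    have "(\<lambda>x. g (f x)) differentiable (at x)" if "x \<in> S" for x
    proof -
      have "g differentiable (at (f x))"
        using 0(2) that assms(3) by auto
      then show ?thesis
        by (rule differentiableI[OF has_derivative_comp_expansion[OF C(2)
              diff_order_has_derivative[OF 0(1) that]]])
    qed
    then show ?case by simp
  next
    case (Suc n)
    have g: "g differentiable (at (f x))" if "x \<in> S" for x
      using diff_order_imp_differentiable[OF Suc.prems(2)] that assms(3) by blast
    show ?case
    proof (rule diff_order_SucI[OF assms(2)
          has_derivative_comp_expansion[OF C(2) diff_order_has_derivative[OF Suc.prems(1)] g]])
      fix v
      have "diff_order n S (\<lambda>x. (frechet_derivative f (at x) v \<bullet> c / (c \<bullet> c)) *\<^sub>R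
          frechet_derivative g (at (f x)) c)" for c
      proof (rule diff_order_bilinear[OF bounded_bilinear_scaleR assms(2)])
        have "bounded_linear (\<lambda>w. w \<bullet> c / (c \<bullet> c))"
          by (intro bounded_linear_divide bounded_linear_inner_left
              bounded_linear_compose[OF bounded_linear_divide bounded_linear_inner_left])
        then show "diff_order n S (\<lambda>x. frechet_derivative f (at x) v \<bullet> c / (c \<bullet> c))"
          using Suc.prems(1) by (intro diff_order_linear_comp[OF _ assms(2), where L="\<lambda>w. w \<bullet> c / (c \<bullet> c)"]) auto
        show "diff_order n S (\<lambda>x. frechet_derivative g (at (f x)) c)"
          using Suc.prems diff_order_Suc_imp by (intro Suc.IH) auto
      qed
      then show "diff_order n S (\<lambda>x. \<Sum>c\<in>C. (frechet_derivative f (at x) v \<bullet> c / (c \<bullet> c)) *\<^sub>R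
          frechet_derivative g (at (f x)) c)"
        by (rule diff_order_sum[OF assms(2)])
    qed
  qed
qed

lemma diff_order_inverse:
  fixes f :: "'e::real_normed_vector \<Rightarrow> 'f::real_normed_field"
  assumes "open S" "diff_order n S f" "\<And>x. x \<in> S \<Longrightarrow> f x \<noteq> 0"
  shows "diff_order n S (\<lambda>x. inverse (f x))"
  using assms(2)
proof (induction n)
  case 0
  then show ?case using assms(3) by (auto intro: differentiable_inverse)
next
  case (Suc n)
  \<comment> \<open>The derivative of 1/f contains 1/f again, but only at order \<open>n\<close>,
    where the induction hypothesis provides it.\<close>
  note * = Suc.IH[OF diff_order_Suc_imp[OF Suc.prems]]
  show ?case
  proof (rule diff_order_SucI[OF assms(1) Deriv.has_derivative_inverse[OF assms(3)
          diff_order_has_derivative[OF Suc.prems]]])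
    fix v
    have "diff_order n S (\<lambda>x. frechet_derivative f (at x) v)" using Suc.prems by simp
    then have "diff_order n S (\<lambda>x. inverse (f x) * frechet_derivative f (at x) v * inverse (f x))"
      by (intro diff_order_bilinear[OF bounded_bilinear_mult assms(1)] *)
    then show "diff_order n S (\<lambda>x. - (inverse (f x) * frechet_derivative f (at x) v * inverse (f x)))"
      by (rule diff_order_linear_comp[OF bounded_linear_minus[OF bounded_linear_ident] assms(1)])
  qed auto
qed

section \<open>The rules for finite order carried over to smooth maps\<close>

lemma smooth_on_const: "smooth_on S (\<lambda>x. c)"
  by (simp add: smooth_on_iff_diff_order diff_order_const)

lemma smooth_on_bounded_linear: "bounded_linear L \<Longrightarrow> open S \<Longrightarrow> smooth_on S L"
  by (simp add: smooth_on_iff_diff_order diff_order_bounded_linear)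

lemma smooth_on_add:
  "open S \<Longrightarrow> smooth_on S f \<Longrightarrow> smooth_on S g \<Longrightarrow> smooth_on S (\<lambda>x. f x + g x)"
  by (simp add: smooth_on_iff_diff_order diff_order_add)

lemma smooth_on_bilinear:
  "bounded_bilinear prd \<Longrightarrow> open S \<Longrightarrow> smooth_on S f \<Longrightarrow> smooth_on S g \<Longrightarrow>
    smooth_on S (\<lambda>x. prd (f x) (g x))"
  by (simp add: smooth_on_iff_diff_order diff_order_bilinear)

lemma smooth_on_linear_comp:
  "bounded_linear L \<Longrightarrow> open S \<Longrightarrow> smooth_on S f \<Longrightarrow> smooth_on S (\<lambda>x. L (f x))"
  by (simp add: smooth_on_iff_diff_order diff_order_linear_comp)

lemma smooth_on_comp:
  fixes g :: "'e::real_inner \<Rightarrow> 'f::real_normed_vector"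
  assumes "\<exists>B::'e set. finite B \<and> span B = UNIV" "open S" "smooth_on S f" "smooth_on T g" "f ` S \<subseteq> T"
  shows "smooth_on S (\<lambda>x. g (f x))"
  using assms diff_order_comp by (metis smooth_on_iff_diff_order)

lemma smooth_on_inverse:
  fixes f :: "'e::real_normed_vector \<Rightarrow> 'f::real_normed_field"
  shows "open S \<Longrightarrow> smooth_on S f \<Longrightarrow> (\<And>x. x \<in> S \<Longrightarrow> f x \<noteq> 0) \<Longrightarrow> smooth_on S (\<lambda>x. inverse (f x))"
  by (simp add: smooth_on_iff_diff_order diff_order_inverse)

subsection \<open>Bump functions on the model space\<close>

text \<open>The index \<open>k\<close> is carried along because differentiation leads from
  \<open>k\<close> to a combination of \<open>k + 1\<close> and \<open>k + 2\<close>. The linear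
  span of the family is thus closed under derivatives, which the single function exp(-1/t) is
  not.\<close>

definition flat_fun :: "nat \<Rightarrow> real \<Rightarrow> real" where
  "flat_fun k t = (if t > 0 then (1 / t) ^ k * exp (- (1 / t)) else 0)"

lemma flat_fun_tendsto_0: "(flat_fun k \<longlongrightarrow> 0) (at_right 0)"
proof -
  have "((\<lambda>x::real. x ^ k / exp x) \<longlongrightarrow> 0) at_top"
    by (rule tendsto_power_div_exp_0)
  then have "((\<lambda>t::real. inverse t ^ k / exp (inverse t)) \<longlongrightarrow> 0) (at_right 0)"
    by (rule filterlim_compose[OF _ filterlim_inverse_at_top_right])
  moreover have "\<forall>\<^sub>F t in at_right 0. inverse t ^ k / exp (inverse t) = flat_fun k t"
    unfolding eventually_at_right_field flat_fun_def
    by (intro exI[of _ 1]) (auto simp: exp_minus field_simps)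
  ultimately show ?thesis
    by (rule Lim_transform_eventually)
qed

lemma flat_fun_DERIV:
  "(flat_fun k has_real_derivative - real k * flat_fun (Suc k) t + flat_fun (Suc (Suc k)) t) (at t)"
proof -
  consider "t > 0" | "t < 0" | "t = 0" by linarith
  then show ?thesis
  proof cases
    case 1
    have "((\<lambda>t. (1 / t) ^ k * exp (- (1 / t))) has_real_derivative
        - real k * flat_fun (Suc k) t + flat_fun (Suc (Suc k)) t) (at t)"
    proof (cases k)
      case 0
      then show ?thesis
        using 1 by (auto intro!: derivative_eq_intros simp: flat_fun_def field_simps power2_eq_square)
    next
      case (Suc j)
      then show ?thesis
        using 1 by (auto intro!: derivative_eq_intros simp: flat_fun_def field_simps power2_eq_square)
          (cases j; simp)
    qed
    then show ?thesis
      by (rule has_field_derivative_transform_within_open[of _ _ _ "{0<..}"]) (use 1 in \<open>auto simp: flat_fun_def\<close>)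
  next
    case 2
    have "((\<lambda>t. 0) has_real_derivative 0) (at t)" by simp
    then have "(flat_fun k has_real_derivative 0) (at t)"
      by (rule has_field_derivative_transform_within_open[of _ _ _ "{..<0}"]) (use 2 in \<open>auto simp: flat_fun_def\<close>)
    then show ?thesis using 2 by (simp add: flat_fun_def)
  next
    case 3
    \<comment> \<open>At 0 the difference quotient is the next member of the family, so the
      derivative there is the limit of that member at 0.\<close>
    have quot: "(flat_fun k y - flat_fun k 0) / (y - 0) = flat_fun (Suc k) y" for y
      by (auto simp: flat_fun_def)
    have "((\<lambda>y. flat_fun (Suc k) y) \<longlongrightarrow> 0) (at_left 0)"
    proof (rule tendsto_eventually)
      show "\<forall>\<^sub>F y in at_left 0. flat_fun (Suc k) y = 0"
        unfolding eventually_at_left_field by (intro exI[of _ "-1"]) (auto simp: flat_fun_def)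
    qed
    then have "((\<lambda>y. flat_fun (Suc k) y) \<longlongrightarrow> 0) (at 0)"
      using flat_fun_tendsto_0 filterlim_split_at by blast
    then have "(flat_fun k has_real_derivative 0) (at 0)"
      unfolding has_field_derivative_iff quot .
    then show ?thesis using 3 by (simp add: flat_fun_def)
  qed
qed

lemma smooth_on_flat_fun: "smooth_on UNIV (flat_fun k)"
proof -
  have "diff_order n UNIV (flat_fun k)" for n
  proof (induction n arbitrary: k)
    case 0
    then show ?case
      using flat_fun_DERIV real_differentiableE unfolding diff_order.simps
      by (metis differentiableI has_field_derivative_imp_has_derivative)
  next
    case (Suc n)
    show ?case
    proof (rule diff_order_SucI[OF open_UNIV flat_fun_DERIV[THEN has_field_derivative_imp_has_derivative]])
      fix v
      have "diff_order n UNIV (\<lambda>x. v * (- real k * flat_fun (Suc k) x + flat_fun (Suc (Suc k)) x))"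
        by (intro diff_order_linear_comp[OF bounded_linear_mult_right open_UNIV] diff_order_add[OF open_UNIV] Suc)
      then show "diff_order n UNIV (\<lambda>x. (- real k * flat_fun (Suc k) x + flat_fun (Suc (Suc k)) x) * v)"
        by (simp add: mult.commute)
    qed
  qed
  then show ?thesis by (simp add: smooth_on_iff_diff_order)
qed

text \<open>The quotient u / (u + w), where u is positive exactly inside the ball of radius
  \<open>r\<close> and w exactly outside the closed ball of radius r/2. Squared distances keep it
  smooth at the centre.\<close>

definition bump :: "'e::real_inner \<Rightarrow> real \<Rightarrow> 'e \<Rightarrow> real" where
  "bump a r x = flat_fun 0 (r\<^sup>2 - (x - a) \<bullet> (x - a)) *
     inverse (flat_fun 0 (r\<^sup>2 - (x - a) \<bullet> (x - a)) + flat_fun 0 ((x - a) \<bullet> (x - a) - r\<^sup>2 / 4))"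

lemma flat_fun_nonneg: "0 \<le> flat_fun k t"
  by (simp add: flat_fun_def)

text \<open>The conditions s < r^2 and s > r^2 / 4 together cover the real line, so one summand is
  always positive.\<close>

lemma bump_denominator_pos:
  assumes "r > 0"
  shows "flat_fun 0 (r\<^sup>2 - s) + flat_fun 0 (s - r\<^sup>2 / 4) > 0"
proof (cases "s < r\<^sup>2")
  case True
  then have "flat_fun 0 (r\<^sup>2 - s) > 0" by (simp add: flat_fun_def)
  then show ?thesis using flat_fun_nonneg by (rule add_pos_nonneg)
next
  case False
  moreover have "r\<^sup>2 > 0" using assms by simp
  ultimately have "s - r\<^sup>2 / 4 > 0" by linarith
  then have "flat_fun 0 (s - r\<^sup>2 / 4) > 0" by (simp add: flat_fun_def)
  then show ?thesis using flat_fun_nonneg by (intro add_nonneg_pos)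
qed

lemma bump_range: "r > 0 \<Longrightarrow> 0 \<le> bump a r x \<and> bump a r x \<le> 1"
  using bump_denominator_pos[of r "(x - a) \<bullet> (x - a)"] flat_fun_nonneg[of 0]
  unfolding bump_def by (auto simp: field_simps)

lemma bump_eq_1:
  assumes "r > 0" "dist x a \<le> r / 2"
  shows "bump a r x = 1"
proof -
  have "(x - a) \<bullet> (x - a) \<le> (r / 2)\<^sup>2"
    using assms by (simp add: dist_norm dot_square_norm power_mono)
  then have "flat_fun 0 ((x - a) \<bullet> (x - a) - r\<^sup>2 / 4) = 0"
    by (simp add: flat_fun_def power_divide)
  then show ?thesis
    using bump_denominator_pos[OF assms(1), of "(x - a) \<bullet> (x - a)"] unfolding bump_def by simp
qed

lemma bump_eq_0:
  assumes "r > 0" "dist x a \<ge> r"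
  shows "bump a r x = 0"
proof -
  have "(x - a) \<bullet> (x - a) \<ge> r\<^sup>2"
    using assms by (simp add: dist_norm dot_square_norm power_mono)
  then show ?thesis
    unfolding bump_def by (simp add: flat_fun_def)
qed

lemma finite_dim_euclidean: "\<exists>B::'e::euclidean_space set. finite B \<and> span B = UNIV"
  using finite_Basis span_Basis by blast

lemma smooth_on_bump:
  assumes "r > 0"
  shows "smooth_on UNIV (bump a r)"
proof -
  have id: "smooth_on UNIV (\<lambda>x. x - a)"
    using smooth_on_add[OF open_UNIV smooth_on_bounded_linear[OF bounded_linear_ident open_UNIV]
        smooth_on_const, of "- a"] by simp
  have sq: "smooth_on UNIV (\<lambda>x. (x - a) \<bullet> (x - a))"
    by (rule smooth_on_bilinear[OF bounded_bilinear_inner open_UNIV id id])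
  have "smooth_on UNIV (\<lambda>x. - ((x - a) \<bullet> (x - a)))"
    by (rule smooth_on_linear_comp[OF bounded_linear_minus[OF bounded_linear_ident] open_UNIV sq])
  then have 1: "smooth_on UNIV (\<lambda>x. flat_fun 0 (r\<^sup>2 - (x - a) \<bullet> (x - a)))"
    using smooth_on_add[OF open_UNIV smooth_on_const, of "\<lambda>x. - ((x - a) \<bullet> (x - a))" "r\<^sup>2"]
    by (intro smooth_on_comp[OF finite_dim_euclidean open_UNIV _ smooth_on_flat_fun]) auto
  have 2: "smooth_on UNIV (\<lambda>x. flat_fun 0 ((x - a) \<bullet> (x - a) - r\<^sup>2 / 4))"
    using smooth_on_add[OF open_UNIV sq smooth_on_const, of "- (r\<^sup>2 / 4)"]
    by (intro smooth_on_comp[OF finite_dim_euclidean open_UNIV _ smooth_on_flat_fun]) auto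
  show ?thesis
    unfolding bump_def[abs_def]
    by (intro smooth_on_bilinear[OF bounded_bilinear_mult open_UNIV] smooth_on_inverse open_UNIV
        smooth_on_add 1 2) (metis assms bump_denominator_pos less_irrefl)
qed

section \<open>Smooth functions on manifolds\<close>

subsection \<open>Charts\<close>

lemma is_chartD:
  assumes "is_chart X (U, \<phi>)"
  shows "openin X U" "open (\<phi> ` U)" "homeomorphic_map (subtopology X U) (top_of_set (\<phi> ` U)) \<phi>"
    "U \<subseteq> topspace X" "inj_on \<phi> U"
proof -
  show 1: "openin X U" "open (\<phi> ` U)"
    and 2: "homeomorphic_map (subtopology X U) (top_of_set (\<phi> ` U)) \<phi>"
    using assms by (auto simp: is_chart_def)
  show 3: "U \<subseteq> topspace X"
    using 1 by (simp add: openin_subset)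
  show "inj_on \<phi> U"
    using homeomorphic_imp_injective_map[OF 2] 3 by (simp add: inf_absorb2)
qed

lemma chart_open_image:
  assumes "is_chart X (U, \<phi>)" "openin X W" "W \<subseteq> U"
  shows "open (\<phi> ` W)"
proof -
  have "openin (subtopology X U) W"
    using assms(2,3) by (simp add: openin_subset_topspace_eq openin_subtopology_alt) (metis inf.absorb2 image_eqI mem_Collect_eq)
  then have "openin (top_of_set (\<phi> ` U)) (\<phi> ` W)"
    using homeomorphic_imp_open_map[OF is_chartD(3)[OF assms(1)]] unfolding open_map_def by blast
  then show ?thesis
    using is_chartD(2)[OF assms(1)] by (metis openin_open_trans)
qed

lemma chart_open_preimage:
  assumes "is_chart X (U, \<phi>)" "open T"
  shows "openin X {x \<in> U. \<phi> x \<in> T}"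
proof -
  have c: "continuous_map (subtopology X U) (top_of_set (\<phi> ` U)) \<phi>"
    by (rule homeomorphic_imp_continuous_map[OF is_chartD(3)[OF assms(1)]])
  have "openin (top_of_set (\<phi> ` U)) (\<phi> ` U \<inter> T)"
    using assms(2) by (rule openin_open_Int)
  from openin_continuous_map_preimage[OF c this]
  have "openin (subtopology X U) {x \<in> U. \<phi> x \<in> T}"
    using is_chartD(4)[OF assms(1)] by (simp add: Collect_conj_eq Int_absorb1 cong: conj_cong)
  then show ?thesis
    using is_chartD(1)[OF assms(1)] openin_trans_full by blast
qed

text \<open>The part of \<open>smooth_manifold\<close> on charts, without smooth transitions. It
  suffices for most facts about smoothness at a point, and it can be verified for products with a
  group and for the orbit space independently of the compatibility of their charts.\<close>

definition charted :: "('a, 'e::real_inner) manifold \<Rightarrow> bool" where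
  "charted M \<longleftrightarrow> (\<forall>c\<in>atlas M. is_chart (mtop M) c) \<and> \<Union>(fst ` atlas M) = man_space M"

lemma smooth_manifold_charted: "smooth_manifold M \<Longrightarrow> charted M"
  unfolding smooth_manifold_def charted_def by blast

lemma charted_is_chart: "charted M \<Longrightarrow> (U, \<phi>) \<in> atlas M \<Longrightarrow> is_chart (mtop M) (U, \<phi>)"
  unfolding charted_def by blast

lemma charted_chart_at:
  assumes "charted M" "p \<in> man_space M"
  obtains U \<phi> where "(U, \<phi>) \<in> atlas M" "p \<in> U"
  using assms unfolding charted_def by fastforce

lemma smooth_manifold_finite_dim:
  "smooth_manifold (M :: ('a, 'e::real_inner) manifold) \<Longrightarrow> \<exists>B::'e set. finite B \<and> span B = UNIV"
  unfolding smooth_manifold_def by blast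

lemma smooth_manifold_transition:
  "smooth_manifold M \<Longrightarrow> (U, \<phi>) \<in> atlas M \<Longrightarrow> (V, \<psi>) \<in> atlas M \<Longrightarrow>
    smooth_on (\<phi> ` (U \<inter> V)) (\<psi> \<circ> inv_into U \<phi>)"
  unfolding smooth_manifold_def by (elim conjE) (drule (1) bspec; simp; drule (1) bspec; simp)

subsection \<open>Smoothness at a point\<close>

text \<open>All charts at \<open>p\<close> are tested, to match \<open>smooth_map\<close> and
  \<open>smooth_functions\<close>, but only on some small neighbourhood, so that the notion is local
  and stable under pointwise operations.\<close>

definition smooth_at ::
  "('a, 'e::real_inner) manifold \<Rightarrow> ('a \<Rightarrow> 'f::real_normed_vector) \<Rightarrow> 'a \<Rightarrow> bool" where
  "smooth_at M f p \<longleftrightarrow> (\<forall>(U, \<phi>)\<in>atlas M. p \<in> U \<longrightarrow>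
     (\<exists>T. open T \<and> \<phi> p \<in> T \<and> T \<subseteq> \<phi> ` U \<and> smooth_on T (f \<circ> inv_into U \<phi>)))"

lemma smooth_atD:
  assumes "smooth_at M f p" "(U, \<phi>) \<in> atlas M" "p \<in> U"
  obtains T where "open T" "\<phi> p \<in> T" "T \<subseteq> \<phi> ` U" "smooth_on T (f \<circ> inv_into U \<phi>)"
  using assms unfolding smooth_at_def by fast

text \<open>One chart is enough: in any other chart the function is precomposed with a transition
  map, to which the chain rule applies.\<close>

lemma smooth_atI_chart:
  assumes M: "smooth_manifold M" and U: "(U, \<phi>) \<in> atlas M" "p \<in> U"
    and T: "open T" "\<phi> p \<in> T" "smooth_on T (f \<circ> inv_into U \<phi>)"
  shows "smooth_at M f p"
  unfolding smooth_at_def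
proof (clarify)
  fix V \<psi> assume V: "(V, \<psi>) \<in> atlas M" "p \<in> V"
  note cU = charted_is_chart[OF smooth_manifold_charted[OF M] U(1)]
  note cV = charted_is_chart[OF smooth_manifold_charted[OF M] V(1)]
  define W where "W = {x \<in> U. \<phi> x \<in> T} \<inter> V"
  have W: "openin (mtop M) W" "W \<subseteq> V" "p \<in> W"
    unfolding W_def using chart_open_preimage[OF cU T(1)] is_chartD(1)[OF cV] U V T by auto
  have oW: "open (\<psi> ` W)"
    by (rule chart_open_image[OF cV W(1,2)])
  have "smooth_on (\<psi> ` W) (\<phi> \<circ> inv_into V \<psi>)"
    by (rule smooth_on_subset[OF smooth_manifold_transition[OF M V(1) U(1)]]) (auto simp: W_def)
  moreover have inv: "inv_into V \<psi> (\<psi> x) = x" if "x \<in> W" for x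
    using that W(2) is_chartD(5)[OF cV] by (simp add: subset_iff)
  ultimately have comp: "smooth_on (\<psi> ` W) (\<lambda>y. (f \<circ> inv_into U \<phi>) ((\<phi> \<circ> inv_into V \<psi>) y))"
    by (intro smooth_on_comp[OF smooth_manifold_finite_dim[OF M] oW _ T(3)]) (auto simp: W_def o_def)
  have "smooth_on (\<psi> ` W) (f \<circ> inv_into V \<psi>)"
    using inv is_chartD(5)[OF cU] by (intro smooth_on_cong[OF comp oW]) (auto simp: W_def)
  then show "\<exists>T. open T \<and> \<psi> p \<in> T \<and> T \<subseteq> \<psi> ` V \<and> smooth_on T (f \<circ> inv_into V \<psi>)"
    using oW W by (intro exI[of _ "\<psi> ` W"]) auto
qed

lemma smooth_at_cong:
  assumes "charted M" "smooth_at M g p" "openin (mtop M) W" "p \<in> W" "\<And>x. x \<in> W \<Longrightarrow> f x = g x"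
  shows "smooth_at M f p"
  unfolding smooth_at_def
proof (clarify)
  fix U \<phi> assume U: "(U, \<phi>) \<in> atlas M" "p \<in> U"
  note cU = charted_is_chart[OF assms(1) U(1)]
  obtain T where T: "open T" "\<phi> p \<in> T" "T \<subseteq> \<phi> ` U" "smooth_on T (g \<circ> inv_into U \<phi>)"
    using smooth_atD[OF assms(2) U] .
  have oW: "open (\<phi> ` (W \<inter> U))"
    using is_chartD(1)[OF cU] assms(3) by (intro chart_open_image[OF cU]) auto
  have "smooth_on (T \<inter> \<phi> ` (W \<inter> U)) (f \<circ> inv_into U \<phi>)"
    using is_chartD(5)[OF cU] assms(5)
    by (intro smooth_on_cong[OF smooth_on_subset[OF T(4)]] open_Int T(1) oW) auto
  then show "\<exists>T. open T \<and> \<phi> p \<in> T \<and> T \<subseteq> \<phi> ` U \<and> smooth_on T (f \<circ> inv_into U \<phi>)"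
    using T oW U assms(4) by (intro exI[of _ "T \<inter> \<phi> ` (W \<inter> U)"]) auto
qed

lemma smooth_at_op:
  fixes M :: "('a, 'e::real_inner) manifold"
  assumes "smooth_at M f p"
    and "\<And>(T :: 'e set) h. open T \<Longrightarrow> smooth_on T h \<Longrightarrow> smooth_on T (\<lambda>x. H (h x))"
  shows "smooth_at M (\<lambda>x. H (f x)) p"
  unfolding smooth_at_def
proof (clarify)
  fix U \<phi> assume U: "(U, \<phi>) \<in> atlas M" "p \<in> U"
  obtain T where T: "open T" "\<phi> p \<in> T" "T \<subseteq> \<phi> ` U" "smooth_on T (f \<circ> inv_into U \<phi>)"
    using smooth_atD[OF assms(1) U] .
  show "\<exists>T. open T \<and> \<phi> p \<in> T \<and> T \<subseteq> \<phi> ` U \<and> smooth_on T ((\<lambda>x. H (f x)) \<circ> inv_into U \<phi>)"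
    using T assms(2)[OF T(1,4)] by (intro exI[of _ T]) (simp add: o_def)
qed

lemma smooth_at_op2:
  fixes M :: "('a, 'e::real_inner) manifold"
  assumes "smooth_at M f p" "smooth_at M g p"
    and "\<And>(T :: 'e set) h k. open T \<Longrightarrow> smooth_on T h \<Longrightarrow> smooth_on T k \<Longrightarrow> smooth_on T (\<lambda>x. H (h x) (k x))"
  shows "smooth_at M (\<lambda>x. H (f x) (g x)) p"
  unfolding smooth_at_def
proof (clarify)
  fix U \<phi> assume U: "(U, \<phi>) \<in> atlas M" "p \<in> U"
  obtain T where T: "open T" "\<phi> p \<in> T" "T \<subseteq> \<phi> ` U" "smooth_on T (f \<circ> inv_into U \<phi>)"
    using smooth_atD[OF assms(1) U] .
  obtain T' where T': "open T'" "\<phi> p \<in> T'" "T' \<subseteq> \<phi> ` U" "smooth_on T' (g \<circ> inv_into U \<phi>)"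
    using smooth_atD[OF assms(2) U] .
  have "smooth_on (T \<inter> T') (\<lambda>x. H ((f \<circ> inv_into U \<phi>) x) ((g \<circ> inv_into U \<phi>) x))"
    using T T' by (intro assms(3) open_Int smooth_on_subset[OF T(4)] smooth_on_subset[OF T'(4)]) auto
  then show "\<exists>T. open T \<and> \<phi> p \<in> T \<and> T \<subseteq> \<phi> ` U \<and> smooth_on T ((\<lambda>x. H (f x) (g x)) \<circ> inv_into U \<phi>)"
    using T T' by (intro exI[of _ "T \<inter> T'"]) (auto simp: o_def)
qed

lemma smooth_at_const:
  assumes "charted M"
  shows "smooth_at M (\<lambda>x. c) p"
  unfolding smooth_at_def
proof clarify
  fix U \<phi> assume U: "(U, \<phi>) \<in> atlas M" "p \<in> U"
  then show "\<exists>T. open T \<and> \<phi> p \<in> T \<and> T \<subseteq> \<phi> ` U \<and> smooth_on T ((\<lambda>x. c) \<circ> inv_into U \<phi>)"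
    using is_chartD(2)[OF charted_is_chart[OF assms U(1)]]
    by (intro exI[of _ "\<phi> ` U"]) (simp add: o_def smooth_on_const)
qed

lemma smooth_at_add: "smooth_at M f p \<Longrightarrow> smooth_at M g p \<Longrightarrow> smooth_at M (\<lambda>x. f x + g x) p"
  by (rule smooth_at_op2[of M f p g "(+)"]) (auto intro: smooth_on_add)

lemma smooth_at_bilinear:
  "bounded_bilinear prd \<Longrightarrow> smooth_at M f p \<Longrightarrow> smooth_at M g p \<Longrightarrow> smooth_at M (\<lambda>x. prd (f x) (g x)) p"
  by (rule smooth_at_op2[of M f p g prd]) (auto intro: smooth_on_bilinear)

lemma smooth_at_linear_comp:
  "bounded_linear L \<Longrightarrow> smooth_at M f p \<Longrightarrow> smooth_at M (\<lambda>x. L (f x)) p"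
  by (rule smooth_at_op[of M f p L]) (auto intro: smooth_on_linear_comp)

lemma smooth_at_mult:
  fixes f g :: "'a \<Rightarrow> 'f::real_normed_algebra"
  shows "smooth_at M f p \<Longrightarrow> smooth_at M g p \<Longrightarrow> smooth_at M (\<lambda>x. f x * g x) p"
  by (rule smooth_at_bilinear[OF bounded_bilinear_mult])

lemma smooth_at_sum:
  assumes "charted M" "\<And>i. i \<in> I \<Longrightarrow> smooth_at M (f i) p"
  shows "smooth_at M (\<lambda>x. \<Sum>i\<in>I. f i x) p"
  using assms(2)
  by (induction I rule: infinite_finite_induct) (auto intro: smooth_at_const[OF assms(1)] smooth_at_add)

lemma smooth_at_prod:
  fixes f :: "'i \<Rightarrow> 'a \<Rightarrow> 'f::{real_normed_algebra_1, comm_ring_1}"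
  assumes "charted M" "\<And>i. i \<in> I \<Longrightarrow> smooth_at M (f i) p"
  shows "smooth_at M (\<lambda>x. \<Prod>i\<in>I. f i x) p"
  using assms(2)
  by (induction I rule: infinite_finite_induct) (auto intro: smooth_at_const[OF assms(1)] smooth_at_mult)

lemma smooth_at_continuous_near:
  assumes M: "charted M" and f: "smooth_at M f p" and p: "p \<in> man_space M" and S: "open S" "f p \<in> S"
  shows "\<exists>W. openin (mtop M) W \<and> p \<in> W \<and> (\<forall>x\<in>W. f x \<in> S)"
proof -
  obtain U \<phi> where U: "(U, \<phi>) \<in> atlas M" "p \<in> U"
    using charted_chart_at[OF M p] .
  note cU = charted_is_chart[OF M U(1)]
  obtain T where T: "open T" "\<phi> p \<in> T" "T \<subseteq> \<phi> ` U" "smooth_on T (f \<circ> inv_into U \<phi>)"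
    using smooth_atD[OF f U] .
  have "open (T \<inter> (f \<circ> inv_into U \<phi>) -` S)"
    using continuous_open_preimage[OF smooth_on_imp_continuous_on[OF T(4)] T(1) S(1)] .
  from chart_open_preimage[OF cU this]
  show ?thesis
    using T(2) U S is_chartD(5)[OF cU]
    by (intro exI[of _ "{x \<in> U. \<phi> x \<in> T \<inter> (f \<circ> inv_into U \<phi>) -` S}"] conjI) auto
qed

lemma smooth_at_imp_continuous_map:
  fixes f :: "'a \<Rightarrow> 'b::real_normed_vector"
  assumes M: "charted M" and f: "\<And>p. p \<in> man_space M \<Longrightarrow> smooth_at M f p"
  shows "continuous_map (mtop M) euclidean f"
  unfolding continuous_map_def
proof (intro conjI allI impI)
  fix S :: "'b set" assume "openin euclidean S"
  then have S: "open S" by simp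
  show "openin (mtop M) {x \<in> man_space M. f x \<in> S}"
  proof (subst openin_subopen, intro ballI)
    fix p assume p: "p \<in> {x \<in> man_space M. f x \<in> S}"
    then obtain W where "openin (mtop M) W" "p \<in> W" "\<forall>x\<in>W. f x \<in> S"
      using smooth_at_continuous_near[OF M f _ S] by blast
    then show "\<exists>T. openin (mtop M) T \<and> p \<in> T \<and> T \<subseteq> {x \<in> man_space M. f x \<in> S}"
      using openin_subset by blast
  qed
qed auto

lemma smooth_at_inverse:
  fixes f :: "'a \<Rightarrow> 'f::real_normed_field"
  assumes M: "charted M" and f: "smooth_at M f p" and nz: "f p \<noteq> 0"
  shows "smooth_at M (\<lambda>x. inverse (f x)) p"
  unfolding smooth_at_def
proof (clarify)
  fix U \<phi> assume U: "(U, \<phi>) \<in> atlas M" "p \<in> U"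
  obtain T where T: "open T" "\<phi> p \<in> T" "T \<subseteq> \<phi> ` U" "smooth_on T (f \<circ> inv_into U \<phi>)"
    using smooth_atD[OF f U] .
  define T' where "T' = T \<inter> (f \<circ> inv_into U \<phi>) -` (- {0})"
  have "open T'"
    unfolding T'_def by (rule continuous_open_preimage[OF smooth_on_imp_continuous_on[OF T(4)] T(1)]) auto
  moreover have "smooth_on T' (\<lambda>x. inverse ((f \<circ> inv_into U \<phi>) x))"
    by (rule smooth_on_inverse[OF \<open>open T'\<close> smooth_on_subset[OF T(4)]]) (auto simp: T'_def)
  moreover have "\<phi> p \<in> T'"
    using T nz U is_chartD(5)[OF charted_is_chart[OF M U(1)]] by (simp add: T'_def)
  ultimately show "\<exists>T. open T \<and> \<phi> p \<in> T \<and> T \<subseteq> \<phi> ` U \<and> smooth_on T ((\<lambda>x. inverse (f x)) \<circ> inv_into U \<phi>)"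
    using T by (intro exI[of _ T']) (auto simp: o_def T'_def)
qed

subsection \<open>Smooth functions and smooth maps\<close>

lemma smooth_functions_iff:
  assumes M: "charted M"
  shows "f \<in> smooth_functions M \<longleftrightarrow> f \<in> extensional (man_space M) \<and> (\<forall>p\<in>man_space M. smooth_at M f p)"
proof
  assume f: "f \<in> smooth_functions M"
  have "smooth_at M f p" for p
    unfolding smooth_at_def
  proof clarify
    fix U \<phi> assume U: "(U, \<phi>) \<in> atlas M" "p \<in> U"
    have "smooth_on (\<phi> ` U) (f \<circ> inv_into U \<phi>)"
      using f U unfolding smooth_functions_def by fast
    then show "\<exists>T. open T \<and> \<phi> p \<in> T \<and> T \<subseteq> \<phi> ` U \<and> smooth_on T (f \<circ> inv_into U \<phi>)"
      using is_chartD(2)[OF charted_is_chart[OF M U(1)]] U by blast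
  qed
  then show "f \<in> extensional (man_space M) \<and> (\<forall>p\<in>man_space M. smooth_at M f p)"
    using f unfolding smooth_functions_def by blast
next
  assume f: "f \<in> extensional (man_space M) \<and> (\<forall>p\<in>man_space M. smooth_at M f p)"
  have "smooth_on (\<phi> ` U) (f \<circ> inv_into U \<phi>)" if U: "(U, \<phi>) \<in> atlas M" for U \<phi>
    unfolding smooth_on_def
  proof (intro allI ballI)
    fix vs y assume "y \<in> \<phi> ` U"
    then obtain p where p: "p \<in> U" "y = \<phi> p" by blast
    then have "smooth_at M f p"
      using f is_chartD(4)[OF charted_is_chart[OF M U]] by blast
    then show "iter_deriv vs (f \<circ> inv_into U \<phi>) differentiable (at y)"
      using smooth_atD[OF _ U p(1)] p(2) unfolding smooth_on_def by metis
  qed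
  then show "f \<in> smooth_functions M"
    using f unfolding smooth_functions_def by blast
qed

lemma smooth_functions_smooth_at:
  "charted M \<Longrightarrow> f \<in> smooth_functions M \<Longrightarrow> p \<in> man_space M \<Longrightarrow> smooth_at M f p"
  by (simp add: smooth_functions_iff)

lemma smooth_functionsI:
  assumes "charted M" "\<And>p. p \<in> man_space M \<Longrightarrow> smooth_at M f p"
  shows "restrict f (man_space M) \<in> smooth_functions M"
  unfolding smooth_functions_iff[OF assms(1)]
proof (intro conjI ballI)
  show "smooth_at M (restrict f (man_space M)) p" if "p \<in> man_space M" for p
    by (rule smooth_at_cong[OF assms(1) assms(2)[OF that] openin_topspace that]) auto
qed auto

text \<open>The definition by pairs of charts speaks of the part of \<open>U\<close> that
  \<open>F\<close> sends into \<open>V\<close>. Continuity makes this part open, and on open sets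
  smoothness can be checked point by point.\<close>

lemma smooth_map_iff:
  assumes M: "charted M" and N: "charted N"
  shows "smooth_map M N F \<longleftrightarrow> continuous_map (mtop M) (mtop N) F \<and>
     (\<forall>p\<in>man_space M. \<forall>(V, \<psi>)\<in>atlas N. F p \<in> V \<longrightarrow> smooth_at M (\<psi> \<circ> F) p)"
proof (cases "continuous_map (mtop M) (mtop N) F")
  case c: True
  have "smooth_at M (\<psi> \<circ> F) p"
    if sm: "smooth_map M N F" and p: "p \<in> man_space M" and V: "(V, \<psi>) \<in> atlas N" "F p \<in> V" for p V \<psi>
    unfolding smooth_at_def
  proof (clarify)
    fix U \<phi> assume U: "(U, \<phi>) \<in> atlas M" "p \<in> U"
    note cU = charted_is_chart[OF M U(1)]
    have "openin (mtop M) {x \<in> man_space M. F x \<in> V}"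
      using c is_chartD(1)[OF charted_is_chart[OF N V(1)]] openin_continuous_map_preimage by blast
    then have "openin (mtop M) ({x \<in> man_space M. F x \<in> V} \<inter> U)"
      using is_chartD(1)[OF cU] by blast
    moreover have "{x \<in> man_space M. F x \<in> V} \<inter> U = U \<inter> F -` V"
      using is_chartD(4)[OF cU] by auto
    ultimately have "open (\<phi> ` (U \<inter> F -` V))"
      by (intro chart_open_image[OF cU]) auto
    moreover have "smooth_on (\<phi> ` (U \<inter> F -` V)) (\<psi> \<circ> F \<circ> inv_into U \<phi>)"
      using sm U V unfolding smooth_map_def by fast
    ultimately show "\<exists>T. open T \<and> \<phi> p \<in> T \<and> T \<subseteq> \<phi> ` U \<and> smooth_on T (\<psi> \<circ> F \<circ> inv_into U \<phi>)"
      using U V by (intro exI[of _ "\<phi> ` (U \<inter> F -` V)"]) auto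
  qed
  moreover have "smooth_on (\<phi> ` (U \<inter> F -` V)) (\<psi> \<circ> F \<circ> inv_into U \<phi>)"
    if *: "\<forall>p\<in>man_space M. \<forall>(V, \<psi>)\<in>atlas N. F p \<in> V \<longrightarrow> smooth_at M (\<psi> \<circ> F) p"
      and U: "(U, \<phi>) \<in> atlas M" and V: "(V, \<psi>) \<in> atlas N" for U \<phi> V \<psi>
    unfolding smooth_on_def
  proof (intro allI ballI)
    fix vs y assume "y \<in> \<phi> ` (U \<inter> F -` V)"
    then obtain p where p: "p \<in> U" "F p \<in> V" "y = \<phi> p" by blast
    then have "smooth_at M (\<psi> \<circ> F) p"
      using * V is_chartD(4)[OF charted_is_chart[OF M U]] by blast
    then show "iter_deriv vs (\<psi> \<circ> F \<circ> inv_into U \<phi>) differentiable (at y)"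
      using smooth_atD[OF _ U p(1)] p(3) unfolding smooth_on_def by metis
  qed
  ultimately show ?thesis
    using c unfolding smooth_map_def by fast
next
  case False
  then show ?thesis unfolding smooth_map_def by blast
qed

lemma smooth_at_compose_smooth_map:
  assumes M: "charted M" and N: "smooth_manifold N" and F: "smooth_map M N F"
    and p: "p \<in> man_space M" and f: "smooth_at N f (F p)"
  shows "smooth_at M (\<lambda>x. f (F x)) p"
proof -
  have c: "continuous_map (mtop M) (mtop N) F" using F by (simp add: smooth_map_def)
  have Fp: "F p \<in> man_space N" using c p by (meson continuous_map_image_subset_topspace image_subset_iff)
  note N' = smooth_manifold_charted[OF N]
  obtain V \<psi> where V: "(V, \<psi>) \<in> atlas N" "F p \<in> V"
    using charted_chart_at[OF N' Fp] .
  note cV = charted_is_chart[OF N' V(1)]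
  obtain T where T: "open T" "\<psi> (F p) \<in> T" "T \<subseteq> \<psi> ` V" "smooth_on T (f \<circ> inv_into V \<psi>)"
    using smooth_atD[OF f V] .
  have psiF: "smooth_at M (\<psi> \<circ> F) p"
    using F p V unfolding smooth_map_iff[OF M N'] by blast
  have oV: "openin (mtop M) {x \<in> man_space M. F x \<in> V}"
    using openin_continuous_map_preimage[OF c is_chartD(1)[OF cV]] .
  show ?thesis
  proof (rule smooth_at_cong[OF M _ oV])
    show "smooth_at M (\<lambda>x. (f \<circ> inv_into V \<psi>) ((\<psi> \<circ> F) x)) p"
      unfolding smooth_at_def
    proof clarify
      fix U \<phi> assume U: "(U, \<phi>) \<in> atlas M" "p \<in> U"
      obtain S where S: "open S" "\<phi> p \<in> S" "S \<subseteq> \<phi> ` U" "smooth_on S (\<psi> \<circ> F \<circ> inv_into U \<phi>)"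
        using smooth_atD[OF psiF U] .
      define S' where "S' = S \<inter> (\<psi> \<circ> F \<circ> inv_into U \<phi>) -` T"
      have "open S'"
        unfolding S'_def by (rule continuous_open_preimage[OF smooth_on_imp_continuous_on[OF S(4)] S(1) T(1)])
      moreover have "smooth_on S' (\<lambda>x. (f \<circ> inv_into V \<psi>) ((\<psi> \<circ> F \<circ> inv_into U \<phi>) x))"
        by (rule smooth_on_comp[OF smooth_manifold_finite_dim[OF N] \<open>open S'\<close> smooth_on_subset[OF S(4)] T(4)])
          (auto simp: S'_def)
      moreover have "\<phi> p \<in> S'"
        using S U T is_chartD(5)[OF charted_is_chart[OF M U(1)]] by (simp add: S'_def)
      ultimately show "\<exists>T. open T \<and> \<phi> p \<in> T \<and> T \<subseteq> \<phi> ` U \<and>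
          smooth_on T ((\<lambda>x. (f \<circ> inv_into V \<psi>) ((\<psi> \<circ> F) x)) \<circ> inv_into U \<phi>)"
        using S by (intro exI[of _ S']) (auto simp: o_def S'_def)
    qed
  qed (use p V is_chartD(5)[OF cV] in auto)
qed

subsection \<open>Products with discrete groups\<close>

lemma inv_into_prod_singleton:
  assumes "inj_on \<phi> U" "y \<in> \<phi> ` U"
  shows "inv_into (U \<times> {g}) (\<phi> \<circ> fst) y = (inv_into U \<phi> y, g)"
proof -
  have "inj_on (\<phi> \<circ> fst) (U \<times> {g})"
    using assms(1) by (auto simp: inj_on_def)
  moreover have "(inv_into U \<phi> y, g) \<in> U \<times> {g}" "(\<phi> \<circ> fst) (inv_into U \<phi> y, g) = y"
    using assms by (auto simp: inv_into_into f_inv_into_f)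
  ultimately show ?thesis
    by (metis inv_into_f_f)
qed

text \<open>The charts of the product at (p, g) are precisely the charts of \<open>M\<close> at p
  placed on the sheet over g, with the same coordinates.\<close>

lemma smooth_at_prod_discrete:
  assumes M: "charted M" and g: "g \<in> carrier \<Lambda>"
  shows "smooth_at (prod_discrete M \<Lambda>) f (p, g) \<longleftrightarrow> smooth_at M (\<lambda>x. f (x, g)) p"
proof -
  have *: "smooth_on T (f \<circ> inv_into (U \<times> {g}) (\<phi> \<circ> fst)) \<longleftrightarrow>
      smooth_on T ((\<lambda>x. f (x, g)) \<circ> inv_into U \<phi>)"
    if "(U, \<phi>) \<in> atlas M" "open T" "T \<subseteq> \<phi> ` U" for U \<phi> T
  proof -
    have "(f \<circ> inv_into (U \<times> {g}) (\<phi> \<circ> fst)) y = ((\<lambda>x. f (x, g)) \<circ> inv_into U \<phi>) y" if "y \<in> T" for y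
      using inv_into_prod_singleton[OF is_chartD(5)[OF charted_is_chart[OF M \<open>(U, \<phi>) \<in> atlas M\<close>]], of y g]
        that \<open>T \<subseteq> \<phi> ` U\<close> by (auto simp: o_def)
    then show ?thesis
      using smooth_on_cong[OF _ that(2)] by metis
  qed
  have im: "(\<phi> \<circ> fst) ` (U \<times> {g}) = \<phi> ` U" for U :: "'a set" and \<phi> :: "'a \<Rightarrow> 'b"
    by force
  show ?thesis
  proof
    assume L: "smooth_at (prod_discrete M \<Lambda>) f (p, g)"
    show "smooth_at M (\<lambda>x. f (x, g)) p"
      unfolding smooth_at_def
    proof clarify
      fix U \<phi> assume U: "(U, \<phi>) \<in> atlas M" "p \<in> U"
      then have "(U \<times> {g}, \<phi> \<circ> fst) \<in> atlas (prod_discrete M \<Lambda>)" "(p, g) \<in> U \<times> {g}"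
        using g unfolding prod_discrete_def by auto
      from smooth_atD[OF L this] show "\<exists>T. open T \<and> \<phi> p \<in> T \<and> T \<subseteq> \<phi> ` U \<and>
          smooth_on T ((\<lambda>x. f (x, g)) \<circ> inv_into U \<phi>)"
        unfolding im using *[OF U(1)] by (metis comp_apply fst_conv)
    qed
  next
    assume R: "smooth_at M (\<lambda>x. f (x, g)) p"
    show "smooth_at (prod_discrete M \<Lambda>) f (p, g)"
      unfolding smooth_at_def
    proof clarify
      fix U' \<phi>' assume "(U', \<phi>') \<in> atlas (prod_discrete M \<Lambda>)" "(p, g) \<in> U'"
      then obtain U \<phi> where U: "(U, \<phi>) \<in> atlas M" "p \<in> U" "U' = U \<times> {g}" "\<phi>' = \<phi> \<circ> fst"
        unfolding prod_discrete_def by auto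
      from smooth_atD[OF R U(1,2)] show "\<exists>T. open T \<and> \<phi>' (p, g) \<in> T \<and> T \<subseteq> \<phi>' ` U' \<and>
          smooth_on T (f \<circ> inv_into U' \<phi>')"
        unfolding U(3,4) im using *[OF U(1)] by (metis comp_apply fst_conv)
    qed
  qed
qed

lemma charted_prod_discrete:
  assumes "charted M"
  shows "charted (prod_discrete M \<Lambda>)"
  unfolding charted_def
proof (intro conjI ballI)
  let ?X = "mtop (prod_discrete M \<Lambda>)"
  have X: "?X = prod_topology (mtop M) (discrete_topology (carrier \<Lambda>))"
    by (simp add: prod_discrete_def)
  fix c assume "c \<in> atlas (prod_discrete M \<Lambda>)"
  then obtain U \<phi> g where c: "c = (U \<times> {g}, \<phi> \<circ> fst)" "(U, \<phi>) \<in> atlas M" "g \<in> carrier \<Lambda>"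
    unfolding prod_discrete_def by auto
  note cU = charted_is_chart[OF assms c(2)]
  have im: "(\<phi> \<circ> fst) ` (U \<times> {g}) = \<phi> ` U" by force
  have "openin ?X (U \<times> {g})"
    unfolding X using is_chartD(1)[OF cU] c(3) by (simp add: openin_prod_Times_iff)
  moreover have "homeomorphic_map (subtopology ?X (U \<times> {g})) (subtopology (mtop M) U) fst"
  proof -
    have "homeomorphic_map (prod_topology (subtopology (mtop M) U) (discrete_topology {g}))
        (subtopology (mtop M) U) fst"
      by (rule homeomorphic_maps_imp_map[where g="\<lambda>x. (x, g)"])
        (auto simp: homeomorphic_maps_def continuous_map_fst intro!: continuous_map_pairedI)
    moreover have "subtopology (discrete_topology (carrier \<Lambda>)) {g} = discrete_topology {g}"
      using c(3) by (simp add: subtopology_eq_discrete_topology_eq) 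
    ultimately show ?thesis
      unfolding X subtopology_Times by simp
  qed
  then have "homeomorphic_map (subtopology ?X (U \<times> {g})) (top_of_set (\<phi> ` U)) (\<phi> \<circ> fst)"
    using is_chartD(3)[OF cU] homeomorphic_map_compose by blast
  ultimately show "is_chart ?X c"
    unfolding is_chart_def c(1) using is_chartD(2)[OF cU] by (simp only: split im)
next
  have "\<Union>(fst ` atlas (prod_discrete M \<Lambda>)) = \<Union>(fst ` atlas M) \<times> carrier \<Lambda>"
    unfolding prod_discrete_def by (auto simp: image_iff) (metis SigmaI singletonI)
  then show "\<Union>(fst ` atlas (prod_discrete M \<Lambda>)) = man_space (prod_discrete M \<Lambda>)"
    using assms unfolding charted_def by (simp add: prod_discrete_def)
qed

lemma continuous_map_from_prod_discrete:
  assumes "\<And>g. g \<in> G \<Longrightarrow> continuous_map X Y (\<lambda>x. f (x, g))"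
  shows "continuous_map (prod_topology X (discrete_topology G)) Y f"
  unfolding continuous_map_def
proof (intro conjI allI impI)
  show "f \<in> topspace (prod_topology X (discrete_topology G)) \<rightarrow> topspace Y"
    using assms by (auto simp: continuous_map_def Pi_iff)
  fix W assume W: "openin Y W"
  have "{x \<in> topspace (prod_topology X (discrete_topology G)). f x \<in> W} =
      (\<Union>g\<in>G. {x \<in> topspace X. f (x, g) \<in> W} \<times> {g})"
    by auto
  moreover have "openin (prod_topology X (discrete_topology G)) ({x \<in> topspace X. f (x, g) \<in> W} \<times> {g})"
    if "g \<in> G" for g
    using openin_continuous_map_preimage[OF assms[OF that] W] that by (simp add: openin_prod_Times_iff)
  ultimately show "openin (prod_topology X (discrete_topology G))
      {x \<in> topspace (prod_topology X (discrete_topology G)). f x \<in> W}"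
    by auto
qed

subsection \<open>Bump functions on manifolds\<close>

text \<open>The bump is taken in coordinates and extended by zero. The extension is smooth because
  \<open>C\<close>, the preimage of a closed ball, is compact and hence closed in the whole
  Hausdorff space, not only in the chart domain.\<close>

lemma manifold_bump:
  assumes M: "smooth_manifold M" and U: "(U, \<phi>) \<in> atlas M" "p \<in> U"
    and W: "openin (mtop M) W" "p \<in> W"
  obtains \<beta> :: "'a \<Rightarrow> real" and C T where "closedin (mtop M) C" "C \<subseteq> W \<inter> U" "openin (mtop M) T"
    "p \<in> T" "T \<subseteq> C" "\<And>x. x \<in> T \<Longrightarrow> \<beta> x = 1" "\<And>x. x \<notin> C \<Longrightarrow> \<beta> x = 0"
    "\<And>x. 0 \<le> \<beta> x" "\<And>x. \<beta> x \<le> 1" "\<And>x. x \<in> man_space M \<Longrightarrow> smooth_at M \<beta> x"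
proof -
  note M' = smooth_manifold_charted[OF M]
  note cU = charted_is_chart[OF M' U(1)]
  have "open (\<phi> ` (W \<inter> U))"
    using is_chartD(1)[OF cU] W by (intro chart_open_image[OF cU]) auto
  then obtain r where r: "r > 0" "cball (\<phi> p) r \<subseteq> \<phi> ` (W \<inter> U)"
    using U W by (metis IntI image_eqI open_contains_cball)
  define C where "C = {x \<in> U. \<phi> x \<in> cball (\<phi> p) r}"
  define T where "T = {x \<in> U. \<phi> x \<in> ball (\<phi> p) (r / 2)}"
  define \<beta> where "\<beta> x = (if x \<in> U then bump (\<phi> p) r (\<phi> x) else 0)" for x
  obtain h where h: "homeomorphic_maps (subtopology (mtop M) U) (top_of_set (\<phi> ` U)) \<phi> h"
    using is_chartD(3)[OF cU] homeomorphic_map_maps by blast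
  have "compactin (top_of_set (\<phi> ` U)) (cball (\<phi> p) r)"
    using compact_cball_finite_dim[OF smooth_manifold_finite_dim[OF M]] r(2)
    by (auto simp: compactin_subtopology)
  then have "compactin (subtopology (mtop M) U) (h ` cball (\<phi> p) r)"
    using h image_compactin unfolding homeomorphic_maps_def by blast
  moreover have "h ` cball (\<phi> p) r = C"
  proof -
    have h1: "h (\<phi> x) = x" if "x \<in> U" for x
      using h that is_chartD(4)[OF cU] unfolding homeomorphic_maps_def by auto
    show ?thesis
    proof
      show "h ` cball (\<phi> p) r \<subseteq> C"
        using r(2) h1 unfolding C_def by (force simp: subset_iff)
      show "C \<subseteq> h ` cball (\<phi> p) r"
      proof
        fix x assume "x \<in> C"
        then show "x \<in> h ` cball (\<phi> p) r"
          unfolding C_def using h1[of x] by (metis (mono_tags, lifting) image_eqI mem_Collect_eq)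
      qed
    qed
  qed
  ultimately have "compactin (mtop M) C"
    by (simp add: compactin_subtopology)
  then have C: "closedin (mtop M) C"
    using M compactin_imp_closedin unfolding smooth_manifold_def by blast
  have C0: "\<beta> x = 0" if "x \<notin> C" for x
    using that r(1) unfolding \<beta>_def C_def by (auto intro!: bump_eq_0 simp: dist_commute)
  have sm: "smooth_at M \<beta> x" if x: "x \<in> man_space M" for x
  proof (cases "x \<in> U")
    case True
    have "smooth_on (\<phi> ` U) (\<beta> \<circ> inv_into U \<phi>)"
      by (rule smooth_on_cong[OF smooth_on_subset[OF smooth_on_bump[OF r(1), of "\<phi> p"] subset_UNIV]
            is_chartD(2)[OF cU]])
        (auto simp: \<beta>_def is_chartD(5)[OF cU])
    then show ?thesis
      using True is_chartD(2)[OF cU] by (intro smooth_atI_chart[OF M U(1) True]) auto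
  next
    case False
    show ?thesis
    proof (rule smooth_at_cong[OF M' smooth_at_const[OF M']])
      show "openin (mtop M) (man_space M - C)" using C by blast
      show "x \<in> man_space M - C" using x False unfolding C_def by blast
    qed (use C0 in auto)
  qed
  show thesis
  proof (rule that[OF C _ _ _ _ _ C0 _ _ sm])
    show "C \<subseteq> W \<inter> U"
    proof
      fix x assume x: "x \<in> C"
      then obtain y where "y \<in> W \<inter> U" "\<phi> y = \<phi> x" using r(2) unfolding C_def by (auto simp: subset_iff)
      then show "x \<in> W \<inter> U" using x is_chartD(5)[OF cU] unfolding C_def by (auto dest: inj_onD)
    qed
    show "openin (mtop M) T" unfolding T_def by (rule chart_open_preimage[OF cU]) auto
    show "p \<in> T" using U r unfolding T_def by simp
    show "T \<subseteq> C" using r(1) unfolding T_def C_def by auto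
    show "\<beta> x = 1" if "x \<in> T" for x
      using that r(1) unfolding \<beta>_def T_def by (auto intro!: bump_eq_1 simp: dist_commute)
    show "0 \<le> \<beta> x" "\<beta> x \<le> 1" for x
      using bump_range[OF r(1)] unfolding \<beta>_def by auto
  qed auto
qed

lemma smooth_functions_separate:
  assumes M: "smooth_manifold M" and p: "p \<in> man_space M" and q: "q \<in> man_space M" "p \<noteq> q"
  shows "\<exists>f\<in>smooth_functions M. f p \<noteq> f q"
proof -
  note M' = smooth_manifold_charted[OF M]
  obtain U \<phi> where U: "(U, \<phi>) \<in> atlas M" "p \<in> U"
    using charted_chart_at[OF M' p] .
  have "closedin (mtop M) {q}"
    using M q(1) unfolding smooth_manifold_def by (simp add: Hausdorff_imp_t1_space closedin_t1_singleton)
  then have W: "openin (mtop M) (man_space M - {q})" by blast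
  obtain \<beta> :: "'a \<Rightarrow> real" and C T where \<beta>: "C \<subseteq> (man_space M - {q}) \<inter> U" "p \<in> T"
    "\<And>x. x \<in> T \<Longrightarrow> \<beta> x = 1" "\<And>x. x \<notin> C \<Longrightarrow> \<beta> x = 0" "\<And>x. x \<in> man_space M \<Longrightarrow> smooth_at M \<beta> x"
    by (rule manifold_bump[OF M U W]) (use p q in blast)+
  have "(\<lambda>x\<in>man_space M. complex_of_real (\<beta> x)) \<in> smooth_functions M"
    by (rule smooth_functionsI[OF M' smooth_at_linear_comp[OF bounded_linear_of_real \<beta>(5)]])
  moreover have "\<beta> p \<noteq> \<beta> q" using \<beta> by fastforce
  ultimately show ?thesis
    using p q by (intro bexI[of _ "\<lambda>x\<in>man_space M. complex_of_real (\<beta> x)"]) simp_all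
qed

section \<open>The algebra of smooth functions\<close>

lemma smooth_function_ring_simps [simp]:
  "carrier (smooth_function_ring P) = smooth_functions P"
  "f \<otimes>\<^bsub>smooth_function_ring P\<^esub> g = (\<lambda>p\<in>man_space P. f p * g p)"
  "\<one>\<^bsub>smooth_function_ring P\<^esub> = (\<lambda>p\<in>man_space P. 1)"
  "\<zero>\<^bsub>smooth_function_ring P\<^esub> = (\<lambda>p\<in>man_space P. 0)"
  "f \<oplus>\<^bsub>smooth_function_ring P\<^esub> g = (\<lambda>p\<in>man_space P. f p + g p)"
  by (simp_all add: smooth_function_ring_def)

lemma smooth_algebra_simps [simp]:
  "carrier (smooth_algebra P) = smooth_functions P"
  "f \<otimes>\<^bsub>smooth_algebra P\<^esub> g = (\<lambda>p\<in>man_space P. f p * g p)"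
  "\<one>\<^bsub>smooth_algebra P\<^esub> = (\<lambda>p\<in>man_space P. 1)"
  "\<zero>\<^bsub>smooth_algebra P\<^esub> = (\<lambda>p\<in>man_space P. 0)"
  "f \<oplus>\<^bsub>smooth_algebra P\<^esub> g = (\<lambda>p\<in>man_space P. f p + g p)"
  "c \<odot>\<^bsub>smooth_algebra P\<^esub> f = (\<lambda>p\<in>man_space P. c * f p)"
  "alg_top (smooth_algebra P) = seminorm_topology (smooth_function_ring P) (smooth_seminorms P)"
  by (simp_all add: smooth_algebra_def)

lemma smooth_functions_extensional: "f \<in> smooth_functions P \<Longrightarrow> f \<in> extensional (man_space P)"
  by (simp add: smooth_functions_def)

lemma smooth_functions_eqI:
  assumes "f \<in> smooth_functions P" "g \<in> smooth_functions P" "\<And>p. p \<in> man_space P \<Longrightarrow> f p = g p"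
  shows "f = g"
  using assms smooth_functions_extensional extensionalityI by metis

lemma smooth_functions_const: "charted P \<Longrightarrow> (\<lambda>p\<in>man_space P. c) \<in> smooth_functions P"
  by (intro smooth_functionsI smooth_at_const)

lemma smooth_functions_add:
  "charted P \<Longrightarrow> f \<in> smooth_functions P \<Longrightarrow> g \<in> smooth_functions P \<Longrightarrow>
    (\<lambda>p\<in>man_space P. f p + g p) \<in> smooth_functions P"
  by (intro smooth_functionsI smooth_at_add smooth_functions_smooth_at)

lemma smooth_functions_mult:
  "charted P \<Longrightarrow> f \<in> smooth_functions P \<Longrightarrow> g \<in> smooth_functions P \<Longrightarrow>
    (\<lambda>p\<in>man_space P. f p * g p) \<in> smooth_functions P"
  by (intro smooth_functionsI smooth_at_mult smooth_functions_smooth_at)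

lemma smooth_functions_scale:
  "charted P \<Longrightarrow> f \<in> smooth_functions P \<Longrightarrow> (\<lambda>p\<in>man_space P. c * f p) \<in> smooth_functions P"
  by (intro smooth_functionsI smooth_at_mult smooth_at_const smooth_functions_smooth_at)

lemma smooth_functions_minus:
  assumes "charted P" "f \<in> smooth_functions P"
  shows "(\<lambda>p\<in>man_space P. - f p) \<in> smooth_functions P"
  using smooth_functions_scale[OF assms, of "-1"] by simp

lemma smooth_functions_diff:
  assumes "charted P" "f \<in> smooth_functions P" "g \<in> smooth_functions P"
  shows "(\<lambda>p\<in>man_space P. f p - g p) \<in> smooth_functions P"
proof -
  have "(\<lambda>p\<in>man_space P. f p - g p) = (\<lambda>p\<in>man_space P. f p + (\<lambda>p\<in>man_space P. - g p) p)"
    by auto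
  then show ?thesis
    using smooth_functions_add[OF assms(1,2) smooth_functions_minus[OF assms(1,3)]] by metis
qed

lemma smooth_functions_cnj:
  "charted P \<Longrightarrow> f \<in> smooth_functions P \<Longrightarrow> (\<lambda>p\<in>man_space P. cnj (f p)) \<in> smooth_functions P"
  by (intro smooth_functionsI smooth_at_linear_comp[OF bounded_linear_cnj] smooth_functions_smooth_at)

lemma smooth_functions_inverse:
  "charted P \<Longrightarrow> f \<in> smooth_functions P \<Longrightarrow> (\<And>p. p \<in> man_space P \<Longrightarrow> f p \<noteq> 0) \<Longrightarrow>
    (\<lambda>p\<in>man_space P. inverse (f p)) \<in> smooth_functions P"
  by (intro smooth_functionsI smooth_at_inverse smooth_functions_smooth_at)

text \<open>Stated for any structure with these operations, since the ring and the algebra of smooth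
  functions are different records and both instances are used.\<close>

lemma cring_of_smooth_functions:
  fixes R (structure)
  assumes P: "charted P" and R: "carrier R = smooth_functions P"
    "\<And>f g. f \<otimes> g = (\<lambda>p\<in>man_space P. f p * g p)" "\<And>f g. f \<oplus> g = (\<lambda>p\<in>man_space P. f p + g p)"
    "\<one> = (\<lambda>p\<in>man_space P. 1)" "\<zero> = (\<lambda>p\<in>man_space P. 0)"
  shows "cring R"
proof (rule cringI)
  show "abelian_group R"
  proof (rule abelian_groupI)
    fix f assume f: "f \<in> carrier R"
    then show "\<exists>g\<in>carrier R. g \<oplus> f = \<zero>"
      using smooth_functions_minus[OF P, of f]
      by (intro bexI[of _ "\<lambda>p\<in>man_space P. - f p"]) (auto simp: R restrict_def)
    show "\<zero> \<oplus> f = f"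
      using f smooth_functions_extensional[of f P] by (auto simp: R restrict_def extensional_def)
  qed (auto simp: R P smooth_functions_add smooth_functions_const algebra_simps cong: restrict_cong)
  show "comm_monoid R"
  proof (rule comm_monoidI)
    fix f assume f: "f \<in> carrier R"
    then show "\<one> \<otimes> f = f"
      using smooth_functions_extensional[of f P] by (auto simp: R restrict_def extensional_def)
  qed (auto simp: R P smooth_functions_mult smooth_functions_const algebra_simps cong: restrict_cong)
qed (auto simp: R restrict_def algebra_simps)

lemma cring_smooth_function_ring: "charted P \<Longrightarrow> cring (smooth_function_ring P)"
  by (rule cring_of_smooth_functions) simp_all

lemma cring_smooth_algebra: "charted P \<Longrightarrow> cring (smooth_algebra P)"
  by (rule cring_of_smooth_functions) simp_all

lemma smooth_function_ring_minus:
  assumes P: "charted P" and f: "f \<in> smooth_functions P" and g: "g \<in> smooth_functions P"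
  shows "f \<ominus>\<^bsub>smooth_function_ring P\<^esub> g = (\<lambda>p\<in>man_space P. f p - g p)"
proof -
  interpret cring "smooth_function_ring P" by (rule cring_smooth_function_ring[OF P])
  have "\<ominus>\<^bsub>smooth_function_ring P\<^esub> g = (\<lambda>p\<in>man_space P. - g p)"
    by (rule minus_equality) (use g smooth_functions_minus[OF P g] in \<open>auto simp: restrict_def\<close>)
  then show ?thesis
    by (auto simp: a_minus_def restrict_def)
qed

section \<open>Continuous characters are point evaluations\<close>

text \<open>A neighbourhood of zero constrains only finitely many derivatives on finitely many compact
  sets, so it contains every function that vanishes near their union.\<close>

lemma open_neighbourhood_of_zero_support:
  assumes P: "smooth_manifold P"
    and O: "openin (alg_top (smooth_algebra P)) Z" "\<zero>\<^bsub>smooth_algebra P\<^esub> \<in> Z"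
  shows "\<exists>K. compactin (mtop P) K \<and> (\<forall>b\<in>smooth_functions P.
    (\<exists>N. openin (mtop P) N \<and> K \<subseteq> N \<and> (\<forall>x\<in>N. b x = 0)) \<longrightarrow> b \<in> Z)"
proof -
  note P' = smooth_manifold_charted[OF P]
  let ?R = "smooth_function_ring P"
  have "generate_topology_on (insert (carrier ?R)
      {{y \<in> carrier ?R. q (y \<ominus>\<^bsub>?R\<^esub> x) < e} | q x e. q \<in> smooth_seminorms P \<and> x \<in> carrier ?R \<and> 0 < e}) Z"
    using O(1) openin_topology_generated_by by (simp add: seminorm_topology_def)
  then show ?thesis
    using O(2)
  proof (induction rule: generate_topology_on.induct)
    case Empty
    then show ?case by simp
  next
    case (Int a b)
    then obtain K L where
      K: "compactin (mtop P) K" "\<And>b. b \<in> smooth_functions P \<Longrightarrow>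
          (\<exists>N. openin (mtop P) N \<and> K \<subseteq> N \<and> (\<forall>x\<in>N. b x = 0)) \<Longrightarrow> b \<in> a" and
      L: "compactin (mtop P) L" "\<And>c. c \<in> smooth_functions P \<Longrightarrow>
          (\<exists>N. openin (mtop P) N \<and> L \<subseteq> N \<and> (\<forall>x\<in>N. c x = 0)) \<Longrightarrow> c \<in> b"
      by auto
    show ?case
    proof (intro exI[of _ "K \<union> L"] conjI ballI impI)
      show "compactin (mtop P) (K \<union> L)" using K(1) L(1) by (rule compactin_Un)
      fix c assume c: "c \<in> smooth_functions P"
        "\<exists>N. openin (mtop P) N \<and> K \<union> L \<subseteq> N \<and> (\<forall>x\<in>N. c x = 0)"
      then show "c \<in> a \<inter> b" using K(2)[OF c(1)] L(2)[OF c(1)] by (metis IntI Un_subset_iff)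
    qed
  next
    case (UN F)
    then obtain k where "k \<in> F" "\<zero>\<^bsub>smooth_algebra P\<^esub> \<in> k" by blast
    then show ?case using UN.IH[of k] by (metis UnionI)
  next
    case (Basis s)
    show ?case
    proof (cases "s = carrier ?R")
      case True
      then show ?thesis by (intro exI[of _ "{}"]) auto
    next
      case False
      then obtain q x e where s: "s = {y \<in> smooth_functions P. q (y \<ominus>\<^bsub>?R\<^esub> x) < e}"
        and q: "q \<in> smooth_seminorms P" and x: "x \<in> smooth_functions P"
        using Basis by auto
      obtain U \<phi> K vs where q_def: "q = (\<lambda>f. SUP y\<in>K. cmod (iter_deriv vs (f \<circ> inv_into U \<phi>) y))"
        and U: "(U, \<phi>) \<in> atlas P" and K: "compact K" "K \<subseteq> \<phi> ` U"
        using q unfolding smooth_seminorms_def by blast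
      note cU = charted_is_chart[OF P' U]
      obtain h where h: "homeomorphic_maps (subtopology (mtop P) U) (top_of_set (\<phi> ` U)) \<phi> h"
        using is_chartD(3)[OF cU] homeomorphic_map_maps by blast
      have "compactin (top_of_set (\<phi> ` U)) K"
        using K by (simp add: compactin_subtopology)
      then have "compactin (subtopology (mtop P) U) (h ` K)"
        using h image_compactin unfolding homeomorphic_maps_def by blast
      then have hK: "compactin (mtop P) (h ` K)"
        by (simp add: compactin_subtopology)
      have h1: "h (\<phi> z) = z" if "z \<in> U" for z
        using h that is_chartD(4)[OF cU] unfolding homeomorphic_maps_def by auto
      show ?thesis
      proof (intro exI[of _ "h ` K"] conjI ballI impI hK)
        fix b assume b: "b \<in> smooth_functions P"
          "\<exists>N. openin (mtop P) N \<and> h ` K \<subseteq> N \<and> (\<forall>x\<in>N. b x = 0)"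
        then obtain N where N: "openin (mtop P) N" "h ` K \<subseteq> N" "\<And>z. z \<in> N \<Longrightarrow> b z = 0"
          by blast
        have oN: "open (\<phi> ` (N \<inter> U))"
          using is_chartD(1)[OF cU] N(1) by (intro chart_open_image[OF cU]) auto
        have KN: "K \<subseteq> \<phi> ` (N \<inter> U)"
        proof
          fix y assume y: "y \<in> K"
          then obtain z where z: "z \<in> U" "y = \<phi> z" using K(2) by blast
          then have "z \<in> N" using N(2) h1 y by (metis image_eqI subsetD)
          then show "y \<in> \<phi> ` (N \<inter> U)" using z by blast
        qed
        \<comment> \<open>The subbasic ball has an arbitrary centre \<open>x\<close>. Since
          \<open>b\<close> and 0 agree near the compact set, the seminorm does not distinguish b - x
          from 0 - x, and 0 lies in the ball.\<close>
        have eq: "((b \<ominus>\<^bsub>?R\<^esub> x) \<circ> inv_into U \<phi>) y = ((\<zero>\<^bsub>?R\<^esub> \<ominus>\<^bsub>?R\<^esub> x) \<circ> inv_into U \<phi>) y"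
          if "y \<in> \<phi> ` (N \<inter> U)" for y
          using that is_chartD(5)[OF cU] N(3) b(1) x smooth_functions_const[OF P', of 0]
          by (auto simp: smooth_function_ring_minus[OF P'])
        have "cmod (iter_deriv vs ((b \<ominus>\<^bsub>?R\<^esub> x) \<circ> inv_into U \<phi>) y) =
            cmod (iter_deriv vs ((\<zero>\<^bsub>?R\<^esub> \<ominus>\<^bsub>?R\<^esub> x) \<circ> inv_into U \<phi>) y)" if "y \<in> K" for y
          by (rule arg_cong[where f=cmod], rule iter_deriv_cong_open[OF oN _ subsetD[OF KN that]], rule eq)
        then have "q (b \<ominus>\<^bsub>?R\<^esub> x) = q (\<zero>\<^bsub>?R\<^esub> \<ominus>\<^bsub>?R\<^esub> x)"
          unfolding q_def by (intro SUP_cong refl)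
        then show "b \<in> s" using Basis.prems b(1) unfolding s by (simp del: restrict_apply)
      qed
    qed
  qed
qed

text \<open>The contradiction is an invertible function in the kernel. Continuity enters through
  \<open>Z\<close> alone: it reduces the search for such a function to a finite covering of
  \<open>K\<close>.\<close>

lemma continuous_character_is_evaluation:
  assumes P: "smooth_manifold P"
    and mult: "\<And>f g. f \<in> smooth_functions P \<Longrightarrow> g \<in> smooth_functions P \<Longrightarrow>
      \<xi> (\<lambda>p\<in>man_space P. f p * g p) = \<xi> f * \<xi> g"
    and add: "\<And>f g. f \<in> smooth_functions P \<Longrightarrow> g \<in> smooth_functions P \<Longrightarrow>
      \<xi> (\<lambda>p\<in>man_space P. f p + g p) = \<xi> f + \<xi> g"
    and scale: "\<And>c f. f \<in> smooth_functions P \<Longrightarrow> \<xi> (\<lambda>p\<in>man_space P. c * f p) = c * \<xi> f"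
    and one: "\<xi> (\<lambda>p\<in>man_space P. 1) = (1::complex)"
    and O: "openin (alg_top (smooth_algebra P)) Z" "\<zero>\<^bsub>smooth_algebra P\<^esub> \<in> Z" "\<And>f. f \<in> Z \<Longrightarrow> cmod (\<xi> f) < 1"
  shows "\<exists>x\<in>man_space P. \<forall>f\<in>smooth_functions P. \<xi> f = f x"
proof (rule ccontr)
  assume contr: "\<not> ?thesis"
  note P' = smooth_manifold_charted[OF P]
  obtain K where K: "compactin (mtop P) K" "\<And>b N. b \<in> smooth_functions P \<Longrightarrow>
      openin (mtop P) N \<Longrightarrow> K \<subseteq> N \<Longrightarrow> \<forall>x\<in>N. b x = 0 \<Longrightarrow> b \<in> Z"
    using open_neighbourhood_of_zero_support[OF P O(1,2)] by metis
  have van: "\<xi> b = 0" if b: "b \<in> smooth_functions P" "openin (mtop P) N" "K \<subseteq> N" "\<forall>x\<in>N. b x = 0" for b N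
  proof (rule ccontr)
    assume nz: "\<xi> b \<noteq> 0"
    have "N \<subseteq> man_space P" using b(2) openin_subset by blast
    \<comment> \<open>Scaling \<open>b\<close> to the value 1 under \<open>\<xi>\<close> keeps it
      zero near \<open>K\<close>, hence in \<open>Z\<close>, where \<open>\<xi>\<close> is smaller
      than 1 in modulus.\<close>
    then have "(\<lambda>p\<in>man_space P. (1 / \<xi> b) * b p) \<in> Z"
      using b by (intro K(2)[OF smooth_functions_scale[OF P' b(1)] b(2,3)]) auto
    then have "cmod ((1 / \<xi> b) * \<xi> b) < 1" using O(3) scale[OF b(1)] by metis
    then show False using nz by simp
  qed
  have "\<exists>h\<in>smooth_functions P. \<xi> h = 0 \<and> h x \<noteq> 0" if x: "x \<in> man_space P" for x
  proof -
    obtain f where f: "f \<in> smooth_functions P" "\<xi> f \<noteq> f x" using contr x by blast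
    \<comment> \<open>This is \<open>f\<close> minus the constant \<open>\<xi> f\<close>: in the
      kernel, but nonzero at \<open>x\<close>. The nested restrictions give it the shape that
      \<open>add\<close> and \<open>scale\<close> speak of.\<close>
    define h where "h = (\<lambda>p\<in>man_space P. f p + (\<lambda>p\<in>man_space P. (- \<xi> f) * (\<lambda>p\<in>man_space P. 1) p) p)"
    have c: "(\<lambda>p\<in>man_space P. (- \<xi> f) * (\<lambda>p\<in>man_space P. 1) p) \<in> smooth_functions P"
      by (intro smooth_functions_scale smooth_functions_const P')
    have "h \<in> smooth_functions P" unfolding h_def by (rule smooth_functions_add[OF P' f(1) c])
    moreover have "\<xi> h = 0"
      unfolding h_def add[OF f(1) c] scale[OF smooth_functions_const[OF P']] one by simp
    moreover have "h x \<noteq> 0" using f(2) x unfolding h_def by simp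
    ultimately show ?thesis by blast
  qed
  then obtain h where h: "\<And>x. x \<in> man_space P \<Longrightarrow> h x \<in> smooth_functions P"
    "\<And>x. x \<in> man_space P \<Longrightarrow> \<xi> (h x) = 0" "\<And>x. x \<in> man_space P \<Longrightarrow> h x x \<noteq> 0"
    by metis
  have KP: "K \<subseteq> man_space P" using K(1) compactin_subset_topspace by blast
  \<comment> \<open>\<open>\<beta>\<close> is 1 near \<open>x\<close> and vanishes wherever
    \<open>h x\<close> does. One predicate holds all the requirements, so that neighbourhood and
    cut-off are chosen together.\<close>
  define Q where "Q x T \<beta> \<longleftrightarrow> openin (mtop P) T \<and> x \<in> T \<and> (\<forall>y\<in>T. \<beta> y = 1) \<and>
      (\<forall>y\<in>man_space P. h x y = 0 \<longrightarrow> \<beta> y = 0) \<and> (\<forall>y. 0 \<le> \<beta> y \<and> \<beta> y \<le> 1) \<and>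
      (\<forall>y\<in>man_space P. smooth_at P \<beta> y)" for x T and \<beta> :: "'a \<Rightarrow> real"
  have "\<exists>T \<beta>. Q x T \<beta>" if x: "x \<in> man_space P" for x
  proof -
    obtain U \<phi> where U: "(U, \<phi>) \<in> atlas P" "x \<in> U" using charted_chart_at[OF P' x] .
    have "continuous_map (mtop P) euclidean (h x)"
      by (rule smooth_at_imp_continuous_map[OF P' smooth_functions_smooth_at[OF P' h(1)[OF x]]])
    then have W: "openin (mtop P) {y \<in> man_space P. h x y \<in> - {0}}"
      by (rule openin_continuous_map_preimage) auto
    obtain \<beta> :: "'a \<Rightarrow> real" and C T where "closedin (mtop P) C" "C \<subseteq> {y \<in> man_space P. h x y \<in> - {0}} \<inter> U"
      and "openin (mtop P) T" "x \<in> T" "T \<subseteq> C" "\<And>y. y \<in> T \<Longrightarrow> \<beta> y = 1" "\<And>y. y \<notin> C \<Longrightarrow> \<beta> y = 0"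
      "\<And>y. 0 \<le> \<beta> y" "\<And>y. \<beta> y \<le> 1" "\<And>y. y \<in> man_space P \<Longrightarrow> smooth_at P \<beta> y"
      by (rule manifold_bump[OF P U W]) (use x h(3) in auto)
    then have "Q x T \<beta>"
      unfolding Q_def by blast
    then show ?thesis by blast
  qed
  then obtain T \<beta> where "\<And>x. x \<in> man_space P \<Longrightarrow> Q x (T x) (\<beta> x)"
    by metis
  then have \<beta>: "\<And>x. x \<in> man_space P \<Longrightarrow> openin (mtop P) (T x)"
    "\<And>x. x \<in> man_space P \<Longrightarrow> x \<in> T x" "\<And>x y. x \<in> man_space P \<Longrightarrow> y \<in> T x \<Longrightarrow> \<beta> x y = 1"
    "\<And>x y. x \<in> man_space P \<Longrightarrow> y \<in> man_space P \<Longrightarrow> h x y = 0 \<Longrightarrow> \<beta> x y = 0"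
    "\<And>x y. x \<in> man_space P \<Longrightarrow> 0 \<le> \<beta> x y \<and> \<beta> x y \<le> 1"
    "\<And>x y. x \<in> man_space P \<Longrightarrow> y \<in> man_space P \<Longrightarrow> smooth_at P (\<beta> x) y"
    unfolding Q_def by blast+
  have "\<exists>\<F>. finite \<F> \<and> \<F> \<subseteq> T ` K \<and> K \<subseteq> \<Union>\<F>"
    by (rule compactinD[OF K(1)]) (use \<beta>(1,2) KP in blast)+
  then obtain I where I: "finite I" "I \<subseteq> K" "K \<subseteq> \<Union>(T ` I)"
    by (metis finite_subset_image)
  have IP: "i \<in> man_space P" if "i \<in> I" for i using that I KP by blast
  \<comment> \<open>The product vanishes near \<open>K\<close>, since the sets \<open>T i\<close>
    cover it, and is 1 where all \<open>h i\<close> vanish. The form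
    \<open>1 + - 1 * \<beta> i y\<close> matches the closure rules for sums and products.\<close>
  define b where "b = (\<lambda>y\<in>man_space P. complex_of_real (\<Prod>i\<in>I. 1 + - 1 * \<beta> i y))"
  define G where "G J = (\<lambda>y\<in>man_space P. \<Sum>i\<in>J. cnj (h i y) * h i y)" for J
  have b: "b \<in> smooth_functions P"
    unfolding b_def
    by (intro smooth_functionsI[OF P'] smooth_at_linear_comp[OF bounded_linear_of_real] smooth_at_prod[OF P']
        smooth_at_add smooth_at_const[OF P'] smooth_at_mult \<beta>(6)) (use IP in auto)
  have "\<xi> b = 0"
  proof (rule van[OF b _ I(3)])
    show "openin (mtop P) (\<Union>(T ` I))" using \<beta>(1) IP by blast
    show "\<forall>x\<in>\<Union>(T ` I). b x = 0"
    proof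
      fix x assume "x \<in> \<Union>(T ` I)"
      then obtain i where i: "i \<in> I" "x \<in> T i" by blast
      then have "1 + - 1 * \<beta> i x = 0" using \<beta>(3) IP by simp
      moreover have "x \<in> man_space P" using i \<beta>(1) IP openin_subset by blast
      ultimately show "b x = 0" unfolding b_def using i(1) I(1) by (auto intro: prod_zero)
    qed
  qed
  have G: "G J \<in> smooth_functions P \<and> \<xi> (G J) = 0" if "J \<subseteq> I" for J
    using finite_subset[OF that I(1)] that
  proof (induction J)
    case empty
    have "G {} = (\<lambda>p\<in>man_space P. 0 * (\<lambda>p\<in>man_space P. 1) p)" unfolding G_def by auto
    then show ?case
      using smooth_functions_scale[OF P' smooth_functions_const[OF P']] scale[OF smooth_functions_const[OF P']]
      by (metis mult_zero_left)
  next
    case (insert j J)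
    note hj = h(1,2)[OF IP, of j]
    have s: "(\<lambda>p\<in>man_space P. (\<lambda>p\<in>man_space P. cnj (h j p)) p * h j p) \<in> smooth_functions P"
      using insert by (intro smooth_functions_mult smooth_functions_cnj P' hj) auto
    have "G (insert j J) = (\<lambda>p\<in>man_space P. (\<lambda>p\<in>man_space P. (\<lambda>p\<in>man_space P. cnj (h j p)) p * h j p) p + G J p)"
      unfolding G_def using insert by auto
    moreover have "\<xi> (\<lambda>p\<in>man_space P. (\<lambda>p\<in>man_space P. cnj (h j p)) p * h j p) = 0"
      using insert hj mult[OF smooth_functions_cnj[OF P' hj(1)] hj(1)] by simp
    moreover have "G J \<in> smooth_functions P" "\<xi> (G J) = 0" using insert by auto
    ultimately show ?case
      by (metis add[OF s] smooth_functions_add[OF P' s] add_0)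
  qed
  define F where "F = (\<lambda>y\<in>man_space P. G I y + b y)"
  have F: "F \<in> smooth_functions P" unfolding F_def by (rule smooth_functions_add[OF P' _ b]) (use G in auto)
  have F0: "\<xi> F = 0" unfolding F_def using add[OF _ b, of "G I"] G[of I] \<open>\<xi> b = 0\<close> by auto
  \<comment> \<open>The values of \<open>F\<close> are nonnegative reals. Either some
    \<open>h i\<close> is nonzero and the sum of squares is positive, or all
    \<open>\<beta> i\<close> vanish and the product is 1.\<close>
  have Fnz: "F y \<noteq> 0" if y: "y \<in> man_space P" for y
  proof -
    have "G I y = complex_of_real (\<Sum>i\<in>I. (cmod (h i y))\<^sup>2)"
      unfolding G_def using y by (auto simp: complex_norm_square[symmetric] mult.commute[of "cnj _"] simp flip: of_real_power intro!: sum.cong)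
    moreover have "(\<Sum>i\<in>I. (cmod (h i y))\<^sup>2) + (\<Prod>i\<in>I. 1 + - 1 * \<beta> i y) > 0"
    proof (cases "\<exists>i\<in>I. h i y \<noteq> 0")
      case True
      then obtain i where "i \<in> I" "h i y \<noteq> 0" by blast
      then have "(\<Sum>i\<in>I. (cmod (h i y))\<^sup>2) > 0"
        by (intro sum_pos2[OF I(1), of i]) auto
      moreover have "(\<Prod>i\<in>I. 1 + - 1 * \<beta> i y) \<ge> 0"
        using \<beta>(5) IP by (intro prod_nonneg) auto
      ultimately show ?thesis by linarith
    next
      case False
      then have "(\<Prod>i\<in>I. 1 + - 1 * \<beta> i y) = 1"
        using \<beta>(4)[OF IP y] by (intro prod.neutral) auto
      moreover have "(\<Sum>i\<in>I. (cmod (h i y))\<^sup>2) \<ge> 0" by (intro sum_nonneg) auto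
      ultimately show ?thesis by linarith
    qed
    ultimately have "F y = complex_of_real ((\<Sum>i\<in>I. (cmod (h i y))\<^sup>2) + (\<Prod>i\<in>I. 1 + - 1 * \<beta> i y))"
      unfolding F_def b_def using y by simp
    then show ?thesis
      using \<open>_ > 0\<close> by (metis less_irrefl of_real_eq_0_iff)
  qed
  have inv: "(\<lambda>p\<in>man_space P. inverse (F p)) \<in> smooth_functions P"
    by (rule smooth_functions_inverse[OF P' F Fnz])
  have "(\<lambda>p\<in>man_space P. F p * (\<lambda>p\<in>man_space P. inverse (F p)) p) = (\<lambda>p\<in>man_space P. 1)"
    using Fnz by (auto simp: restrict_def)
  then show False
    using mult[OF F inv] F0 one by simp
qed

section \<open>The action induced on the manifold\<close>

text \<open>The modulus of the evaluation at \<open>p\<close> is one of the seminorms: the compact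
  set is a single point and no derivative is taken.\<close>

lemma open_evaluation_ball:
  assumes P: "smooth_manifold P" and p: "p \<in> man_space P"
  shows "openin (alg_top (smooth_algebra P)) {f \<in> smooth_functions P. cmod (f p) < 1}"
proof -
  note P' = smooth_manifold_charted[OF P]
  let ?R = "smooth_function_ring P"
  obtain U \<phi> where U: "(U, \<phi>) \<in> atlas P" "p \<in> U" using charted_chart_at[OF P' p] .
  note cU = charted_is_chart[OF P' U(1)]
  define q where "q = (\<lambda>f::'a \<Rightarrow> complex. SUP y\<in>{\<phi> p}. cmod (iter_deriv [] (f \<circ> inv_into U \<phi>) y))"
  have q: "q \<in> smooth_seminorms P"
    unfolding q_def smooth_seminorms_def using U by (intro CollectI exI[of _ U] exI[of _ \<phi>] exI[of _ "{\<phi> p}"] exI[of _ "[]"]) auto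
  have "q (y \<ominus>\<^bsub>?R\<^esub> \<zero>\<^bsub>?R\<^esub>) = cmod (y p)" if "y \<in> smooth_functions P" for y
    unfolding q_def using that p U is_chartD(5)[OF cU] smooth_functions_const[OF P', of 0]
    by (simp add: smooth_function_ring_minus[OF P'])
  then have "{f \<in> smooth_functions P. cmod (f p) < 1} = {y \<in> carrier ?R. q (y \<ominus>\<^bsub>?R\<^esub> \<zero>\<^bsub>?R\<^esub>) < 1}"
    by auto
  moreover have "openin (alg_top (smooth_algebra P)) {y \<in> carrier ?R. q (y \<ominus>\<^bsub>?R\<^esub> \<zero>\<^bsub>?R\<^esub>) < 1}"
    unfolding smooth_algebra_simps seminorm_topology_def
    using q smooth_functions_const[OF P', of 0]
    by (intro topology_generated_by_Basis insertI2 CollectI exI[of _ q] exI[of _ "\<zero>\<^bsub>?R\<^esub>"] exI[of _ 1]) auto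
  ultimately show ?thesis by simp
qed

lemma dynamical_system_autD:
  assumes "dynamical_system (smooth_algebra P) \<Lambda> \<alpha>" "g \<in> carrier \<Lambda>"
  shows "f \<in> smooth_functions P \<Longrightarrow> \<alpha> g f \<in> smooth_functions P"
    "f \<in> smooth_functions P \<Longrightarrow> f' \<in> smooth_functions P \<Longrightarrow>
      \<alpha> g (\<lambda>p\<in>man_space P. f p * f' p) = (\<lambda>p\<in>man_space P. \<alpha> g f p * \<alpha> g f' p)"
    "f \<in> smooth_functions P \<Longrightarrow> f' \<in> smooth_functions P \<Longrightarrow>
      \<alpha> g (\<lambda>p\<in>man_space P. f p + f' p) = (\<lambda>p\<in>man_space P. \<alpha> g f p + \<alpha> g f' p)"
    "f \<in> smooth_functions P \<Longrightarrow> \<alpha> g (\<lambda>p\<in>man_space P. c * f p) = (\<lambda>p\<in>man_space P. c * \<alpha> g f p)"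
    "\<alpha> g (\<lambda>p\<in>man_space P. 1) = (\<lambda>p\<in>man_space P. 1)"
    "h \<in> carrier \<Lambda> \<Longrightarrow> f \<in> smooth_functions P \<Longrightarrow> \<alpha> (g \<otimes>\<^bsub>\<Lambda>\<^esub> h) f = \<alpha> g (\<alpha> h f)"
    "f \<in> smooth_functions P \<Longrightarrow> \<alpha> \<one>\<^bsub>\<Lambda>\<^esub> f = f"
proof -
  let ?A = "smooth_algebra P"
  have hom: "\<alpha> \<in> hom \<Lambda> (algebra_AutGroup ?A)" and G: "group \<Lambda>"
    using assms(1) by (auto simp: dynamical_system_def)
  have aut: "\<alpha> h \<in> Bij (smooth_functions P)" "\<alpha> h \<in> ring_hom ?A ?A"
    "\<And>c x. x \<in> smooth_functions P \<Longrightarrow> \<alpha> h (c \<odot>\<^bsub>?A\<^esub> x) = c \<odot>\<^bsub>?A\<^esub> \<alpha> h x" if "h \<in> carrier \<Lambda>" for h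
    using hom_in_carrier[OF hom that] by (auto simp: algebra_AutGroup_def)
  show cl: "\<alpha> g f \<in> smooth_functions P" if "f \<in> smooth_functions P" for f
    using aut(1)[OF assms(2)] that Bij_imp_funcset by blast
  show "\<alpha> g (\<lambda>p\<in>man_space P. f p * f' p) = (\<lambda>p\<in>man_space P. \<alpha> g f p * \<alpha> g f' p)"
    if "f \<in> smooth_functions P" "f' \<in> smooth_functions P"
    using ring_hom_mult[OF aut(2)[OF assms(2)], of f f'] that by simp
  show "\<alpha> g (\<lambda>p\<in>man_space P. f p + f' p) = (\<lambda>p\<in>man_space P. \<alpha> g f p + \<alpha> g f' p)"
    if "f \<in> smooth_functions P" "f' \<in> smooth_functions P"
    using ring_hom_add[OF aut(2)[OF assms(2)], of f f'] that by simp
  show "\<alpha> g (\<lambda>p\<in>man_space P. c * f p) = (\<lambda>p\<in>man_space P. c * \<alpha> g f p)" if "f \<in> smooth_functions P"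
    using aut(3)[OF assms(2) that] by simp
  show "\<alpha> g (\<lambda>p\<in>man_space P. 1) = (\<lambda>p\<in>man_space P. 1)"
    using ring_hom_one[OF aut(2)[OF assms(2)]] by simp
  have mul: "\<alpha> (g \<otimes>\<^bsub>\<Lambda>\<^esub> h) f = \<alpha> g (\<alpha> h f)" if "g \<in> carrier \<Lambda>" "h \<in> carrier \<Lambda>" "f \<in> smooth_functions P" for g h f
    using hom_mult[OF hom that(1,2)] aut(1)[OF that(1)] aut(1)[OF that(2)] that(3)
    by (simp add: algebra_AutGroup_def BijGroup_def compose_def)
  show "\<alpha> (g \<otimes>\<^bsub>\<Lambda>\<^esub> h) f = \<alpha> g (\<alpha> h f)" if "h \<in> carrier \<Lambda>" "f \<in> smooth_functions P"
    using mul[OF assms(2) that] .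
  show "\<alpha> \<one>\<^bsub>\<Lambda>\<^esub> f = f" if f: "f \<in> smooth_functions P"
  proof -
    have 1: "\<one>\<^bsub>\<Lambda>\<^esub> \<in> carrier \<Lambda>" using G by (simp add: group.is_monoid)
    \<comment> \<open>The operator of the unit element is idempotent and injective, hence the
      identity.\<close>
    have "\<alpha> \<one>\<^bsub>\<Lambda>\<^esub> (\<alpha> \<one>\<^bsub>\<Lambda>\<^esub> f) = \<alpha> \<one>\<^bsub>\<Lambda>\<^esub> f"
      using mul[OF 1 1 f] G by (simp add: group.is_monoid)
    moreover have "inj_on (\<alpha> \<one>\<^bsub>\<Lambda>\<^esub>) (smooth_functions P)" "\<alpha> \<one>\<^bsub>\<Lambda>\<^esub> f \<in> smooth_functions P"
      using aut(1)[OF 1] f Bij_imp_funcset[OF aut(1)[OF 1]] by (auto simp: Bij_def bij_betw_def)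
    ultimately show ?thesis using f by (auto dest: inj_onD)
  qed
qed

lemma point_evaluation_compose_eq_iff:
  assumes "x \<in> man_space P" "\<And>f. f \<in> smooth_functions P \<Longrightarrow> \<alpha> g f \<in> smooth_functions P"
  shows "point_evaluation P x = compose (smooth_functions P) (point_evaluation P p) (\<alpha> g) \<longleftrightarrow>
    (\<forall>f\<in>smooth_functions P. f x = \<alpha> g f p)"
  using assms(2) by (auto simp: point_evaluation_def compose_def fun_eq_iff restrict_def)

text \<open>The composite of the evaluation with \<open>\<alpha> g\<close> is a character, bounded
  by 1 on the preimage under \<open>\<alpha> g\<close> of an evaluation ball, so it is an
  evaluation. Uniqueness holds because smooth functions separate points.\<close>

lemma induced_point_unique_existence:
  assumes P: "smooth_manifold P" and D: "dynamical_system (smooth_algebra P) \<Lambda> \<alpha>"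
    and p: "p \<in> man_space P" and g: "g \<in> carrier \<Lambda>"
  shows "\<exists>!x. x \<in> man_space P \<and>
    point_evaluation P x = compose (smooth_functions P) (point_evaluation P p) (\<alpha> g)"
proof -
  note P' = smooth_manifold_charted[OF P]
  let ?T = "alg_top (smooth_algebra P)"
  note \<alpha> = dynamical_system_autD[OF D g]
  have top: "topspace ?T = smooth_functions P"
    unfolding smooth_algebra_simps seminorm_topology_def by auto
  have "continuous_map (prod_topology (discrete_topology (carrier \<Lambda>)) ?T) ?T (\<lambda>(g, a). \<alpha> g a)"
    using D by (simp add: dynamical_system_def)
  moreover have "continuous_map ?T (prod_topology (discrete_topology (carrier \<Lambda>)) ?T) (\<lambda>a. (g, a))"
    using g by (intro continuous_map_pairedI) auto
  ultimately have "continuous_map ?T ?T ((\<lambda>(g, a). \<alpha> g a) \<circ> (\<lambda>a. (g, a)))"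
    using continuous_map_compose by blast
  then have c: "continuous_map ?T ?T (\<alpha> g)" by (simp add: o_def)
  have "openin ?T {f \<in> topspace ?T. \<alpha> g f \<in> {f \<in> smooth_functions P. cmod (f p) < 1}}"
    by (rule openin_continuous_map_preimage[OF c open_evaluation_ball[OF P p]])
  then have Z: "openin ?T {f \<in> smooth_functions P. cmod (\<alpha> g f p) < 1}"
    unfolding top using \<alpha>(1) by (simp cong: conj_cong)
  have zero: "\<zero>\<^bsub>smooth_algebra P\<^esub> \<in> {f \<in> smooth_functions P. cmod (\<alpha> g f p) < 1}"
    using \<alpha>(4)[OF smooth_functions_const[OF P', of 0], of 0] smooth_functions_const[OF P', of 0] p by simp
  have "\<exists>x\<in>man_space P. \<forall>f\<in>smooth_functions P. \<alpha> g f p = f x"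
    by (rule continuous_character_is_evaluation[OF P, where \<xi>="\<lambda>f. \<alpha> g f p", OF _ _ _ _ Z zero])
      (simp_all add: \<alpha>(2-5) p)
  then obtain x where x: "x \<in> man_space P" "\<forall>f\<in>smooth_functions P. f x = \<alpha> g f p" by metis
  show ?thesis
  proof (rule ex1I[of _ x])
    show "x \<in> man_space P \<and> point_evaluation P x = compose (smooth_functions P) (point_evaluation P p) (\<alpha> g)"
      using x point_evaluation_compose_eq_iff[where \<alpha>=\<alpha> and g=g, OF x(1) \<alpha>(1)] by blast
    fix y assume "y \<in> man_space P \<and> point_evaluation P y = compose (smooth_functions P) (point_evaluation P p) (\<alpha> g)"
    then show "y = x"
      using x point_evaluation_compose_eq_iff[where \<alpha>=\<alpha> and g=g, OF _ \<alpha>(1)] smooth_functions_separate[OF P, of y x] by metis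
  qed
qed

lemma induced_action_works:
  assumes "smooth_manifold P" "dynamical_system (smooth_algebra P) \<Lambda> \<alpha>"
    and "p \<in> man_space P" "g \<in> carrier \<Lambda>"
  shows "induced_action P \<alpha> (p, g) \<in> man_space P"
    and "f \<in> smooth_functions P \<Longrightarrow> f (induced_action P \<alpha> (p, g)) = \<alpha> g f p"
proof -
  have *: "induced_action P \<alpha> (p, g) \<in> man_space P \<and> point_evaluation P (induced_action P \<alpha> (p, g)) =
      compose (smooth_functions P) (point_evaluation P p) (\<alpha> g)"
    using theI'[OF induced_point_unique_existence[OF assms]] by (simp add: induced_action_def)
  then show 1: "induced_action P \<alpha> (p, g) \<in> man_space P" by blast
  show "f (induced_action P \<alpha> (p, g)) = \<alpha> g f p" if "f \<in> smooth_functions P"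
    using * that point_evaluation_compose_eq_iff[where \<alpha>=\<alpha> and g=g, OF 1 dynamical_system_autD(1)[OF assms(2,4)]] by blast
qed

lemma smooth_at_chart:
  assumes P: "smooth_manifold P" and V: "(V, \<psi>) \<in> atlas P" "x \<in> V"
  shows "smooth_at P \<psi> x"
proof -
  note cV = charted_is_chart[OF smooth_manifold_charted[OF P] V(1)]
  have "smooth_on (\<psi> ` V) (\<psi> \<circ> inv_into V \<psi>)"
    by (rule smooth_on_cong[OF smooth_on_bounded_linear[OF bounded_linear_ident is_chartD(2)[OF cV]]
          is_chartD(2)[OF cV]]) (auto simp: f_inv_into_f)
  then show ?thesis
    using V is_chartD(2)[OF cV] by (intro smooth_atI_chart[OF P V]) auto
qed

text \<open>A bump function \<open>B\<close> at the image point, supported in \<open>W\<close>, is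
  sent by \<open>\<alpha> g\<close> to its composite with the action. The set where this smooth
  function is nonzero is open, contains the given point and is mapped into \<open>W\<close>.\<close>

lemma continuous_map_induced_action:
  assumes P: "smooth_manifold P" and D: "dynamical_system (smooth_algebra P) \<Lambda> \<alpha>" and g: "g \<in> carrier \<Lambda>"
  shows "continuous_map (mtop P) (mtop P) (\<lambda>p. induced_action P \<alpha> (p, g))"
  unfolding continuous_map_def
proof (intro conjI allI impI)
  note P' = smooth_manifold_charted[OF P]
  let ?\<sigma> = "\<lambda>p. induced_action P \<alpha> (p, g)"
  note act = induced_action_works[OF P D _ g]
  show "?\<sigma> \<in> man_space P \<rightarrow> man_space P" using act(1) by blast
  fix W assume W: "openin (mtop P) W"
  show "openin (mtop P) {x \<in> man_space P. ?\<sigma> x \<in> W}"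
  proof (subst openin_subopen, intro ballI)
    fix p assume "p \<in> {x \<in> man_space P. ?\<sigma> x \<in> W}"
    then have p: "p \<in> man_space P" "?\<sigma> p \<in> W" by auto
    obtain U \<phi> where U: "(U, \<phi>) \<in> atlas P" "?\<sigma> p \<in> U" using charted_chart_at[OF P' act(1)[OF p(1)]] .
    obtain \<beta> :: "'a \<Rightarrow> real" and C T where \<beta>: "C \<subseteq> W \<inter> U" "?\<sigma> p \<in> T"
      "\<And>x. x \<in> T \<Longrightarrow> \<beta> x = 1" "\<And>x. x \<notin> C \<Longrightarrow> \<beta> x = 0" "\<And>x. x \<in> man_space P \<Longrightarrow> smooth_at P \<beta> x"
      by (rule manifold_bump[OF P U W p(2)]) auto
    define B where "B = (\<lambda>x\<in>man_space P. complex_of_real (\<beta> x))"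
    have B: "B \<in> smooth_functions P"
      unfolding B_def by (rule smooth_functionsI[OF P' smooth_at_linear_comp[OF bounded_linear_of_real \<beta>(5)]])
    have "continuous_map (mtop P) euclidean (\<alpha> g B)"
      by (rule smooth_at_imp_continuous_map[OF P' smooth_functions_smooth_at[OF P' dynamical_system_autD(1)[OF D g B]]])
    then have N: "openin (mtop P) {x \<in> man_space P. \<alpha> g B x \<in> - {0}}"
      by (rule openin_continuous_map_preimage) auto
    have aB: "\<alpha> g B x = complex_of_real (\<beta> (?\<sigma> x))" if "x \<in> man_space P" for x
      using act(2)[OF that B] act(1)[OF that] unfolding B_def by simp
    have "?\<sigma> x \<in> W" if "x \<in> man_space P" "\<alpha> g B x \<in> - {0}" for x
      using that aB[OF that(1)] \<beta>(1) \<beta>(4)[of "?\<sigma> x"] by auto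
    then show "\<exists>T. openin (mtop P) T \<and> p \<in> T \<and> T \<subseteq> {x \<in> man_space P. ?\<sigma> x \<in> W}"
      using N p aB[OF p(1)] \<beta>(2,3)
      by (intro exI[of _ "{x \<in> man_space P. \<alpha> g B x \<in> - {0}}"] conjI) auto
  qed
qed

text \<open>Near a point, the coordinates of \<open>\<sigma>(\<cdot>, g)\<close> are the images under \<open>\<alpha> g\<close> of cut-off coordinate functions.\<close>

lemma smooth_at_chart_induced_action:
  fixes P :: "('a, 'e::real_inner) manifold"
  assumes P: "smooth_manifold P" and D: "dynamical_system (smooth_algebra P) \<Lambda> \<alpha>" and g: "g \<in> carrier \<Lambda>"
    and p: "p \<in> man_space P" and V: "(V, \<psi>) \<in> atlas P" "induced_action P \<alpha> (p, g) \<in> V"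
  shows "smooth_at P (\<lambda>x. \<psi> (induced_action P \<alpha> (x, g))) p"
proof -
  note P' = smooth_manifold_charted[OF P]
  let ?\<sigma> = "\<lambda>p. induced_action P \<alpha> (p, g)"
  note act = induced_action_works[OF P D _ g]
  obtain \<beta> :: "'a \<Rightarrow> real" and C T where \<beta>: "closedin (mtop P) C" "C \<subseteq> man_space P \<inter> V"
      "openin (mtop P) T" "?\<sigma> p \<in> T" "T \<subseteq> C"
      "\<And>x. x \<in> T \<Longrightarrow> \<beta> x = 1" "\<And>x. x \<notin> C \<Longrightarrow> \<beta> x = 0" "\<And>x. x \<in> man_space P \<Longrightarrow> smooth_at P \<beta> x"
    by (rule manifold_bump[OF P V openin_topspace act(1)[OF p]]) auto
  obtain E :: "'e set" where E: "finite E" "\<And>v. (\<Sum>c\<in>E. (v \<bullet> c / (c \<bullet> c)) *\<^sub>R c) = v"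
    using finite_dim_expansion[OF smooth_manifold_finite_dim[OF P]] by blast
  define F where "F c = (\<lambda>x\<in>man_space P. complex_of_real (if x \<in> V then \<beta> x * (\<psi> x \<bullet> c) else 0))" for c
  have F: "F c \<in> smooth_functions P" for c
    unfolding F_def
  proof (rule smooth_functionsI[OF P' smooth_at_linear_comp[OF bounded_linear_of_real]])
    fix x assume x: "x \<in> man_space P"
    show "smooth_at P (\<lambda>x. if x \<in> V then \<beta> x * (\<psi> x \<bullet> c) else 0) x"
    proof (cases "x \<in> V")
      case True
      have "smooth_at P (\<lambda>x. \<beta> x * (\<psi> x \<bullet> c)) x"
        by (intro smooth_at_mult \<beta>(8) x smooth_at_linear_comp[OF bounded_linear_inner_left] smooth_at_chart[OF P V(1) True])
      then show ?thesis
        by (rule smooth_at_cong[OF P' _ is_chartD(1)[OF charted_is_chart[OF P' V(1)]] True]) auto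
    next
      case False
      show ?thesis
      proof (rule smooth_at_cong[OF P' smooth_at_const[OF P']])
        show "openin (mtop P) (man_space P - C)" using \<beta>(1) by blast
        show "x \<in> man_space P - C" using x False \<beta>(2) by blast
      qed (use \<beta>(7) in auto)
    qed
  qed
  define N where "N = {x \<in> man_space P. ?\<sigma> x \<in> T}"
  have N: "openin (mtop P) N"
    unfolding N_def by (rule openin_continuous_map_preimage[OF continuous_map_induced_action[OF P D g] \<beta>(3)])
  have coord: "\<psi> (?\<sigma> x) \<bullet> c = Re (\<alpha> g (F c) x)" if "x \<in> N" for x c
  proof -
    have x: "x \<in> man_space P" "?\<sigma> x \<in> T" "?\<sigma> x \<in> V" using that \<beta>(2,5) unfolding N_def by auto
    then have "F c (?\<sigma> x) = complex_of_real (\<psi> (?\<sigma> x) \<bullet> c)"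
      using act(1)[OF x(1)] \<beta>(6) unfolding F_def by simp
    then show ?thesis using act(2)[OF x(1) F, of c] by (metis Re_complex_of_real)
  qed
  have "smooth_at P (\<lambda>x. \<Sum>c\<in>E. (Re (\<alpha> g (F c) x) / (c \<bullet> c)) *\<^sub>R c) p"
    by (intro smooth_at_sum[OF P'] smooth_at_linear_comp[OF bounded_linear_scaleR_left]
        smooth_at_linear_comp[OF bounded_linear_divide] smooth_at_linear_comp[OF bounded_linear_Re]
        smooth_functions_smooth_at[OF P' dynamical_system_autD(1)[OF D g F] p])
  then show ?thesis
  proof (rule smooth_at_cong[OF P' _ N])
    show "p \<in> N" using p \<beta>(4) unfolding N_def by blast
    show "\<psi> (?\<sigma> x) = (\<Sum>c\<in>E. (Re (\<alpha> g (F c) x) / (c \<bullet> c)) *\<^sub>R c)" if "x \<in> N" for x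
      using E(2)[of "\<psi> (?\<sigma> x)"] unfolding coord[OF that] by simp
  qed
qed

lemma mtop_prod_discrete: "mtop (prod_discrete P \<Lambda>) = prod_topology (mtop P) (discrete_topology (carrier \<Lambda>))"
  by (simp add: prod_discrete_def)

text \<open>Points are compared by the values of all smooth functions. The value of f at
  \<open>\<sigma>(\<sigma>(p, g), h)\<close> is that of \<open>\<alpha> g (\<alpha> h f)\<close> at
  p, which is why a homomorphism yields a right action.\<close>

lemma smooth_right_action_induced:
  assumes P: "smooth_manifold P" and D: "dynamical_system (smooth_algebra P) \<Lambda> \<alpha>"
  shows "smooth_right_action P \<Lambda> (induced_action P \<alpha>)"
  unfolding smooth_right_action_def
proof (intro conjI ballI)
  note P' = smooth_manifold_charted[OF P]
  note act = induced_action_works[OF P D]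
  interpret group \<Lambda> using D by (simp add: dynamical_system_def)
  show "smooth_map (prod_discrete P \<Lambda>) P (induced_action P \<alpha>)"
    unfolding smooth_map_iff[OF charted_prod_discrete[OF P'] P']
  proof (intro conjI ballI; clarsimp simp: mtop_prod_discrete)
    show "continuous_map (prod_topology (mtop P) (discrete_topology (carrier \<Lambda>))) (mtop P) (induced_action P \<alpha>)"
      by (rule continuous_map_from_prod_discrete[OF continuous_map_induced_action[OF P D]])
    fix p g V \<psi> assume *: "p \<in> man_space P" "g \<in> carrier \<Lambda>" "(V, \<psi>) \<in> atlas P" "induced_action P \<alpha> (p, g) \<in> V"
    then show "smooth_at (prod_discrete P \<Lambda>) (\<psi> \<circ> induced_action P \<alpha>) (p, g)"
      unfolding smooth_at_prod_discrete[OF P' *(2)] o_def by (intro smooth_at_chart_induced_action[OF P D])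
  qed
  show "induced_action P \<alpha> (p, \<one>\<^bsub>\<Lambda>\<^esub>) = p" if p: "p \<in> man_space P" for p
  proof (rule ccontr)
    assume "induced_action P \<alpha> (p, \<one>\<^bsub>\<Lambda>\<^esub>) \<noteq> p"
    then obtain f where "f \<in> smooth_functions P" "f (induced_action P \<alpha> (p, \<one>\<^bsub>\<Lambda>\<^esub>)) \<noteq> f p"
      using smooth_functions_separate[OF P act(1)[OF p one_closed] p] by blast
    then show False
      using act(2)[OF p one_closed] dynamical_system_autD(7)[OF D one_closed] by metis
  qed
  show "induced_action P \<alpha> (induced_action P \<alpha> (p, g), h) = induced_action P \<alpha> (p, g \<otimes>\<^bsub>\<Lambda>\<^esub> h)"
    if p: "p \<in> man_space P" and g: "g \<in> carrier \<Lambda>" and h: "h \<in> carrier \<Lambda>" for p g h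
  proof (rule ccontr)
    assume "induced_action P \<alpha> (induced_action P \<alpha> (p, g), h) \<noteq> induced_action P \<alpha> (p, g \<otimes>\<^bsub>\<Lambda>\<^esub> h)"
    then obtain f where f: "f \<in> smooth_functions P"
        "f (induced_action P \<alpha> (induced_action P \<alpha> (p, g), h)) \<noteq> f (induced_action P \<alpha> (p, g \<otimes>\<^bsub>\<Lambda>\<^esub> h))"
      using smooth_functions_separate[OF P act(1)[OF act(1)[OF p g] h] act(1)[OF p m_closed[OF g h]]] by blast
    then show False
      using act(2)[OF p m_closed[OF g h] f(1)] act(2)[OF act(1)[OF p g] h f(1)]
        act(2)[OF p g dynamical_system_autD(1)[OF D h f(1)]] dynamical_system_autD(6)[OF D g h f(1)] by simp
  qed
qed

section \<open>Finite abelian groups\<close>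

subsection \<open>Characters\<close>

lemma charactersD:
  fixes G (structure)
  assumes "group G" "\<theta> \<in> characters G"
  shows "x \<in> carrier G \<Longrightarrow> y \<in> carrier G \<Longrightarrow> \<theta> (x \<otimes>\<^bsub>G\<^esub> y) = \<theta> x * \<theta> y"
    "x \<in> carrier G \<Longrightarrow> cmod (\<theta> x) = 1" "\<theta> \<one>\<^bsub>G\<^esub> = 1"
    "x \<in> carrier G \<Longrightarrow> \<theta> (inv\<^bsub>G\<^esub> x) = inverse (\<theta> x)"
    "x \<in> carrier G \<Longrightarrow> \<theta> (x [^]\<^bsub>G\<^esub> (n::nat)) = \<theta> x ^ n"
proof -
  interpret group G by fact
  have hom: "\<theta> \<in> hom G circle_group" using assms(2) by (simp add: characters_def)
  show m: "\<theta> (x \<otimes> y) = \<theta> x * \<theta> y" if "x \<in> carrier G" "y \<in> carrier G" for x y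
    using hom_mult[OF hom that] by (simp add: circle_group_def)
  show c: "cmod (\<theta> x) = 1" if "x \<in> carrier G" for x
    using hom_in_carrier[OF hom that] by (simp add: circle_group_def)
  have nz: "\<theta> x \<noteq> 0" if "x \<in> carrier G" for x
    using c[OF that] by auto
  show 1: "\<theta> \<one> = 1" using m[of \<one> \<one>] nz[of \<one>] by simp
  show "\<theta> (inv x) = inverse (\<theta> x)" if "x \<in> carrier G"
    using m[of x "inv x"] 1 that nz[OF that] by (simp add: field_simps)
  show "\<theta> (x [^] n) = \<theta> x ^ n" if "x \<in> carrier G"
    using that by (induction n) (auto simp: 1 m)
qed

lemma characters_eqI:
  assumes G: "group G" and \<theta>: "\<theta> \<in> characters G" "\<eta> \<in> characters G"
    and S: "S \<subseteq> carrier G" "generate G S = carrier G" "\<And>s. s \<in> S \<Longrightarrow> \<theta> s = \<eta> s"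
  shows "\<theta> = \<eta>"
proof (rule extensionalityI)
  show "\<theta> \<in> extensional (carrier G)" "\<eta> \<in> extensional (carrier G)"
    using \<theta> by (auto simp: characters_def)
  fix x assume "x \<in> carrier G"
  then have "x \<in> generate G S" using S(2) by simp
  then have "x \<in> carrier G \<and> \<theta> x = \<eta> x"
  proof (induction rule: generate.induct)
    case one
    then show ?case
      using charactersD(3)[OF G \<theta>(1)] charactersD(3)[OF G \<theta>(2)] G by (simp add: group.is_monoid)
  next
    case (incl h)
    then show ?case using S by blast
  next
    case (inv h)
    then show ?case using charactersD(4)[OF G] \<theta> G S by (metis group.inv_closed subsetD)
  next
    case (eng h1 h2)
    then show ?case using charactersD(1)[OF G] \<theta> G by (metis S(2) generate.eng)
  qed
  then show "\<theta> x = \<eta> x" by blast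
qed

lemma (in comm_group) character_finprod:
  assumes "\<theta> \<in> characters G" "finite S" "f \<in> S \<rightarrow> carrier G"
  shows "\<theta> (finprod G f S) = (\<Prod>s\<in>S. \<theta> (f s))"
  using assms(2,3)
proof (induction S)
  case empty
  then show ?case using charactersD(3)[OF is_group assms(1)] by simp
next
  case (insert s S)
  then have "f s \<in> carrier G" "f \<in> S \<rightarrow> carrier G" by auto
  then show ?case
    using insert charactersD(1)[OF is_group assms(1)] by simp
qed

lemma root_of_unity_power:
  "exp (2 * of_real pi * \<i> / of_nat n) ^ j = exp (2 * of_real pi * \<i> * of_nat j / (of_nat n :: complex))"
  by (simp add: exp_of_nat_mult[symmetric] algebra_simps)

text \<open>Makes the assignment sending a power of \<open>s\<close> to the same power of a
  primitive root of unity well defined.\<close>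

lemma (in group) pow_eq_imp_root_of_unity_eq:
  assumes fin: "finite (carrier G)" and s: "s \<in> carrier G" and eq: "s [^] (m::nat) = s [^] (n::nat)"
  shows "exp (2 * of_real pi * \<i> / of_nat (ord s)) ^ m = (exp (2 * of_real pi * \<i> / of_nat (ord s)) ^ n :: complex)"
proof -
  have "s [^] (int m) = s [^] (int n)" using eq by (simp add: int_pow_int)
  then have "int (ord s) dvd (int n - int m)" using int_pow_eq[OF s] by blast
  then have "int m mod int (ord s) = int n mod int (ord s)" by (metis mod_eq_dvd_iff)
  then have "m mod ord s = n mod ord s" by (metis of_nat_eq_iff zmod_int)
  then show ?thesis
    unfolding root_of_unity_power using complex_root_unity_eq[OF ord_ge_1[OF fin s]] by blast
qed

text \<open>Finite order allows the integer exponent to be reduced modulo \<open>ord s\<close>, so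
  that natural exponents can be used throughout.\<close>

lemma (in group) cyclic_subgroup_nat_power:
  assumes fin: "finite (carrier G)" and s: "s \<in> carrier G" and x: "x \<in> carrier (subgroup_generated G {s})"
  obtains n :: nat where "x = s [^] n"
proof -
  obtain m :: int where m: "x = s [^] m"
    using x carrier_subgroup_generated_by_singleton[OF s] by auto
  have pos: "int (ord s) > 0" using ord_ge_1[OF fin s] by simp
  have "s [^] m = s [^] (m mod int (ord s))"
    unfolding int_pow_eq[OF s] by (metis dvd_minus_mod dvd_minus_iff minus_diff_eq)
  also have "\<dots> = s [^] nat (m mod int (ord s))"
    using pos by (metis int_pow_int nat_0_le pos_mod_sign)
  finally show thesis using m that by blast
qed

subsection \<open>Dual generators\<close>

lemma (in comm_group) adapted_generators_expansion:
  assumes fin: "finite (carrier G)" and S: "adapted_generators G S" and g: "g \<in> carrier G"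
  obtains n :: "'a \<Rightarrow> nat" where "g = finprod G (\<lambda>s. s [^] n s) S"
proof -
  have SG: "S \<subseteq> carrier G"
    and iso: "(\<lambda>x. finprod G x S) \<in> iso (product_group S (\<lambda>s. subgroup_generated G {s})) G"
    using S by (auto simp: adapted_generators_def)
  obtain x where x: "x \<in> (\<Pi>\<^sub>E s\<in>S. carrier (subgroup_generated G {s}))" "g = finprod G x S"
    using iso g by (auto simp: iso_def bij_betw_def)
  have "\<forall>s\<in>S. \<exists>n::nat. x s = s [^] n"
    using cyclic_subgroup_nat_power[OF fin] SG x(1) by (metis PiE_mem subsetD)
  then obtain n where n: "\<forall>s\<in>S. x s = s [^] (n s :: nat)" by metis
  then have "finprod G x S = finprod G (\<lambda>s. s [^] n s) S"
    using SG by (intro finprod_cong') auto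
  then show thesis using x(2) that by metis
qed

text \<open>The character reads off the \<open>s\<close>-component of g under the inverse of the
  product isomorphism and sends the n-th power of \<open>s\<close> to the n-th power of the root of
  unity.\<close>

lemma (in comm_group) dual_generator_exists:
  assumes fin: "finite (carrier G)" and S: "adapted_generators G S" and s: "s \<in> S"
  shows "\<exists>\<theta>. \<theta> \<in> characters G \<and> \<theta> s = exp (2 * of_real pi * \<i> / of_nat (ord s)) \<and> (\<forall>t\<in>S - {s}. \<theta> t = 1)"
proof -
  let ?P = "product_group S (\<lambda>s. subgroup_generated G {s})"
  define E where "E = (\<lambda>x. finprod G x S)"
  define \<omega> :: complex where "\<omega> = exp (2 * of_real pi * \<i> / of_nat (ord s))"
  have SG: "S \<subseteq> carrier G" and finS: "finite S" and iso: "E \<in> iso ?P G"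
    using S by (auto simp: adapted_generators_def E_def)
  have sG: "s \<in> carrier G" using s SG by blast
  have grpP: "group ?P" by simp
  define co where "co = inv_into (carrier ?P) E"
  have co: "co \<in> hom G ?P"
    using group.iso_set_sym[OF grpP iso] unfolding co_def iso_def by blast
  have inj: "inj_on E (carrier ?P)" using iso by (auto simp: iso_def bij_betw_def)
  have coE: "co (E x) = x" if "x \<in> carrier ?P" for x
    unfolding co_def using inj that by simp
  have co_s: "co g s \<in> carrier (subgroup_generated G {s})" if "g \<in> carrier G" for g
    using hom_in_carrier[OF co that] s by auto
  have mem: "t \<in> carrier (subgroup_generated G {t})" if "t \<in> S" for t
    using that SG subgroup_generated_subset_carrier_subset[of "{t}"] by blast
  have co_gen: "co t = (\<lambda>u\<in>S. if u = t then t else \<one>)" if t: "t \<in> S" for t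
  proof -
    let ?x = "\<lambda>u\<in>S. if u = t then t else \<one>"
    have "?x \<in> carrier ?P"
      using mem[OF t] by (auto simp: PiE_iff) (metis group.is_monoid group_subgroup_generated monoid.one_closed one_subgroup_generated)
    moreover have "E ?x = t"
    proof -
      have "E ?x = finprod G (\<lambda>u. if t = u then u else \<one>) S"
        unfolding E_def using SG by (intro finprod_cong') auto
      also have "\<dots> = t"
        using finprod_singleton[OF t finS, of "\<lambda>u. u"] SG by (simp add: Pi_iff subset_iff)
      finally show ?thesis .
    qed
    ultimately show ?thesis using coE by metis
  qed
  \<comment> \<open>An arbitrary exponent of the \<open>s\<close>-component; by
    \<open>pow_eq_imp_root_of_unity_eq\<close> the value of the character does not depend on
    it.\<close>
  define k where "k g = (SOME n::nat. co g s = s [^] n)" for g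
  have k: "co g s = s [^] k g" if "g \<in> carrier G" for g
    unfolding k_def by (rule someI_ex) (metis cyclic_subgroup_nat_power[OF fin sG co_s[OF that]])
  have pw: "\<omega> ^ m = \<omega> ^ n" if "s [^] m = s [^] n" for m n :: nat
    unfolding \<omega>_def by (rule pow_eq_imp_root_of_unity_eq[OF fin sG that])
  define \<theta> where "\<theta> = (\<lambda>g\<in>carrier G. \<omega> ^ k g)"
  have norm: "cmod \<omega> = 1" unfolding \<omega>_def by (simp add: norm_exp_eq_Re)
  have "\<theta> (g \<otimes> h) = \<theta> g * \<theta> h" if gh: "g \<in> carrier G" "h \<in> carrier G" for g h
  proof -
    have "co (g \<otimes> h) s = co g s \<otimes> co h s"
      using hom_mult[OF co gh] s by simp
    then have "s [^] k (g \<otimes> h) = s [^] (k g + k h)"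
      using k gh sG by (simp add: nat_pow_mult)
    from pw[OF this] show ?thesis
      using gh by (simp add: \<theta>_def power_add)
  qed
  then have "\<theta> \<in> hom G circle_group"
    unfolding hom_def circle_group_def by (auto simp: \<theta>_def norm norm_power)
  then have 1: "\<theta> \<in> characters G" by (simp add: characters_def \<theta>_def)
  have "s [^] k s = s [^] (1::nat)" using k[OF sG] co_gen[OF s] s sG by simp
  then have 2: "\<theta> s = \<omega>" using pw[of "k s" 1] sG by (simp add: \<theta>_def)
  have 3: "\<theta> t = 1" if t: "t \<in> S - {s}" for t
  proof -
    have tG: "t \<in> carrier G" using t SG by blast
    have "s [^] k t = s [^] (0::nat)" using k[OF tG] co_gen[of t] t s by auto
    then show ?thesis using pw[of "k t" 0] tG by (simp add: \<theta>_def)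
  qed
  show ?thesis using 1 2 3 unfolding \<omega>_def by blast
qed

text \<open>Two characters with the prescribed values agree on generators, so the definite
  description denotes the character just constructed.\<close>

lemma (in comm_group) dual_generator:
  assumes fin: "finite (carrier G)" and S: "adapted_generators G S" and s: "s \<in> S"
  shows "dual_generator G S s \<in> characters G"
    "dual_generator G S s s = exp (2 * of_real pi * \<i> / of_nat (ord s))"
    "t \<in> S \<Longrightarrow> t \<noteq> s \<Longrightarrow> dual_generator G S s t = 1"
proof -
  let ?Q = "\<lambda>\<theta>. \<theta> \<in> characters G \<and> \<theta> s = exp (2 * of_real pi * \<i> / of_nat (ord s)) \<and> (\<forall>t\<in>S - {s}. \<theta> t = 1)"
  have SG: "S \<subseteq> carrier G" "generate G S = carrier G"
    using S by (auto simp: adapted_generators_def)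
  have "\<exists>!\<theta>. ?Q \<theta>"
  proof (rule ex_ex1I[OF dual_generator_exists[OF assms]])
    fix \<theta> \<eta> assume *: "?Q \<theta>" "?Q \<eta>"
    show "\<theta> = \<eta>"
    proof (rule characters_eqI[OF is_group _ _ SG])
      show "\<theta> t = \<eta> t" if "t \<in> S" for t using * that by (cases "t = s") auto
    qed (use * in auto)
  qed
  from theI'[OF this] have "?Q (dual_generator G S s)"
    unfolding dual_generator_def .
  then show "dual_generator G S s \<in> characters G"
    "dual_generator G S s s = exp (2 * of_real pi * \<i> / of_nat (ord s))"
    "t \<in> S \<Longrightarrow> t \<noteq> s \<Longrightarrow> dual_generator G S s t = 1" by auto
qed

lemma (in comm_group) dual_generator_finprod:
  assumes fin: "finite (carrier G)" and S: "adapted_generators G S" and s: "s \<in> S"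
  shows "dual_generator G S s (finprod G (\<lambda>t. t [^] n t) S) =
    exp (2 * of_real pi * \<i> / of_nat (ord s)) ^ n s"
proof -
  note \<theta> = dual_generator[OF assms]
  have SG: "S \<subseteq> carrier G" and finS: "finite S" using S by (auto simp: adapted_generators_def)
  have "dual_generator G S s (finprod G (\<lambda>t. t [^] n t) S) = (\<Prod>t\<in>S. dual_generator G S s (t [^] n t))"
    using SG by (intro character_finprod[OF \<theta>(1) finS]) auto
  also have "\<dots> = (\<Prod>t\<in>S. if t = s then exp (2 * of_real pi * \<i> / of_nat (ord s)) ^ n s else 1)"
    using SG \<theta>(2,3) charactersD(5)[OF is_group \<theta>(1)] by (intro prod.cong) auto
  also have "\<dots> = exp (2 * of_real pi * \<i> / of_nat (ord s)) ^ n s"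
    using finS s by simp
  finally show ?thesis .
qed

lemma (in comm_group) dual_generator_power_ord:
  assumes fin: "finite (carrier G)" and S: "adapted_generators G S" and s: "s \<in> S" and g: "g \<in> carrier G"
  shows "dual_generator G S s g ^ ord s = 1"
proof -
  obtain n :: "'a \<Rightarrow> nat" where n: "g = finprod G (\<lambda>s. s [^] n s) S"
    using adapted_generators_expansion[OF fin S g] .
  have "s \<in> carrier G" using S s by (auto simp: adapted_generators_def)
  then have "ord s \<noteq> 0" using ord_ge_1[OF fin] by fastforce
  then show ?thesis
    unfolding n dual_generator_finprod[OF fin S s] root_of_unity_power by (rule complex_root_unity)
qed

text \<open>Value 1 forces \<open>ord s\<close> to divide the exponent of \<open>s\<close>. With
  \<open>dual_generators_surj\<close> this identifies the group with the product of the groups of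
  roots of unity of order \<open>ord s\<close>, for \<open>s\<close> in \<open>S\<close>.\<close>

lemma (in comm_group) dual_generators_separate:
  assumes fin: "finite (carrier G)" and S: "adapted_generators G S" and g: "g \<in> carrier G"
    and one: "\<And>s. s \<in> S \<Longrightarrow> dual_generator G S s g = 1"
  shows "g = \<one>"
proof -
  obtain n :: "'a \<Rightarrow> nat" where n: "g = finprod G (\<lambda>s. s [^] n s) S"
    using adapted_generators_expansion[OF fin S g] .
  have SG: "S \<subseteq> carrier G" using S by (auto simp: adapted_generators_def)
  have "s [^] n s = \<one>" if s: "s \<in> S" for s
  proof -
    have sG: "s \<in> carrier G" using s SG by blast
    have "ord s dvd n s"
      using one[OF s] unfolding n dual_generator_finprod[OF fin S s] root_of_unity_power
      using complex_root_unity_eq_1[OF ord_ge_1[OF fin sG]] by blast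
    then show ?thesis using pow_eq_id[OF sG] by blast
  qed
  then show ?thesis unfolding n by (intro finprod_one_eqI)
qed

text \<open>Every root of unity of order \<open>ord s\<close> is a power of the primitive one; the
  exponents found separately for each \<open>s\<close> are the coordinates of the element.\<close>

lemma (in comm_group) dual_generators_surj:
  assumes fin: "finite (carrier G)" and S: "adapted_generators G S"
    and z: "\<And>s. s \<in> S \<Longrightarrow> z s ^ ord s = (1::complex)"
  shows "\<exists>g\<in>carrier G. \<forall>s\<in>S. dual_generator G S s g = z s"
proof -
  have SG: "S \<subseteq> carrier G" using S by (auto simp: adapted_generators_def)
  have "\<exists>j. z s = exp (2 * of_real pi * \<i> / of_nat (ord s)) ^ j" if s: "s \<in> S" for s
  proof -
    have "z s \<in> {z. z ^ ord s = 1}" using z[OF s] by simp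
    then show ?thesis
      unfolding root_of_unity_power using complex_roots_unity[OF ord_ge_1[OF fin, of s]] s SG by blast
  qed
  then obtain n where n: "\<And>s. s \<in> S \<Longrightarrow> z s = exp (2 * of_real pi * \<i> / of_nat (ord s)) ^ n s" by metis
  show ?thesis
    using SG n dual_generator_finprod[OF fin S]
    by (intro bexI[of _ "finprod G (\<lambda>s. s [^] n s) S"] finprod_closed) auto
qed

subsection \<open>Existence of adapted generators\<close>

lemma (in group) generate_eqI:
  assumes "A \<subseteq> carrier G" "B \<subseteq> carrier G" "A \<subseteq> generate G B" "B \<subseteq> generate G A"
  shows "generate G A = generate G B"
  using assms generate_subgroup_incl generate_is_subgroup by (metis subset_antisym)

text \<open>The elementary move on generating families. It loses nothing, being undone by
  multiplication with the inverse of \<open>g i\<close>.\<close>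

lemma (in group) generate_fun_upd_mult:
  assumes g: "g \<in> I \<rightarrow> carrier G" and ij: "i \<in> I" "j \<in> I" "i \<noteq> j"
  shows "generate G (g(j := g i \<otimes> g j) ` I) = generate G (g ` I)"
proof (rule generate_eqI)
  let ?g = "g(j := g i \<otimes> g j)"
  show A: "g ` I \<subseteq> carrier G" and B: "?g ` I \<subseteq> carrier G" using g ij by auto
  have "?g k \<in> generate G (g ` I)" if "k \<in> I" for k
    using that ij by (auto intro: generate.incl generate.eng)
  then show "?g ` I \<subseteq> generate G (g ` I)" by blast
  have mem: "?g k \<in> generate G (?g ` I)" if "k \<in> I" for k
    using that by (intro generate.incl imageI)
  have "g k \<in> generate G (?g ` I)" if k: "k \<in> I" for k
  proof (cases "k = j")
    case True
    have "g i \<in> generate G (?g ` I)" "g i \<otimes> g j \<in> generate G (?g ` I)"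
      using mem[OF ij(1)] mem[OF ij(2)] ij(3) by auto
    then have "inv (g i) \<otimes> (g i \<otimes> g j) \<in> generate G (?g ` I)"
      by (rule generate.eng[OF generate_m_inv_closed[OF B]])
    moreover have "inv (g i) \<otimes> (g i \<otimes> g j) = g j"
      using g ij by (simp add: Pi_iff m_assoc[symmetric])
    ultimately show ?thesis using True by simp
  next
    case False
    then show ?thesis using mem[OF k] by simp
  qed
  then show "g ` I \<subseteq> generate G (?g ` I)" by blast
qed

text \<open>Euclid's algorithm on the exponents of a relation, mirrored by changes of the generators.\<close>

lemma (in comm_group) relation_reduce:
  assumes "finite I" "g \<in> I \<rightarrow> carrier G" "finprod G (\<lambda>i. g i [^] (m i :: nat)) I = \<one>" "a \<in> I" "m a > 0"
  shows "\<exists>h i d. h \<in> I \<rightarrow> carrier G \<and> generate G (h ` I) = generate G (g ` I) \<and> i \<in> I \<and>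
    0 < d \<and> d \<le> m a \<and> h i [^] (d::nat) = \<one>"
  using assms(2-)
proof (induction "\<Sum>i\<in>I. m i" arbitrary: g m rule: less_induct)
  case less
  show ?case
  proof (cases "\<exists>b\<in>I - {a}. m b > 0")
    \<comment> \<open>No other exponent is left: the relation is a single power of
      \<open>g a\<close>.\<close>
    case False
    have "finprod G (\<lambda>i. g i [^] m i) I = finprod G (\<lambda>i. if a = i then g i [^] m i else \<one>) I"
      using False less.prems(1,3) by (intro finprod_cong') (auto simp: Pi_iff)
    also have "\<dots> = g a [^] m a"
      using less.prems(1) by (intro finprod_singleton[OF less.prems(3) assms(1)]) auto
    finally show ?thesis
      using less.prems by (intro exI[of _ g] exI[of _ a] exI[of _ "m a"]) simp
  next
    case True
    then obtain b where b: "b \<in> I" "b \<noteq> a" "m b > 0" by blast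
    \<comment> \<open>One Euclidean step: x^m y^n = x^(m - n) (x y)^n for n at most m, so the
      relation survives the elementary move, with a smaller exponent sum when n is positive.\<close>
    have step: "finprod G (\<lambda>k. (g(j := g i \<otimes> g j)) k [^] (m(i := m i - m j)) k) I = \<one>"
      if ij: "i \<in> I" "j \<in> I" "i \<noteq> j" "m j \<le> m i" for i j
    proof -
      define J where "J = I - {i, j}"
      have I: "I = insert i (insert j J)" and J: "finite J" "i \<notin> insert j J" "j \<notin> J"
        using ij assms(1) by (auto simp: J_def)
      have gc: "g i \<in> carrier G" "g j \<in> carrier G" "g \<in> J \<rightarrow> carrier G"
        using less.prems(1) ij by (auto simp: J_def)
      have eqJ: "finprod G (\<lambda>k. (g(j := g i \<otimes> g j)) k [^] (m(i := m i - m j)) k) J = finprod G (\<lambda>k. g k [^] m k) J"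
        using gc J by (intro finprod_cong') auto
      have P: "finprod G (\<lambda>k. g k [^] m k) J \<in> carrier G" using gc by (intro finprod_closed) auto
      have split: "finprod G f I = f i \<otimes> (f j \<otimes> finprod G f J)" if "f \<in> I \<rightarrow> carrier G" for f
        unfolding I using J that[unfolded I] by simp
      have dist: "(g i \<otimes> g j) [^] m j = g i [^] m j \<otimes> g j [^] m j"
        using gc by (intro pow_mult_distrib m_comm)
      have "(\<lambda>k. (g(j := g i \<otimes> g j)) k [^] (m(i := m i - m j)) k) \<in> I \<rightarrow> carrier G"
        using less.prems(1) gc by (auto simp: Pi_iff)
      from split[OF this]
      have "finprod G (\<lambda>k. (g(j := g i \<otimes> g j)) k [^] (m(i := m i - m j)) k) I =
          g i [^] (m i - m j) \<otimes> ((g i \<otimes> g j) [^] m j \<otimes> finprod G (\<lambda>k. g k [^] m k) J)"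
        unfolding eqJ using ij(3) by simp
      also have "\<dots> = (g i [^] (m i - m j) \<otimes> g i [^] m j) \<otimes> (g j [^] m j \<otimes> finprod G (\<lambda>k. g k [^] m k) J)"
        unfolding dist using gc P by (simp add: m_assoc)
      also have "\<dots> = g i [^] m i \<otimes> (g j [^] m j \<otimes> finprod G (\<lambda>k. g k [^] m k) J)"
        using gc ij(4) by (simp add: nat_pow_mult)
      also have "\<dots> = finprod G (\<lambda>k. g k [^] m k) I"
        using less.prems(1) by (intro split[symmetric]) (auto simp: Pi_iff)
      finally show ?thesis using less.prems(2) by simp
    qed
    have dec: "(\<Sum>k\<in>I. (m(i := m i - m j)) k) < (\<Sum>k\<in>I. m k)" if "i \<in> I" "0 < m j" "m j \<le> m i" for i j
      using that assms(1) by (intro sum_strict_mono_ex1) auto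
    have clo: "g(j := g i \<otimes> g j) \<in> I \<rightarrow> carrier G" if "i \<in> I" "j \<in> I" for i j
      using less.prems(1) that by (auto simp: Pi_iff)
    show ?thesis
    \<comment> \<open>The smaller exponent is subtracted from the larger. On a tie that of
      \<open>b\<close> is reduced, so the exponent of \<open>a\<close> stays positive and never
      grows.\<close>
    proof (cases "m a \<le> m b")
      case True
      from less.hyps[OF dec[OF b(1) less.prems(4) True] clo[OF b(1) less.prems(3)]
          step[OF b(1) less.prems(3) b(2) True] less.prems(3)]
      show ?thesis
        using less.prems(4) b(2) generate_fun_upd_mult[OF less.prems(1) b(1) less.prems(3) b(2)] by simp
    next
      case False
      then have le: "m b \<le> m a" by simp
      from less.hyps[OF dec[OF less.prems(3) b(3) le] clo[OF less.prems(3) b(1)]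
          step[OF less.prems(3) b(1) b(2)[symmetric] le] less.prems(3)]
      obtain h i d where "h \<in> I \<rightarrow> carrier G" "generate G (h ` I) = generate G (g(b := g a \<otimes> g b) ` I)"
        "i \<in> I" "0 < d" "d \<le> (m(a := m a - m b)) a" "h i [^] (d::nat) = \<one>"
        using False by auto
      then show ?thesis
        using generate_fun_upd_mult[OF less.prems(1) less.prems(3) b(1) b(2)[symmetric]]
        by (intro exI[of _ h] exI[of _ i] exI[of _ d]) auto
    qed
  qed
qed

text \<open>Families instead of sets: the moves may make entries coincide, while the number of
  indices has to stay fixed. For elements of finite order natural exponents express every
  relation.\<close>

definition independent_family :: "('g, 'z) monoid_scheme \<Rightarrow> ('i \<Rightarrow> 'g) \<Rightarrow> 'i set \<Rightarrow> bool" where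
  "independent_family G h I \<longleftrightarrow> (\<forall>m::'i \<Rightarrow> nat. finprod G (\<lambda>i. h i [^]\<^bsub>G\<^esub> m i) I = \<one>\<^bsub>G\<^esub> \<longrightarrow>
     (\<forall>i\<in>I. h i [^]\<^bsub>G\<^esub> m i = \<one>\<^bsub>G\<^esub>))"

text \<open>Rado's argument: a generator of least possible order can be split off as a direct factor, since a
  relation that involves it nontrivially would produce a generator of smaller order.\<close>

lemma (in comm_group) independent_generators_exist:
  fixes I :: "'i set"
  assumes fin: "finite (carrier G)" and "finite I" "g \<in> I \<rightarrow> carrier G"
  shows "\<exists>h\<in>I \<rightarrow> carrier G. generate G (h ` I) = generate G (g ` I) \<and> independent_family G h I"
  using assms(2,3)
proof (induction I arbitrary: g)
  case empty
  then show ?case by (auto simp: independent_family_def)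
next
  case (insert a I)
  let ?I = "insert a I"
  let ?X = "\<lambda>f. f \<in> ?I \<rightarrow> carrier G \<and> generate G (f ` ?I) = generate G (g ` ?I)"
  \<comment> \<open>Among all families generating the same subgroup, the order of the entry at the
    new index is made least; the other entries are left to the induction.\<close>
  obtain g0 where g0: "?X g0" "\<And>f. ?X f \<Longrightarrow> ord (g0 a) \<le> ord (f a)"
    using ex_has_least_nat[of ?X g "\<lambda>f. ord (f a)"] insert.prems by blast
  have g0I: "g0 \<in> I \<rightarrow> carrier G" and g0a: "g0 a \<in> carrier G" using g0(1) by auto
  obtain h where h: "h \<in> I \<rightarrow> carrier G" "generate G (h ` I) = generate G (g0 ` I)" "independent_family G h I"
    using insert.IH[OF g0I] by blast
  define h' where "h' = h(a := g0 a)"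
  have h'I: "h' ` ?I = insert (g0 a) (h ` I)" "\<And>i. i \<in> I \<Longrightarrow> h' i = h i"
    using insert.hyps(2) by (auto simp: h'_def)
  have h'c: "h' \<in> ?I \<rightarrow> carrier G" using h(1) g0a h'I(2) by (auto simp: h'_def)
  have gen: "generate G (h' ` ?I) = generate G (g ` ?I)"
  proof -
    have "generate G (h' ` ?I) = generate G (g0 ` ?I)"
    proof (rule generate_eqI)
      show "h' ` ?I \<subseteq> carrier G" "g0 ` ?I \<subseteq> carrier G" using h'c g0(1) by auto
      have "h ` I \<subseteq> generate G (g0 ` I)" unfolding h(2)[symmetric] by (auto intro: generate.incl)
      also have "\<dots> \<subseteq> generate G (g0 ` ?I)" by (rule mono_generate) auto
      finally show "h' ` ?I \<subseteq> generate G (g0 ` ?I)"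
        unfolding h'I(1) by (auto intro: generate.incl)
      have "g0 ` I \<subseteq> generate G (h ` I)" unfolding h(2) by (auto intro: generate.incl)
      also have "\<dots> \<subseteq> generate G (h' ` ?I)" unfolding h'I(1) by (rule mono_generate) auto
      finally show "g0 ` ?I \<subseteq> generate G (h' ` ?I)"
        unfolding h'I(1) by (auto intro: generate.incl)
    qed
    then show ?thesis using g0(1) by simp
  qed
  have "independent_family G h' ?I"
    unfolding independent_family_def
  proof (intro allI impI)
    fix m :: "'i \<Rightarrow> nat" assume rel: "finprod G (\<lambda>i. h' i [^] m i) ?I = \<one>"
    have rest: "finprod G (\<lambda>i. h' i [^] m' i) ?I = g0 a [^] m' a \<otimes> finprod G (\<lambda>i. h i [^] m' i) I" for m' :: "'i \<Rightarrow> nat"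
    proof -
      have "finprod G (\<lambda>i. h' i [^] m' i) I = finprod G (\<lambda>i. h i [^] m' i) I"
        using h(1) h'I(2) by (intro finprod_cong') (auto simp: Pi_iff)
      then show ?thesis
        using insert.hyps h'c by (subst finprod_insert) (auto simp: h'_def Pi_iff)
    qed
    have hI: "finprod G (\<lambda>i. h i [^] m i) I \<in> carrier G" using h(1) by (intro finprod_closed) (auto simp: Pi_iff)
    have am: "g0 a [^] m a = \<one>"
    proof (rule ccontr)
      assume ne: "g0 a [^] m a \<noteq> \<one>"
      \<comment> \<open>Reduction modulo the order keeps the relation and leaves an exponent that is
        positive yet smaller than the order, which \<open>relation_reduce\<close> turns into an
        entry of too small an order.\<close>
      define m' where "m' = m(a := m a mod ord (g0 a))"
      have ndvd: "\<not> ord (g0 a) dvd m a" using ne pow_eq_id[OF g0a] by blast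
      have pos: "m' a > 0" unfolding m'_def using ndvd by (simp add: mod_greater_zero_iff_not_dvd)
      have lt: "m' a < ord (g0 a)" unfolding m'_def using ord_ge_1[OF fin g0a] by simp
      have "g0 a [^] m' a = g0 a [^] m a"
      proof -
        have "g0 a [^] m a = g0 a [^] (ord (g0 a) * (m a div ord (g0 a)) + m a mod ord (g0 a))" by simp
        also have "\<dots> = (g0 a [^] ord (g0 a)) [^] (m a div ord (g0 a)) \<otimes> g0 a [^] (m a mod ord (g0 a))"
          using g0a by (simp only: nat_pow_mult[symmetric] nat_pow_pow nat_pow_closed)
        finally show ?thesis using g0a by (simp add: m'_def)
      qed
      moreover have "finprod G (\<lambda>i. h i [^] m' i) I = finprod G (\<lambda>i. h i [^] m i) I"
        using h(1) insert.hyps(2) by (intro finprod_cong') (auto simp: m'_def Pi_iff)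
      ultimately have "finprod G (\<lambda>i. h' i [^] m' i) ?I = \<one>"
        using rel rest by metis
      from relation_reduce[OF _ h'c this _ pos] insert.hyps(1)
      obtain f i d where f: "f \<in> ?I \<rightarrow> carrier G" "generate G (f ` ?I) = generate G (h' ` ?I)" "i \<in> ?I"
        "0 < d" "d \<le> m' a" "f i [^] (d::nat) = \<one>" by auto
      \<comment> \<open>Entries are exchanged so that the element of smaller order stands at
        \<open>a\<close>, where the minimality of \<open>g0\<close> applies.\<close>
      define f' where "f' = f(a := f i, i := f a)"
      have "f' ` ?I = f ` ?I" unfolding f'_def using f(3) by (auto simp: image_iff)
      moreover have "f' \<in> ?I \<rightarrow> carrier G" using f(1,3) unfolding f'_def by (auto simp: Pi_iff)
      ultimately have "ord (g0 a) \<le> ord (f' a)" using g0(2)[of f'] f(2) gen by simp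
      moreover have "f' a = f i" unfolding f'_def by auto
      moreover have "ord (f i) dvd d" using f(1,3,6) pow_eq_id[of "f i" d] by (auto simp: Pi_iff)
      ultimately show False using dvd_imp_le[of "ord (f i)" d] f(4,5) lt by simp
    qed
    then have "finprod G (\<lambda>i. h i [^] m i) I = \<one>" using rel rest[of m] hI by simp
    then have "\<forall>i\<in>I. h i [^] m i = \<one>" using h(3) unfolding independent_family_def by blast
    then show "\<forall>i\<in>?I. h' i [^] m i = \<one>" using am h'I(2) by (auto simp: h'_def)
  qed
  then show ?case using h'c gen by blast
qed

text \<open>Independence means a trivial kernel, once each component is written as a power of its
  generator. The image is a subgroup that contains \<open>S\<close>, hence the whole group.\<close>

lemma (in comm_group) finprod_in_iso:
  assumes fin: "finite (carrier G)" and S: "finite S" "S \<subseteq> carrier G" "generate G S = carrier G"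
    and ind: "independent_family G (\<lambda>s. s) S"
  shows "(\<lambda>x. finprod G x S) \<in> iso (product_group S (\<lambda>s. subgroup_generated G {s})) G"
proof -
  let ?P = "product_group S (\<lambda>s. subgroup_generated G {s})"
  have sub: "carrier (subgroup_generated G {s}) \<subseteq> carrier G" for s
    by (rule carrier_subgroup_generated_subset)
  have xc: "x \<in> S \<rightarrow> carrier G" if "x \<in> carrier ?P" for x
    using that sub by (fastforce simp: PiE_iff)
  have hom: "(\<lambda>x. finprod G x S) \<in> hom ?P G"
  proof (rule homI)
    show "finprod G x S \<in> carrier G" if "x \<in> carrier ?P" for x
      using xc[OF that] by (rule finprod_closed)
    fix x y assume xy: "x \<in> carrier ?P" "y \<in> carrier ?P"
    have "finprod G (x \<otimes>\<^bsub>?P\<^esub> y) S = finprod G (\<lambda>s. x s \<otimes> y s) S"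
      using xc[OF xy(1)] xc[OF xy(2)] by (intro finprod_cong') (auto simp: Pi_iff)
    then show "finprod G (x \<otimes>\<^bsub>?P\<^esub> y) S = finprod G x S \<otimes> finprod G y S"
      using xc[OF xy(1)] xc[OF xy(2)] by simp
  qed
  interpret H: group_hom ?P G "\<lambda>x. finprod G x S"
    using hom by (intro group_hom.intro group_hom_axioms.intro product_group group_subgroup_generated is_group)
  have "inj_on (\<lambda>x. finprod G x S) (carrier ?P)"
    unfolding H.inj_on_one_iff
  proof (intro allI impI)
    fix x assume x: "x \<in> carrier ?P" "finprod G x S = \<one>"
    have "\<forall>s\<in>S. \<exists>n::nat. x s = s [^] n"
      using cyclic_subgroup_nat_power[OF fin] S(2) x(1) by (metis PiE_mem carrier_product_group subsetD)
    then obtain n where n: "\<forall>s\<in>S. x s = s [^] (n s :: nat)" by metis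
    then have "finprod G (\<lambda>s. s [^] n s) S = finprod G x S"
      using xc[OF x(1)] by (intro finprod_cong') (auto simp: Pi_iff)
    then have "\<forall>s\<in>S. s [^] n s = \<one>"
      using ind x(2) unfolding independent_family_def by simp
    then show "x = \<one>\<^bsub>?P\<^esub>"
      using n x(1) by (auto simp: PiE_iff extensional_def)
  qed
  moreover have "carrier G \<subseteq> (\<lambda>x. finprod G x S) ` carrier ?P"
  proof -
    have "s \<in> (\<lambda>x. finprod G x S) ` carrier ?P" if s: "s \<in> S" for s
    proof -
      let ?x = "\<lambda>u\<in>S. if u = s then s else \<one>"
      have "s \<in> carrier (subgroup_generated G {s})"
        using s S(2) subgroup_generated_subset_carrier_subset[of "{s}"] by blast
      then have "?x \<in> carrier ?P"
        by (auto simp: PiE_iff) (metis group.is_monoid group_subgroup_generated monoid.one_closed one_subgroup_generated)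
      moreover have "finprod G ?x S = s"
      proof -
        have "finprod G ?x S = finprod G (\<lambda>u. if s = u then u else \<one>) S"
          using S(2) by (intro finprod_cong') (auto simp: Pi_iff)
        also have "\<dots> = s"
          using finprod_singleton[OF s S(1), of "\<lambda>u. u"] S(2) by (simp add: Pi_iff subset_iff)
        finally show ?thesis .
      qed
      ultimately show ?thesis by (metis image_eqI)
    qed
    then have "generate G S \<subseteq> (\<lambda>x. finprod G x S) ` carrier ?P"
      using H.img_is_subgroup by (intro generate_subgroup_incl) auto
    then show ?thesis using S(3) by simp
  qed
  ultimately show ?thesis
    using hom H.hom_closed unfolding iso_def bij_betw_def by blast
qed

text \<open>Start from a generating set of least cardinality. An independent family on that index
  set is injective, as otherwise its range would be a smaller generating set; so its range has least
  cardinality too.\<close>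

lemma (in comm_group) adapted_generators_exist:
  assumes fin: "finite (carrier G)"
  shows "\<exists>S. adapted_generators G S"
proof -
  let ?gen = "\<lambda>T. finite T \<and> T \<subseteq> carrier G \<and> generate G T = carrier G"
  have "?gen (carrier G)"
    using fin generate_incl[of "carrier G"] generate.incl[of _ "carrier G" G] by blast
  then obtain T where T: "?gen T" "\<And>T'. ?gen T' \<Longrightarrow> card T \<le> card T'"
    using ex_has_least_nat[of ?gen "carrier G" card] by blast
  have "(\<lambda>t. t) \<in> T \<rightarrow> carrier G" using T(1) by auto
  then obtain h where h: "h \<in> T \<rightarrow> carrier G" "generate G (h ` T) = generate G ((\<lambda>t. t) ` T)" "independent_family G h T"
    using independent_generators_exist[OF fin conjunct1[OF T(1)]] by blast
  have gen: "?gen (h ` T)" using h T(1) by auto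
  then have "card (h ` T) = card T"
    using T card_image_le[of T h] by (simp add: le_antisym)
  then have inj: "inj_on h T" using T(1) by (simp add: eq_card_imp_inj_on)
  have "independent_family G (\<lambda>s. s) (h ` T)"
    unfolding independent_family_def
  proof (intro allI impI)
    fix m :: "'a \<Rightarrow> nat" assume *: "finprod G (\<lambda>s. s [^] m s) (h ` T) = \<one>"
    have "finprod G (\<lambda>s. s [^] m s) (h ` T) = finprod G (\<lambda>t. h t [^] m (h t)) T"
      using h(1) by (intro finprod_reindex inj) (auto simp: Pi_iff)
    then have "\<forall>t\<in>T. h t [^] m (h t) = \<one>"
      using * by (intro h(3)[unfolded independent_family_def, THEN spec, of "\<lambda>t. m (h t)", THEN mp]) simp
    then show "\<forall>s\<in>h ` T. s [^] m s = \<one>" by blast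
  qed
  then have "(\<lambda>x. finprod G x (h ` T)) \<in> iso (product_group (h ` T) (\<lambda>s. subgroup_generated G {s})) G"
    using gen by (intro finprod_in_iso[OF fin]) auto
  then show ?thesis
    unfolding adapted_generators_def using gen T(2) \<open>card (h ` T) = card T\<close>
    by (intro exI[of _ "h ` T"]) auto
qed

section \<open>Orbit spaces of actions with an equivariant map to the group\<close>

lemma is_chartI:
  fixes f :: "'a \<Rightarrow> 'e::real_inner"
  assumes "openin X U" "inj_on f U" "\<And>T. open T \<Longrightarrow> openin X {x \<in> U. f x \<in> T}"
    and "\<And>W. openin X W \<Longrightarrow> W \<subseteq> U \<Longrightarrow> open (f ` W)"
  shows "is_chart X (U, f)"
proof -
  have U: "U \<subseteq> topspace X" using assms(1) by (rule openin_subset)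
  have cont: "continuous_map (subtopology X U) (top_of_set (f ` U)) f"
    unfolding continuous_map_in_subtopology
  proof (intro conjI)
    show "continuous_map (subtopology X U) euclidean f"
      unfolding continuous_map_def
    proof (intro conjI allI impI)
      fix T :: "'e set" assume "openin euclidean T"
      then have "openin X {x \<in> U. f x \<in> T}" using assms(3) by simp
      moreover have "{x \<in> topspace (subtopology X U). f x \<in> T} = {x \<in> U. f x \<in> T}" using U by auto
      ultimately show "openin (subtopology X U) {x \<in> topspace (subtopology X U). f x \<in> T}"
        using assms(1) by (simp add: openin_open_subtopology)
    qed auto
    show "f \<in> topspace (subtopology X U) \<rightarrow> f ` U" using U by auto
  qed
  have "open_map (subtopology X U) (top_of_set (f ` U)) f"
    unfolding open_map_def
  proof (intro allI impI)
    fix W assume "openin (subtopology X U) W"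
    then have "openin X W" "W \<subseteq> U" using assms(1) by (auto simp: openin_open_subtopology)
    then show "openin (top_of_set (f ` U)) (f ` W)"
      using assms(4)[of W] assms(4)[OF assms(1)] by (auto simp: openin_open_eq)
  qed
  then have "homeomorphic_map (subtopology X U) (top_of_set (f ` U)) f"
    using cont U assms(2) by (intro bijective_open_imp_homeomorphic_map) (auto simp: inf_absorb2)
  then show ?thesis
    unfolding is_chart_def using assms(1) assms(4)[OF assms(1)] by auto
qed

text \<open>Lets a global trivialization serve as the local one required by
  \<open>principal_bundle\<close>, with the whole base as neighbourhood.\<close>

lemma open_submanifold_whole:
  fixes N :: "('b, 'f::real_inner) manifold"
  assumes "charted N" "man_space N \<subseteq> W"
  shows "open_submanifold N W = N"
proof -
  have "subtopology (mtop N) W = mtop N" using assms(2) by (simp add: subtopology_superset)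
  moreover have "(\<lambda>(U, \<phi>). (U \<inter> W, \<phi>)) c = c" if "c \<in> atlas N" for c
  proof -
    obtain U \<phi> where c: "c = (U, \<phi>)" by (cases c)
    have "U \<subseteq> man_space N" using is_chartD(4)[OF charted_is_chart[OF assms(1)]] that unfolding c by blast
    then show ?thesis using assms(2) unfolding c by auto
  qed
  ultimately show ?thesis unfolding open_submanifold_def by simp
qed

section \<open>Smooth actions, and their properness for a finite group\<close>

locale smooth_action =
  fixes P :: "('a, 'e::real_inner) manifold" and \<Lambda> :: "('g, 'z) monoid_scheme"
    and \<sigma> :: "'a \<times> 'g \<Rightarrow> 'a"
  assumes P: "smooth_manifold P" and \<Lambda>: "group \<Lambda>" and act: "smooth_right_action P \<Lambda> \<sigma>"
begin

lemmas P' = smooth_manifold_charted[OF P]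

lemma P_Hausdorff: "Hausdorff_space (mtop P)" and P_second_countable: "second_countable (mtop P)"
  and P_paracompact: "paracompact_space (mtop P)"
  using P by (simp_all add: smooth_manifold_def)

lemma \<sigma>_one: "p \<in> man_space P \<Longrightarrow> \<sigma> (p, \<one>\<^bsub>\<Lambda>\<^esub>) = p"
  and \<sigma>_mult: "p \<in> man_space P \<Longrightarrow> g \<in> carrier \<Lambda> \<Longrightarrow> h \<in> carrier \<Lambda> \<Longrightarrow> \<sigma> (\<sigma> (p, g), h) = \<sigma> (p, g \<otimes>\<^bsub>\<Lambda>\<^esub> h)"
  and \<sigma>_smooth: "smooth_map (prod_discrete P \<Lambda>) P \<sigma>"
  using act unfolding smooth_right_action_def by auto

lemma \<sigma>_continuous:
  assumes g: "g \<in> carrier \<Lambda>"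
  shows "continuous_map (mtop P) (mtop P) (\<lambda>p. \<sigma> (p, g))"
proof -
  have "continuous_map (prod_topology (mtop P) (discrete_topology (carrier \<Lambda>))) (mtop P) \<sigma>"
    using \<sigma>_smooth unfolding smooth_map_def mtop_prod_discrete by blast
  moreover have "continuous_map (mtop P) (prod_topology (mtop P) (discrete_topology (carrier \<Lambda>))) (\<lambda>p. (p, g))"
    using g by (intro continuous_map_pairedI) auto
  ultimately have "continuous_map (mtop P) (mtop P) (\<sigma> \<circ> (\<lambda>p. (p, g)))"
    using continuous_map_compose by blast
  then show ?thesis by (simp add: o_def)
qed

lemma \<sigma>_closed: "p \<in> man_space P \<Longrightarrow> g \<in> carrier \<Lambda> \<Longrightarrow> \<sigma> (p, g) \<in> man_space P"
  using \<sigma>_continuous continuous_map_image_subset_topspace by blast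

lemma \<sigma>_smooth_at_chart:
  assumes "p \<in> man_space P" "g \<in> carrier \<Lambda>" "(V, \<psi>) \<in> atlas P" "\<sigma> (p, g) \<in> V"
  shows "smooth_at P (\<lambda>x. \<psi> (\<sigma> (x, g))) p"
proof -
  have "(p, g) \<in> man_space (prod_discrete P \<Lambda>)" using assms by (simp add: mtop_prod_discrete)
  then have "smooth_at (prod_discrete P \<Lambda>) (\<psi> \<circ> \<sigma>) (p, g)"
    using \<sigma>_smooth assms unfolding smooth_map_iff[OF charted_prod_discrete[OF P'] P'] by blast
  then show ?thesis
    unfolding smooth_at_prod_discrete[OF P' assms(2)] by simp
qed

lemma \<sigma>_smooth_map:
  assumes g: "g \<in> carrier \<Lambda>"
  shows "smooth_map P P (\<lambda>p. \<sigma> (p, g))"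
  unfolding smooth_map_iff[OF P' P'] o_def
  using \<sigma>_continuous[OF g] \<sigma>_smooth_at_chart[OF _ g] by auto

text \<open>A closed set splits into finitely many sheets, and on each the map is the graph
  embedding of a continuous map into a Hausdorff space, which is a closed map. The fibres are
  finite.\<close>

lemma proper_action_finite:
  assumes fin: "finite (carrier \<Lambda>)"
  shows "proper_action P \<Lambda> \<sigma>"
  unfolding proper_action_def mtop_prod_discrete proper_map_def
proof (intro conjI ballI)
  let ?X = "prod_topology (mtop P) (discrete_topology (carrier \<Lambda>))"
  let ?f = "\<lambda>(p, g). (p, \<sigma> (p, g))"
  have pair: "continuous_map (mtop P) ?X (\<lambda>p. (p, g))" if "g \<in> carrier \<Lambda>" for g
    using that by (intro continuous_map_pairedI) auto
  show "closed_map ?X (prod_topology (mtop P) (mtop P)) ?f"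
    unfolding closed_map_def
  proof (intro allI impI)
    fix C assume C: "closedin ?X C"
    have CX: "C \<subseteq> man_space P \<times> carrier \<Lambda>" using closedin_subset[OF C] by simp
    have "?f ` C = (\<Union>g\<in>carrier \<Lambda>. (\<lambda>p. (p, \<sigma> (p, g))) ` {p \<in> man_space P. (p, g) \<in> C})"
      using CX by (auto simp: image_iff)
    moreover have "closedin (prod_topology (mtop P) (mtop P)) ((\<lambda>p. (p, \<sigma> (p, g))) ` {p \<in> man_space P. (p, g) \<in> C})"
      if g: "g \<in> carrier \<Lambda>" for g
      using closed_map_paired_continuous_map_right[OF \<sigma>_continuous[OF g] P_Hausdorff]
        closedin_continuous_map_preimage[OF pair[OF g] C] unfolding closed_map_def by blast
    ultimately show "closedin (prod_topology (mtop P) (mtop P)) (?f ` C)"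
      using fin by (auto intro: closedin_Union)
  qed
  show "compactin ?X {x \<in> topspace ?X. ?f x = y}" if "y \<in> topspace (prod_topology (mtop P) (mtop P))" for y
  proof (rule finite_imp_compactin)
    have "{x \<in> topspace ?X. ?f x = y} \<subseteq> {fst y} \<times> carrier \<Lambda>" by auto
    then show "finite {x \<in> topspace ?X. ?f x = y}" using fin finite_subset by blast
  qed auto
qed

end

text \<open>A locally constant equivariant map to the group is the group component of a
  trivialization. Freeness, the structure of the orbit space and triviality are all deduced from
  it.\<close>

locale equivariant_action = smooth_action P \<Lambda> \<sigma>
  for P :: "('a, 'e::real_inner) manifold" and \<Lambda> :: "('g, 'z) monoid_scheme" and \<sigma> +
  fixes \<tau> :: "'a \<Rightarrow> 'g"
  assumes \<tau>_closed: "p \<in> man_space P \<Longrightarrow> \<tau> p \<in> carrier \<Lambda>"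
    and \<tau>_act: "p \<in> man_space P \<Longrightarrow> g \<in> carrier \<Lambda> \<Longrightarrow> \<tau> (\<sigma> (p, g)) = \<tau> p \<otimes>\<^bsub>\<Lambda>\<^esub> g"
    and \<tau>_open: "openin (mtop P) {p \<in> man_space P. \<tau> p = g}"
begin

interpretation L: group \<Lambda> by (rule \<Lambda>)

abbreviation "pr \<equiv> orbit_map \<Lambda> \<sigma>"
abbreviation "M \<equiv> orbit_manifold P \<Lambda> \<sigma>"

lemma free: "free_action P \<Lambda> \<sigma>"
  unfolding free_action_def
proof (intro ballI impI)
  fix p g assume *: "p \<in> man_space P" "g \<in> carrier \<Lambda>" "\<sigma> (p, g) = p"
  then have "\<tau> p \<otimes>\<^bsub>\<Lambda>\<^esub> g = \<tau> p" using \<tau>_act by metis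
  then show "g = \<one>\<^bsub>\<Lambda>\<^esub>" using \<tau>_closed *(1,2) by simp
qed

lemma orbit_map_act: "p \<in> man_space P \<Longrightarrow> g \<in> carrier \<Lambda> \<Longrightarrow> pr (\<sigma> (p, g)) = pr p"
proof -
  assume *: "p \<in> man_space P" "g \<in> carrier \<Lambda>"
  have "pr (\<sigma> (p, g)) = (\<lambda>h. \<sigma> (p, g \<otimes>\<^bsub>\<Lambda>\<^esub> h)) ` carrier \<Lambda>"
    unfolding orbit_map_def using \<sigma>_mult[OF *] by (intro image_cong) auto
  also have "\<dots> = (\<lambda>h. \<sigma> (p, h)) ` ((\<lambda>h. g \<otimes>\<^bsub>\<Lambda>\<^esub> h) ` carrier \<Lambda>)" by auto
  also have "(\<lambda>h. g \<otimes>\<^bsub>\<Lambda>\<^esub> h) ` carrier \<Lambda> = carrier \<Lambda>"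
    using L.surj_const_mult *(2) by auto
  finally show ?thesis unfolding orbit_map_def .
qed

lemma orbit_map_eqD:
  assumes "p \<in> man_space P" "p' \<in> man_space P" "pr p = pr p'"
  obtains g where "g \<in> carrier \<Lambda>" "p' = \<sigma> (p, g)"
proof -
  have "p' \<in> pr p'" unfolding orbit_map_def using \<sigma>_one[OF assms(2)] L.one_closed by (metis image_eqI)
  then show thesis using assms(3) that unfolding orbit_map_def by auto
qed

lemma orbit_map_eq_\<tau>_eq:
  assumes "p \<in> man_space P" "p' \<in> man_space P" "pr p = pr p'" "\<tau> p = \<tau> p'"
  shows "p = p'"
proof -
  obtain g where g: "g \<in> carrier \<Lambda>" "p' = \<sigma> (p, g)" using orbit_map_eqD[OF assms(1-3)] .
  then have "\<tau> p \<otimes>\<^bsub>\<Lambda>\<^esub> g = \<tau> p" using \<tau>_act[OF assms(1) g(1)] assms(4) by simp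
  then have "g = \<one>\<^bsub>\<Lambda>\<^esub>" using \<tau>_closed[OF assms(1)] g(1) by simp
  then show ?thesis using g \<sigma>_one[OF assms(1)] by simp
qed

subsection \<open>The quotient topology\<close>

lemma openin_orbit:
  "openin (mtop M) W \<longleftrightarrow> W \<subseteq> pr ` man_space P \<and> openin (mtop P) {p \<in> man_space P. pr p \<in> W}"
proof -
  have "istopology (\<lambda>W. W \<subseteq> pr ` man_space P \<and> openin (mtop P) {p \<in> man_space P. pr p \<in> W})"
    unfolding istopology_def
  proof (intro conjI allI impI)
    fix A B assume *: "A \<subseteq> pr ` man_space P \<and> openin (mtop P) {p \<in> man_space P. pr p \<in> A}"
      "B \<subseteq> pr ` man_space P \<and> openin (mtop P) {p \<in> man_space P. pr p \<in> B}"
    have "{p \<in> man_space P. pr p \<in> A \<inter> B} = {p \<in> man_space P. pr p \<in> A} \<inter> {p \<in> man_space P. pr p \<in> B}" by auto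
    then show "openin (mtop P) {p \<in> man_space P. pr p \<in> A \<inter> B}" using * by auto
    show "A \<inter> B \<subseteq> pr ` man_space P" using * by auto
  next
    fix \<K> assume *: "\<forall>K\<in>\<K>. K \<subseteq> pr ` man_space P \<and> openin (mtop P) {p \<in> man_space P. pr p \<in> K}"
    have "{p \<in> man_space P. pr p \<in> \<Union>\<K>} = (\<Union>K\<in>\<K>. {p \<in> man_space P. pr p \<in> K})" by auto
    then show "openin (mtop P) {p \<in> man_space P. pr p \<in> \<Union>\<K>}" using * by auto
    show "\<Union>\<K> \<subseteq> pr ` man_space P" using * by auto
  qed
  then show ?thesis
    unfolding orbit_manifold_def Let_def by (simp add: topology_inverse')
qed

lemma man_space_orbit: "man_space M = pr ` man_space P"
proof
  show "man_space M \<subseteq> pr ` man_space P" using openin_orbit[of "man_space M"] by simp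
  have "{p \<in> man_space P. pr p \<in> pr ` man_space P} = man_space P" by auto
  then have "openin (mtop M) (pr ` man_space P)" unfolding openin_orbit by simp
  then show "pr ` man_space P \<subseteq> man_space M" by (rule openin_subset)
qed

text \<open>The saturation of an open set is the union of its preimages under the
  translations.\<close>

lemma open_orbit_image:
  assumes V: "openin (mtop P) V"
  shows "openin (mtop M) (pr ` V)"
  unfolding openin_orbit
proof
  have VP: "V \<subseteq> man_space P" using V by (rule openin_subset)
  then show "pr ` V \<subseteq> pr ` man_space P" by blast
  have "{p \<in> man_space P. pr p \<in> pr ` V} = (\<Union>g\<in>carrier \<Lambda>. {p \<in> man_space P. \<sigma> (p, g) \<in> V})"
  proof (intro equalityI subsetI)
    fix p assume "p \<in> {p \<in> man_space P. pr p \<in> pr ` V}"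
    then obtain v where v: "p \<in> man_space P" "v \<in> V" "pr p = pr v" by blast
    then obtain g where "g \<in> carrier \<Lambda>" "v = \<sigma> (p, g)" using orbit_map_eqD[of p v] VP by blast
    then show "p \<in> (\<Union>g\<in>carrier \<Lambda>. {p \<in> man_space P. \<sigma> (p, g) \<in> V})" using v by blast
  next
    fix p assume "p \<in> (\<Union>g\<in>carrier \<Lambda>. {p \<in> man_space P. \<sigma> (p, g) \<in> V})"
    then obtain g where "g \<in> carrier \<Lambda>" "p \<in> man_space P" "\<sigma> (p, g) \<in> V" by blast
    then show "p \<in> {p \<in> man_space P. pr p \<in> pr ` V}" using orbit_map_act[of p g] by (metis (mono_tags, lifting) image_eqI mem_Collect_eq)
  qed
  moreover have "openin (mtop P) {p \<in> man_space P. \<sigma> (p, g) \<in> V}" if "g \<in> carrier \<Lambda>" for g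
    by (rule openin_continuous_map_preimage[OF \<sigma>_continuous[OF that] V])
  ultimately show "openin (mtop P) {p \<in> man_space P. pr p \<in> pr ` V}" by auto
qed

lemma continuous_orbit_map: "continuous_map (mtop P) (mtop M) pr"
  unfolding continuous_map_def man_space_orbit using openin_orbit by auto

text \<open>The unit sheet: an open set that meets each orbit exactly once. Topological properties
  descend to the orbit space because \<open>pr\<close> is open and is injective on this set.\<close>

definition "slice = {p \<in> man_space P. \<tau> p = \<one>\<^bsub>\<Lambda>\<^esub>}"

definition "retr p = \<sigma> (p, inv\<^bsub>\<Lambda>\<^esub> \<tau> p)"

lemma slice_open: "openin (mtop P) slice"
  unfolding slice_def by (rule \<tau>_open)

lemma slice_inj: "inj_on pr slice"
  unfolding slice_def by (rule inj_onI) (use orbit_map_eq_\<tau>_eq in auto)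

lemma retr_slice:
  assumes "p \<in> man_space P"
  shows "retr p \<in> slice" "pr (retr p) = pr p" "\<sigma> (retr p, \<tau> p) = p" "retr p \<in> man_space P"
  unfolding slice_def retr_def
  using assms \<tau>_closed[OF assms] by (auto simp: \<sigma>_closed \<tau>_act orbit_map_act \<sigma>_mult \<sigma>_one)

lemma retr_cong: "p \<in> man_space P \<Longrightarrow> p' \<in> man_space P \<Longrightarrow> pr p = pr p' \<Longrightarrow> retr p = retr p'"
  using retr_slice slice_inj by (metis inj_onD)

lemma orbit_Hausdorff: "Hausdorff_space (mtop M)"
  unfolding Hausdorff_space_def
proof (intro allI impI)
  fix x y assume "x \<in> man_space M \<and> y \<in> man_space M \<and> x \<noteq> y"
  then obtain p q where pq: "p \<in> man_space P" "q \<in> man_space P" "x = pr p" "y = pr q" "pr p \<noteq> pr q"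
    unfolding man_space_orbit by blast
  then have "retr p \<noteq> retr q" using retr_slice(2) by metis
  then obtain A B where AB: "openin (mtop P) A" "openin (mtop P) B" "retr p \<in> A" "retr q \<in> B" "disjnt A B"
    using P_Hausdorff retr_slice(4) pq unfolding Hausdorff_space_def by metis
  have "disjnt (pr ` (A \<inter> slice)) (pr ` (B \<inter> slice))"
    using AB(5) slice_inj unfolding disjnt_def by (auto dest: inj_onD)
  moreover have "openin (mtop M) (pr ` (A \<inter> slice))" "openin (mtop M) (pr ` (B \<inter> slice))"
    using AB slice_open by (auto intro: open_orbit_image)
  moreover have "x \<in> pr ` (A \<inter> slice)" "y \<in> pr ` (B \<inter> slice)"
    using AB retr_slice pq by (metis IntI image_eqI)+
  ultimately show "\<exists>U V. openin (mtop M) U \<and> openin (mtop M) V \<and> x \<in> U \<and> y \<in> V \<and> disjnt U V" by blast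
qed

lemma orbit_second_countable: "second_countable (mtop M)"
proof -
  obtain \<B> where \<B>: "countable \<B>" "\<And>V. V \<in> \<B> \<Longrightarrow> openin (mtop P) V"
    "\<And>U x. openin (mtop P) U \<Longrightarrow> x \<in> U \<Longrightarrow> \<exists>V\<in>\<B>. x \<in> V \<and> V \<subseteq> U"
    using P_second_countable unfolding second_countable_def by metis
  show ?thesis
    unfolding second_countable_def
  proof (intro exI[of _ "(\<lambda>B. pr ` (B \<inter> slice)) ` \<B>"] conjI ballI allI impI)
    show "countable ((\<lambda>B. pr ` (B \<inter> slice)) ` \<B>)" using \<B>(1) by simp
    show "openin (mtop M) V" if "V \<in> (\<lambda>B. pr ` (B \<inter> slice)) ` \<B>" for V
      using that \<B>(2) slice_open by (auto intro: open_orbit_image)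
    fix W x assume W: "openin (mtop M) W \<and> x \<in> W"
    then obtain p where p: "p \<in> man_space P" "x = pr p" using openin_orbit by blast
    have "openin (mtop P) {p \<in> man_space P. pr p \<in> W}" "retr p \<in> {p \<in> man_space P. pr p \<in> W}"
      using W p retr_slice[OF p(1)] openin_orbit by auto
    then obtain B where B: "B \<in> \<B>" "retr p \<in> B" "B \<subseteq> {p \<in> man_space P. pr p \<in> W}" using \<B>(3) by blast
    have "x \<in> pr ` (B \<inter> slice)" using B(2) retr_slice[OF p(1)] p(2) by (metis IntI image_eqI)
    moreover have "pr ` (B \<inter> slice) \<subseteq> W" using B(3) by blast
    ultimately show "\<exists>V\<in>(\<lambda>B. pr ` (B \<inter> slice)) ` \<B>. x \<in> V \<and> V \<subseteq> W" using B(1) by blast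
  qed
qed

lemma orbit_paracompact: "paracompact_space (mtop M)"
  unfolding paracompact_space_def
proof (intro allI impI)
  fix \<U> assume \<U>: "(\<forall>U\<in>\<U>. openin (mtop M) U) \<and> \<Union>\<U> = man_space M"
  define \<U>' where "\<U>' = (\<lambda>U. {p \<in> man_space P. pr p \<in> U}) ` \<U>"
  have "\<forall>U\<in>\<U>'. openin (mtop P) U" unfolding \<U>'_def using \<U> openin_orbit by auto
  moreover have "\<Union>\<U>' = man_space P" unfolding \<U>'_def using \<U> man_space_orbit by auto
  ultimately have "\<exists>\<V>. (\<forall>V\<in>\<V>. openin (mtop P) V \<and> (\<exists>U\<in>\<U>'. V \<subseteq> U)) \<and> \<Union>\<V> = man_space P \<and>
      locally_finite_in (mtop P) \<V>"
    using P_paracompact[unfolded paracompact_space_def, THEN spec, of \<U>'] by blast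
  then obtain \<V> where \<V>0: "\<forall>V\<in>\<V>. openin (mtop P) V \<and> (\<exists>U\<in>\<U>'. V \<subseteq> U)"
    "\<Union>\<V> = man_space P" "locally_finite_in (mtop P) \<V>"
    by (elim exE conjE)
  have \<V>: "openin (mtop P) V" "\<exists>U\<in>\<U>'. V \<subseteq> U" if "V \<in> \<V>" for V
    using \<V>0(1) that by blast+
  define \<W> where "\<W> = (\<lambda>V. pr ` (V \<inter> slice)) ` \<V>"
  have sub: "\<Union>\<W> \<subseteq> man_space M" unfolding \<W>_def man_space_orbit slice_def by auto
  have cov: "\<Union>\<W> = man_space M"
  proof (rule equalityI[OF sub], rule subsetI)
    fix x assume "x \<in> man_space M"
    then obtain p where p: "p \<in> man_space P" "x = pr p" unfolding man_space_orbit by blast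
    have "retr p \<in> \<Union>\<V>" using \<V>0(2) retr_slice(4)[OF p(1)] by simp
    then obtain V where V: "V \<in> \<V>" "retr p \<in> V" by blast
    have "pr (retr p) \<in> pr ` (V \<inter> slice)" using V(2) retr_slice(1)[OF p(1)] by blast
    then show "x \<in> \<Union>\<W>" unfolding \<W>_def using V(1) retr_slice(2)[OF p(1)] p(2) by auto
  qed
  have "locally_finite_in (mtop M) \<W>"
    unfolding locally_finite_in_def
  proof (intro conjI ballI sub)
    fix x assume "x \<in> man_space M"
    then obtain p where p: "p \<in> man_space P" "x = pr p" unfolding man_space_orbit by blast
    obtain N where N: "openin (mtop P) N" "retr p \<in> N" "finite {V \<in> \<V>. V \<inter> N \<noteq> {}}"
      using \<V>0(3) retr_slice(4)[OF p(1)] unfolding locally_finite_in_def by blast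
    \<comment> \<open>Two subsets of the slice whose images under \<open>pr\<close> meet already
      meet themselves, since \<open>pr\<close> is injective there; so local finiteness
      descends.\<close>
    have "{W \<in> \<W>. W \<inter> pr ` (N \<inter> slice) \<noteq> {}} \<subseteq> (\<lambda>V. pr ` (V \<inter> slice)) ` {V \<in> \<V>. V \<inter> N \<noteq> {}}"
    proof
      fix W assume "W \<in> {W \<in> \<W>. W \<inter> pr ` (N \<inter> slice) \<noteq> {}}"
      then obtain V a b where "V \<in> \<V>" "W = pr ` (V \<inter> slice)" "a \<in> V" "a \<in> slice" "b \<in> N" "b \<in> slice" "pr a = pr b"
        unfolding \<W>_def by fastforce
      moreover from this have "a = b" using slice_inj by (auto dest: inj_onD)
      ultimately show "W \<in> (\<lambda>V. pr ` (V \<inter> slice)) ` {V \<in> \<V>. V \<inter> N \<noteq> {}}" by blast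
    qed
    then have "finite {W \<in> \<W>. W \<inter> pr ` (N \<inter> slice) \<noteq> {}}"
      using N(3) finite_surj by blast
    moreover have "openin (mtop M) (pr ` (N \<inter> slice))" using N(1) slice_open by (auto intro: open_orbit_image)
    moreover have "x \<in> pr ` (N \<inter> slice)" using N(2) retr_slice[OF p(1)] p(2) by (metis IntI image_eqI)
    ultimately show "\<exists>V. openin (mtop M) V \<and> x \<in> V \<and> finite {U \<in> \<W>. U \<inter> V \<noteq> {}}" by blast
  qed
  moreover have "openin (mtop M) W \<and> (\<exists>U\<in>\<U>. W \<subseteq> U)" if W: "W \<in> \<W>" for W
  proof -
    obtain V where V: "V \<in> \<V>" "W = pr ` (V \<inter> slice)" using W unfolding \<W>_def by blast
    obtain U where U: "U \<in> \<U>" "V \<subseteq> {p \<in> man_space P. pr p \<in> U}" using \<V>(2)[OF V(1)] unfolding \<U>'_def by blast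
    have "openin (mtop M) W" unfolding V(2) using \<V>(1)[OF V(1)] slice_open by (auto intro: open_orbit_image)
    moreover have "W \<subseteq> U" unfolding V(2) using U(2) by blast
    ultimately show ?thesis using U(1) by blast
  qed
  ultimately show "\<exists>\<W>. (\<forall>W\<in>\<W>. openin (mtop M) W \<and> (\<exists>U\<in>\<U>. W \<subseteq> U)) \<and> \<Union>\<W> = man_space M \<and>
      locally_finite_in (mtop M) \<W>"
    using cov by blast
qed

subsection \<open>The smooth structure of the orbit space\<close>

lemma orbit_atlasE:
  assumes "(W, \<xi>) \<in> atlas M"
  obtains U \<phi> V where "(U, \<phi>) \<in> atlas P" "V \<subseteq> U" "openin (mtop P) V" "inj_on pr V"
    "W = pr ` V" "\<And>v. v \<in> V \<Longrightarrow> \<xi> (pr v) = \<phi> v" "V \<subseteq> man_space P"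
proof -
  obtain U V \<phi> where *: "W = pr ` V" "\<xi> = \<phi> \<circ> inv_into V pr" "(U, \<phi>) \<in> atlas P" "V \<subseteq> U" "openin (mtop P) V" "inj_on pr V"
    using assms unfolding orbit_manifold_def Let_def by auto
  show thesis
    by (rule that[OF *(3,4,5,6,1)]) (use * openin_subset[OF *(5)] in auto)
qed

lemma orbit_chart_inj:
  assumes "(U, \<phi>) \<in> atlas P" "V \<subseteq> U" "\<And>v. v \<in> V \<Longrightarrow> \<xi> (pr v) = \<phi> v"
  shows "inj_on \<xi> (pr ` V)" "v \<in> V \<Longrightarrow> inv_into (pr ` V) \<xi> (\<phi> v) = pr v"
proof -
  have inj: "inj_on \<phi> V" using is_chartD(5)[OF charted_is_chart[OF P' assms(1)]] assms(2) inj_on_subset by blast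
  then show 1: "inj_on \<xi> (pr ` V)" using assms(3) unfolding inj_on_def by auto
  show "inv_into (pr ` V) \<xi> (\<phi> v) = pr v" if "v \<in> V"
    using inv_into_f_f[OF 1, of "pr v"] that assms(3) by simp
qed

lemma charted_orbit: "charted M"
  unfolding charted_def
proof (intro conjI ballI)
  fix c assume "c \<in> atlas M"
  then obtain W \<xi> where c: "c = (W, \<xi>)" "(W, \<xi>) \<in> atlas M" by (cases c) auto
  obtain U \<phi> V where V: "(U, \<phi>) \<in> atlas P" "V \<subseteq> U" "openin (mtop P) V" "inj_on pr V"
    "W = pr ` V" "\<And>v. v \<in> V \<Longrightarrow> \<xi> (pr v) = \<phi> v" "V \<subseteq> man_space P"
    by (rule orbit_atlasE[OF c(2)]) (rule that)
  note cU = charted_is_chart[OF P' V(1)]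
  show "is_chart (mtop M) c"
    unfolding c(1)
  proof (rule is_chartI)
    show "openin (mtop M) W" unfolding V(5) by (rule open_orbit_image[OF V(3)])
    show "inj_on \<xi> W" unfolding V(5) by (rule orbit_chart_inj(1)[OF V(1,2,6)])
    fix T :: "'e set" assume "open T"
    then have "openin (mtop P) ({x \<in> U. \<phi> x \<in> T} \<inter> V)" using chart_open_preimage[OF cU] V(3) by blast
    then have "openin (mtop M) (pr ` ({x \<in> U. \<phi> x \<in> T} \<inter> V))" by (rule open_orbit_image)
    moreover have "{x \<in> W. \<xi> x \<in> T} = pr ` ({x \<in> U. \<phi> x \<in> T} \<inter> V)" unfolding V(5) using V(2,6) by auto
    ultimately show "openin (mtop M) {x \<in> W. \<xi> x \<in> T}" by simp
  next
    fix X assume X: "openin (mtop M) X" "X \<subseteq> W"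
    have "openin (mtop P) ({p \<in> man_space P. pr p \<in> X} \<inter> V)" using X(1) V(3) openin_orbit by blast
    then have "open (\<phi> ` ({p \<in> man_space P. pr p \<in> X} \<inter> V))" using V(2) by (intro chart_open_image[OF cU]) auto
    moreover have "\<xi> ` X = \<phi> ` ({p \<in> man_space P. pr p \<in> X} \<inter> V)"
    proof (intro equalityI subsetI)
      fix y assume "y \<in> \<xi> ` X"
      then obtain v where "v \<in> V" "pr v \<in> X" "y = \<xi> (pr v)" using X(2) unfolding V(5) by blast
      then show "y \<in> \<phi> ` ({p \<in> man_space P. pr p \<in> X} \<inter> V)" using V(6,7) by auto
    next
      fix y assume "y \<in> \<phi> ` ({p \<in> man_space P. pr p \<in> X} \<inter> V)"
      then obtain v where "v \<in> V" "pr v \<in> X" "y = \<phi> v" by blast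
      then show "y \<in> \<xi> ` X" using V(6) by (metis image_eqI)
    qed
    ultimately show "open (\<xi> ` X)" by simp
  qed
next
  show "\<Union>(fst ` atlas M) = man_space M"
  proof (intro equalityI subsetI)
    fix x assume "x \<in> \<Union>(fst ` atlas M)"
    then obtain W \<xi> where "(W, \<xi>) \<in> atlas M" "x \<in> W" by auto
    then show "x \<in> man_space M"
      using orbit_atlasE[of W \<xi>] unfolding man_space_orbit by (metis image_mono subsetD)
  next
    fix x assume "x \<in> man_space M"
    then obtain p where p: "p \<in> man_space P" "x = pr p" unfolding man_space_orbit by blast
    obtain U \<phi> where U: "(U, \<phi>) \<in> atlas P" "p \<in> U" using charted_chart_at[OF P' p(1)] .
    \<comment> \<open>Restricting a chart to one sheet of \<open>\<tau>\<close> makes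
      \<open>pr\<close> injective, and sheets are open, so every orbit lies in some chart of the
      quotient.\<close>
    define V where "V = U \<inter> {q \<in> man_space P. \<tau> q = \<tau> p}"
    have "openin (mtop P) V" unfolding V_def using is_chartD(1)[OF charted_is_chart[OF P' U(1)]] \<tau>_open by blast
    moreover have "inj_on pr V" unfolding V_def by (rule inj_onI) (use orbit_map_eq_\<tau>_eq in auto)
    moreover have "V \<subseteq> U" "p \<in> V" unfolding V_def using U p by auto
    ultimately have "(pr ` V, \<phi> \<circ> inv_into V pr) \<in> atlas M" "x \<in> pr ` V"
      unfolding orbit_manifold_def Let_def using U p by auto
    then show "x \<in> \<Union>(fst ` atlas M)" by force
  qed
qed

text \<open>The chart may stem from a set elsewhere on the orbit of \<open>p\<close>. Some
  translation carries \<open>p\<close> into that set, and near \<open>p\<close> the chart after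
  \<open>pr\<close> is this translation followed by a chart of \<open>P\<close>.\<close>

lemma smooth_at_orbit_chart:
  assumes W: "(W, \<xi>) \<in> atlas M" and p: "p \<in> man_space P" "pr p \<in> W"
  shows "smooth_at P (\<lambda>x. \<xi> (pr x)) p"
proof -
  obtain U \<phi> V where V: "(U, \<phi>) \<in> atlas P" "V \<subseteq> U" "openin (mtop P) V" "inj_on pr V"
    "W = pr ` V" "\<And>v. v \<in> V \<Longrightarrow> \<xi> (pr v) = \<phi> v" "V \<subseteq> man_space P"
    by (rule orbit_atlasE[OF W]) (rule that)
  obtain v where v: "v \<in> V" "pr p = pr v" using p(2) V(5) by blast
  obtain g where g: "g \<in> carrier \<Lambda>" "v = \<sigma> (p, g)" using orbit_map_eqD[of p v] p(1) v V(7) by blast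
  have "smooth_at P (\<lambda>x. \<phi> (\<sigma> (x, g))) p"
    using v g V(2) by (intro \<sigma>_smooth_at_chart[OF p(1) g(1) V(1)]) auto
  then show ?thesis
  proof (rule smooth_at_cong[OF P' _ openin_continuous_map_preimage[OF \<sigma>_continuous[OF g(1)] V(3)]])
    show "p \<in> {x \<in> man_space P. \<sigma> (x, g) \<in> V}" using p v g by simp
    show "\<xi> (pr x) = \<phi> (\<sigma> (x, g))" if "x \<in> {x \<in> man_space P. \<sigma> (x, g) \<in> V}" for x
      using that V(6)[of "\<sigma> (x, g)"] orbit_map_act[of x g] g(1) by simp
  qed
qed

text \<open>Smoothness can be tested upstairs at any point of the orbit: the pullback along
  \<open>pr\<close> is invariant, so a translation moves its smoothness to the point from which the
  chart was built.\<close>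

lemma orbit_smooth_atI:
  assumes p: "p \<in> man_space P" and f: "smooth_at P (\<lambda>x. f (pr x)) p"
  shows "smooth_at M f (pr p)"
  unfolding smooth_at_def
proof clarify
  fix W \<xi> assume W: "(W, \<xi>) \<in> atlas M" "pr p \<in> W"
  obtain U \<phi> V where V: "(U, \<phi>) \<in> atlas P" "V \<subseteq> U" "openin (mtop P) V" "inj_on pr V"
    "W = pr ` V" "\<And>v. v \<in> V \<Longrightarrow> \<xi> (pr v) = \<phi> v" "V \<subseteq> man_space P"
    by (rule orbit_atlasE[OF W(1)]) (rule that)
  note cU = charted_is_chart[OF P' V(1)]
  obtain v where v: "v \<in> V" "pr p = pr v" using W(2) V(5) by blast
  have vP: "v \<in> man_space P" using v V(7) by blast
  obtain g where g: "g \<in> carrier \<Lambda>" "p = \<sigma> (v, g)" using orbit_map_eqD[OF vP p v(2)[symmetric]] .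
  have "smooth_at P (\<lambda>x. f (pr (\<sigma> (x, g)))) v"
    using smooth_at_compose_smooth_map[OF P' P \<sigma>_smooth_map[OF g(1)] vP] f g(2) by simp
  then have fv: "smooth_at P (\<lambda>x. f (pr x)) v"
    by (rule smooth_at_cong[OF P' _ openin_topspace vP]) (simp add: orbit_map_act g(1))
  obtain T where T: "open T" "\<phi> v \<in> T" "T \<subseteq> \<phi> ` U" "smooth_on T ((\<lambda>x. f (pr x)) \<circ> inv_into U \<phi>)"
    using smooth_atD[OF fv V(1) subsetD[OF V(2) v(1)]] .
  have oV: "open (\<phi> ` V)" by (rule chart_open_image[OF cU V(3,2)])
  have "smooth_on (T \<inter> \<phi> ` V) (f \<circ> inv_into W \<xi>)"
  proof (rule smooth_on_cong[OF smooth_on_subset[OF T(4)]])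
    show "open (T \<inter> \<phi> ` V)" using T(1) oV by blast
    fix y assume "y \<in> T \<inter> \<phi> ` V"
    then obtain u where u: "u \<in> V" "y = \<phi> u" by blast
    then show "(f \<circ> inv_into W \<xi>) y = ((\<lambda>x. f (pr x)) \<circ> inv_into U \<phi>) y"
      unfolding V(5) using orbit_chart_inj(2)[OF V(1,2,6) u(1)] is_chartD(5)[OF cU] V(2)
      by (simp add: subset_iff)
  qed auto
  moreover have "\<xi> (pr p) \<in> T \<inter> \<phi> ` V" using v V(6) T(2) by simp
  moreover have "T \<inter> \<phi> ` V \<subseteq> \<xi> ` W" unfolding V(5) using V(6) by (auto simp: image_iff)
  ultimately show "\<exists>T. open T \<and> \<xi> (pr p) \<in> T \<and> T \<subseteq> \<xi> ` W \<and> smooth_on T (f \<circ> inv_into W \<xi>)"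
    using T(1) oV by blast
qed

lemma smooth_manifold_orbit: "smooth_manifold M"
proof -
  have "smooth_on (\<xi> ` (W \<inter> W')) (\<xi>' \<circ> inv_into W \<xi>)"
    if W: "(W, \<xi>) \<in> atlas M" and W': "(W', \<xi>') \<in> atlas M" for W \<xi> W' \<xi>'
    unfolding smooth_on_def
  proof (intro allI ballI)
    fix vs y assume "y \<in> \<xi> ` (W \<inter> W')"
    then obtain x where x: "x \<in> W" "x \<in> W'" "y = \<xi> x" by blast
    have "x \<in> man_space M" using x(1) is_chartD(4)[OF charted_is_chart[OF charted_orbit W]] by blast
    then obtain p where p: "p \<in> man_space P" "x = pr p" unfolding man_space_orbit by blast
    have "smooth_at M \<xi>' (pr p)"
      using x p by (intro orbit_smooth_atI smooth_at_orbit_chart[OF W']) auto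
    from smooth_atD[OF this W] x p show "iter_deriv vs (\<xi>' \<circ> inv_into W \<xi>) differentiable (at y)"
      unfolding smooth_on_def by metis
  qed
  then show ?thesis
    unfolding smooth_manifold_def
    using smooth_manifold_finite_dim[OF P] orbit_Hausdorff orbit_second_countable orbit_paracompact
      charted_orbit[unfolded charted_def] by fast
qed

lemma smooth_orbit_map: "smooth_map P M pr"
  unfolding smooth_map_iff[OF P' charted_orbit] o_def
  using continuous_orbit_map smooth_at_orbit_chart by blast

subsection \<open>Triviality\<close>

text \<open>The choice is harmless because \<open>retr\<close> is constant on orbits; this is the
  section of \<open>pr\<close> with image \<open>slice\<close>.\<close>

definition "orbit_section x = retr (SOME p. p \<in> man_space P \<and> pr p = x)"

lemma orbit_section: "p \<in> man_space P \<Longrightarrow> orbit_section (pr p) = retr p"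
  unfolding orbit_section_def
  by (rule retr_cong) (metis (mono_tags, lifting) someI_ex)+

lemma trivialization_smooth: "smooth_map P (prod_discrete M \<Lambda>) (\<lambda>p. (pr p, \<tau> p))"
  unfolding smooth_map_iff[OF P' charted_prod_discrete[OF charted_orbit]]
proof (intro conjI ballI)
  have "continuous_map (mtop P) (discrete_topology (carrier \<Lambda>)) \<tau>"
    unfolding continuous_map_def
  proof (intro conjI allI impI)
    show "\<tau> \<in> man_space P \<rightarrow> topspace (discrete_topology (carrier \<Lambda>))" using \<tau>_closed by auto
    fix X assume "openin (discrete_topology (carrier \<Lambda>)) X"
    have "{x \<in> man_space P. \<tau> x \<in> X} = (\<Union>g\<in>X. {x \<in> man_space P. \<tau> x = g})" by auto
    then show "openin (mtop P) {x \<in> man_space P. \<tau> x \<in> X}" using \<tau>_open by auto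
  qed
  then show "continuous_map (mtop P) (mtop (prod_discrete M \<Lambda>)) (\<lambda>p. (pr p, \<tau> p))"
    unfolding mtop_prod_discrete using continuous_orbit_map by (intro continuous_map_pairedI)
  fix p c assume p: "p \<in> man_space P" and c: "c \<in> atlas (prod_discrete M \<Lambda>)"
  obtain W \<xi> g where W: "c = (W \<times> {g}, \<xi> \<circ> fst)" "(W, \<xi>) \<in> atlas M" using c unfolding prod_discrete_def by auto
  show "case c of (V, \<psi>) \<Rightarrow> (pr p, \<tau> p) \<in> V \<longrightarrow> smooth_at P (\<psi> \<circ> (\<lambda>p. (pr p, \<tau> p))) p"
    unfolding W(1) using smooth_at_orbit_chart[OF W(2) p] by (auto simp: o_def)
qed

text \<open>On a sheet of \<open>\<tau>\<close> the group element used by \<open>retr\<close> is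
  constant, so a translate of the section becomes the action of one fixed element, which is known to
  be smooth.\<close>

lemma act_retr_near:
  assumes p: "p \<in> man_space P" "g \<in> carrier \<Lambda>" and x: "x \<in> man_space P" "\<tau> x = \<tau> p"
  shows "\<sigma> (retr x, g) = \<sigma> (x, inv\<^bsub>\<Lambda>\<^esub> \<tau> p \<otimes>\<^bsub>\<Lambda>\<^esub> g)"
  using assms \<tau>_closed[OF x(1)] unfolding retr_def by (simp add: \<sigma>_mult)

lemma trivialization_inverse_smooth:
  "smooth_map (prod_discrete M \<Lambda>) P (\<lambda>(x, g). \<sigma> (orbit_section x, g))"
  unfolding smooth_map_iff[OF charted_prod_discrete[OF charted_orbit] P']
proof (intro conjI ballI)
  show "continuous_map (mtop (prod_discrete M \<Lambda>)) (mtop P) (\<lambda>(x, g). \<sigma> (orbit_section x, g))"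
    unfolding mtop_prod_discrete
  proof (rule continuous_map_from_prod_discrete)
    fix g assume g: "g \<in> carrier \<Lambda>"
    have "continuous_map (mtop M) (mtop P) (\<lambda>x. \<sigma> (orbit_section x, g))"
      unfolding continuous_map_def
    proof (intro conjI allI impI)
      show "(\<lambda>x. \<sigma> (orbit_section x, g)) \<in> man_space M \<rightarrow> man_space P"
        unfolding man_space_orbit using g by (auto simp: orbit_section \<sigma>_closed retr_slice)
      fix X assume X: "openin (mtop P) X"
      have "openin (mtop P) {p \<in> man_space P. pr p \<in> {x \<in> man_space M. \<sigma> (orbit_section x, g) \<in> X}}"
      proof (subst openin_subopen, intro ballI)
        fix p assume "p \<in> {p \<in> man_space P. pr p \<in> {x \<in> man_space M. \<sigma> (orbit_section x, g) \<in> X}}"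
        then have p: "p \<in> man_space P" "\<sigma> (retr p, g) \<in> X" by (auto simp: orbit_section)
        let ?h = "inv\<^bsub>\<Lambda>\<^esub> \<tau> p \<otimes>\<^bsub>\<Lambda>\<^esub> g"
        have h: "?h \<in> carrier \<Lambda>" using \<tau>_closed[OF p(1)] g by simp
        let ?N = "{x \<in> man_space P. \<sigma> (x, ?h) \<in> X} \<inter> {x \<in> man_space P. \<tau> x = \<tau> p}"
        have "openin (mtop P) ?N"
          using openin_continuous_map_preimage[OF \<sigma>_continuous[OF h] X] \<tau>_open by blast
        moreover have "p \<in> ?N" using p act_retr_near[OF p(1) g p(1)] by simp
        moreover have "?N \<subseteq> {p \<in> man_space P. pr p \<in> {x \<in> man_space M. \<sigma> (orbit_section x, g) \<in> X}}"
          using act_retr_near[OF p(1) g] by (auto simp: orbit_section man_space_orbit)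
        ultimately show "\<exists>T. openin (mtop P) T \<and> p \<in> T \<and>
            T \<subseteq> {p \<in> man_space P. pr p \<in> {x \<in> man_space M. \<sigma> (orbit_section x, g) \<in> X}}" by blast
      qed
      then show "openin (mtop M) {x \<in> man_space M. \<sigma> (orbit_section x, g) \<in> X}"
        unfolding openin_orbit by (auto simp: man_space_orbit)
    qed
    then show "continuous_map (mtop M) (mtop P) (\<lambda>x. case (x, g) of (x, g) \<Rightarrow> \<sigma> (orbit_section x, g))" by simp
  qed
  fix z c assume z: "z \<in> man_space (prod_discrete M \<Lambda>)" and c: "c \<in> atlas P"
  obtain p g where p: "p \<in> man_space P" "g \<in> carrier \<Lambda>" "z = (pr p, g)"
    using z unfolding mtop_prod_discrete by (auto simp: man_space_orbit)
  obtain V \<psi> where V: "c = (V, \<psi>)" by (cases c)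
  have "smooth_at (prod_discrete M \<Lambda>) (\<psi> \<circ> (\<lambda>(x, g). \<sigma> (orbit_section x, g))) z" if "\<sigma> (orbit_section (pr p), g) \<in> V"
    unfolding p(3) smooth_at_prod_discrete[OF charted_orbit p(2)]
  proof (rule orbit_smooth_atI[OF p(1)])
    let ?h = "inv\<^bsub>\<Lambda>\<^esub> \<tau> p \<otimes>\<^bsub>\<Lambda>\<^esub> g"
    have h: "?h \<in> carrier \<Lambda>" using \<tau>_closed[OF p(1)] p(2) by simp
    have "smooth_at P (\<lambda>x. \<psi> (\<sigma> (x, ?h))) p"
      using that c act_retr_near[OF p(1,2) p(1)] unfolding V
      by (intro \<sigma>_smooth_at_chart[OF p(1) h]) (auto simp: orbit_section p(1))
    then show "smooth_at P (\<lambda>x. (\<psi> \<circ> (\<lambda>(x, g). \<sigma> (orbit_section x, g))) (pr x, g)) p"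
      by (rule smooth_at_cong[OF P' _ \<tau>_open[of "\<tau> p"]])
        (use p act_retr_near[OF p(1,2)] in \<open>auto simp: orbit_section\<close>)
  qed
  then show "case c of (V, \<psi>) \<Rightarrow> (case z of (x, g) \<Rightarrow> \<sigma> (orbit_section x, g)) \<in> V \<longrightarrow>
      smooth_at (prod_discrete M \<Lambda>) (\<psi> \<circ> (\<lambda>(x, g). \<sigma> (orbit_section x, g))) z"
    unfolding V p(3) by simp
qed

lemma trivialization:
  "bundle_equivalence \<Lambda> P pr \<sigma> (prod_discrete M \<Lambda>) fst (product_action \<Lambda>) (\<lambda>p. (pr p, \<tau> p))"
  unfolding bundle_equivalence_def diffeomorphism_def
proof (intro conjI ballI exI)
  show "smooth_map P (prod_discrete M \<Lambda>) (\<lambda>p. (pr p, \<tau> p))" by (rule trivialization_smooth)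
  show "smooth_map (prod_discrete M \<Lambda>) P (\<lambda>(x, g). \<sigma> (orbit_section x, g))" by (rule trivialization_inverse_smooth)
  show "(case (pr p, \<tau> p) of (x, g) \<Rightarrow> \<sigma> (orbit_section x, g)) = p" if "p \<in> man_space P" for p
    using that by (simp add: orbit_section retr_slice)
  show "(pr (case y of (x, g) \<Rightarrow> \<sigma> (orbit_section x, g)), \<tau> (case y of (x, g) \<Rightarrow> \<sigma> (orbit_section x, g))) = y"
    if y: "y \<in> man_space (prod_discrete M \<Lambda>)" for y
  proof -
    obtain p g where p: "p \<in> man_space P" "g \<in> carrier \<Lambda>" "y = (pr p, g)"
      using y unfolding mtop_prod_discrete by (auto simp: man_space_orbit)
    have "\<tau> (retr p) = \<one>\<^bsub>\<Lambda>\<^esub>" using retr_slice(1)[OF p(1)] unfolding slice_def by simp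
    then show ?thesis
      using p retr_slice[OF p(1)] by (simp add: orbit_section orbit_map_act \<tau>_act)
  qed
  show "fst (pr p, \<tau> p) = pr p" for p by simp
  show "(pr (\<sigma> (p, g)), \<tau> (\<sigma> (p, g))) = product_action \<Lambda> ((pr p, \<tau> p), g)"
    if "p \<in> man_space P" "g \<in> carrier \<Lambda>" for p g
    using that by (simp add: product_action_def orbit_map_act \<tau>_act)
qed

lemma trivial: "trivial_principal_bundle P M \<Lambda> pr \<sigma>"
proof -
  have "open_submanifold P (pr -` man_space M) = P" "open_submanifold M (man_space M) = M"
    using continuous_orbit_map
    by (auto intro!: open_submanifold_whole[OF P'] open_submanifold_whole[OF charted_orbit] simp: man_space_orbit)
  then have "\<forall>m\<in>man_space M. \<exists>U \<Phi>. openin (mtop M) U \<and> m \<in> U \<and>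
      bundle_equivalence \<Lambda> (open_submanifold P (pr -` U)) pr \<sigma>
        (prod_discrete (open_submanifold M U) \<Lambda>) fst (product_action \<Lambda>) \<Phi>"
    using trivialization by (intro ballI exI[of _ "man_space M"] exI[of _ "\<lambda>p. (pr p, \<tau> p)"]) simp
  then show ?thesis
    unfolding trivial_principal_bundle_def principal_bundle_def
    using P smooth_manifold_orbit \<Lambda> smooth_orbit_map man_space_orbit act trivialization by blast
qed

end

section \<open>The equivariant map determined by a trivial noncommutative bundle\<close>

lemma smooth_algebra_pow:
  "p \<in> man_space P \<Longrightarrow> (a [^]\<^bsub>smooth_algebra P\<^esub> (n::nat)) p = a p ^ n"
  by (induction n) (auto simp: mult.commute)

lemma trivial_nc_bundle_equivariant_action:
  assumes \<Lambda>: "comm_group \<Lambda>" and fin: "finite (carrier \<Lambda>)" and P: "smooth_manifold P"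
    and triv: "trivial_nc_principal_bundle (smooth_algebra P) \<Lambda> \<alpha>"
  shows "\<exists>\<tau>. equivariant_action P \<Lambda> (induced_action P \<alpha>) \<tau>"
proof -
  interpret L: comm_group \<Lambda> by (rule \<Lambda>)
  note P' = smooth_manifold_charted[OF P]
  let ?\<sigma> = "induced_action P \<alpha>"
  obtain S where D: "dynamical_system (smooth_algebra P) \<Lambda> \<alpha>" and S: "adapted_generators \<Lambda> S"
    and ex: "\<forall>s\<in>S. \<exists>a\<in>isotypic_component (smooth_algebra P) \<Lambda> \<alpha> (dual_generator \<Lambda> S s).
      a \<in> Units (smooth_algebra P) \<and> a [^]\<^bsub>smooth_algebra P\<^esub> L.ord s = \<one>\<^bsub>smooth_algebra P\<^esub>"
    using triv unfolding trivial_nc_principal_bundle_def by blast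
  let ?\<theta> = "dual_generator \<Lambda> S"
  obtain a where a: "\<And>s. s \<in> S \<Longrightarrow> a s \<in> isotypic_component (smooth_algebra P) \<Lambda> \<alpha> (?\<theta> s)"
    "\<And>s. s \<in> S \<Longrightarrow> a s [^]\<^bsub>smooth_algebra P\<^esub> L.ord s = \<one>\<^bsub>smooth_algebra P\<^esub>"
    using ex by metis
  have SG: "S \<subseteq> carrier \<Lambda>" and finS: "finite S" using S by (auto simp: adapted_generators_def)
  have aS: "a s \<in> smooth_functions P" if "s \<in> S" for s
    using a(1)[OF that] by (simp add: isotypic_component_def)
  note act = induced_action_works[OF P D]
  have root: "a s p ^ L.ord s = 1" if "s \<in> S" "p \<in> man_space P" for s p
    using a(2)[OF that(1)] smooth_algebra_pow[OF that(2), of "a s" "L.ord s"] that(2) by simp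
  have eq: "a s (?\<sigma> (p, g)) = ?\<theta> s g * a s p" if "s \<in> S" "p \<in> man_space P" "g \<in> carrier \<Lambda>" for s p g
    using a(1)[OF that(1)] act(2)[OF that(2,3) aS[OF that(1)]] that(2,3) by (simp add: isotypic_component_def)
  note \<theta> = L.dual_generator(1)[OF fin S]
  have unique: "g = h" if gh: "g \<in> carrier \<Lambda>" "h \<in> carrier \<Lambda>" "\<And>s. s \<in> S \<Longrightarrow> ?\<theta> s g = ?\<theta> s h" for g h
  proof -
    have "?\<theta> s (g \<otimes>\<^bsub>\<Lambda>\<^esub> inv\<^bsub>\<Lambda>\<^esub> h) = 1" if s: "s \<in> S" for s
    proof -
      have "cmod (?\<theta> s h) = 1" using charactersD(2)[OF L.is_group \<theta>[OF s]] \<open>h \<in> carrier \<Lambda>\<close> by blast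
      then have "?\<theta> s h \<noteq> 0" by auto
      then show ?thesis
        using charactersD(1)[OF L.is_group \<theta>[OF s], of g "inv\<^bsub>\<Lambda>\<^esub> h"]
          charactersD(4)[OF L.is_group \<theta>[OF s], of h] gh(3)[OF s] \<open>g \<in> carrier \<Lambda>\<close> \<open>h \<in> carrier \<Lambda>\<close> by simp
    qed
    then have "g \<otimes>\<^bsub>\<Lambda>\<^esub> inv\<^bsub>\<Lambda>\<^esub> h = \<one>\<^bsub>\<Lambda>\<^esub>" using gh(1,2) by (intro L.dual_generators_separate[OF fin S]) auto
    then show ?thesis using gh(1,2) by (metis L.inv_closed L.inv_equality L.inv_inv)
  qed
  have "\<exists>g\<in>carrier \<Lambda>. \<forall>s\<in>S. ?\<theta> s g = a s p" if "p \<in> man_space P" for p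
    using root[OF _ that] by (intro L.dual_generators_surj[OF fin S]) auto
  then obtain \<tau> where \<tau>: "\<And>p. p \<in> man_space P \<Longrightarrow> \<tau> p \<in> carrier \<Lambda>"
    "\<And>p s. p \<in> man_space P \<Longrightarrow> s \<in> S \<Longrightarrow> ?\<theta> s (\<tau> p) = a s p" by metis
  have "equivariant_action P \<Lambda> ?\<sigma> \<tau>"
  proof
    show "smooth_manifold P" by (rule P)
    show "smooth_right_action P \<Lambda> ?\<sigma>" by (rule smooth_right_action_induced[OF P D])
    show "\<tau> p \<in> carrier \<Lambda>" if "p \<in> man_space P" for p using \<tau>(1)[OF that] .
    \<comment> \<open>Both sides have the same dual coordinates: \<open>a s\<close> lies in the
      isotypic component of \<open>?\<theta> s\<close>, so the action multiplies it by
      \<open>?\<theta> s g\<close>.\<close>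
    show "\<tau> (?\<sigma> (p, g)) = \<tau> p \<otimes>\<^bsub>\<Lambda>\<^esub> g" if p: "p \<in> man_space P" and g: "g \<in> carrier \<Lambda>" for p g
    proof (rule unique)
      show "\<tau> (?\<sigma> (p, g)) \<in> carrier \<Lambda>" "\<tau> p \<otimes>\<^bsub>\<Lambda>\<^esub> g \<in> carrier \<Lambda>" using \<tau>(1) act(1) p g by auto
      show "?\<theta> s (\<tau> (?\<sigma> (p, g))) = ?\<theta> s (\<tau> p \<otimes>\<^bsub>\<Lambda>\<^esub> g)" if s: "s \<in> S" for s
        using \<tau> act(1) p g s eq[OF s p g] charactersD(1)[OF L.is_group \<theta>[OF s], of "\<tau> p" g] by simp
    qed
    fix g
    show "openin (mtop P) {p \<in> man_space P. \<tau> p = g}"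
    proof (cases "g \<in> carrier \<Lambda>")
      case True
      have o: "openin (mtop P) {p \<in> man_space P. a s p = ?\<theta> s g}" if s: "s \<in> S" for s
      proof -
        let ?R = "{z::complex. z ^ L.ord s = 1}"
        have "L.ord s \<ge> 1" using L.ord_ge_1[OF fin] s SG by blast
        then have "finite ?R" by (intro finite_roots_unity) auto
        \<comment> \<open>The values of \<open>a s\<close> lie in a finite set, so removing the
          other roots leaves an open set that isolates the value \<open>?\<theta> s g\<close>. This
          is why \<open>\<tau>\<close> is locally constant.\<close>
        then have "open (- (?R - {?\<theta> s g}))" by (intro open_Compl finite_imp_closed) simp
        moreover have "continuous_map (mtop P) euclidean (a s)"
          by (rule smooth_at_imp_continuous_map[OF P' smooth_functions_smooth_at[OF P' aS[OF s]]])
        ultimately have "openin (mtop P) {p \<in> man_space P. a s p \<in> - (?R - {?\<theta> s g})}"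
          by (intro openin_continuous_map_preimage) auto
        moreover have "{p \<in> man_space P. a s p \<in> - (?R - {?\<theta> s g})} = {p \<in> man_space P. a s p = ?\<theta> s g}"
          using root[OF s] by auto
        ultimately show ?thesis by simp
      qed
      \<comment> \<open>Intersecting with the space covers the trivial group, where \<open>S\<close>
        is empty and the intersection over \<open>S\<close> is the whole type.\<close>
      have "{p \<in> man_space P. \<tau> p = g} = (\<Inter>s\<in>S. {p \<in> man_space P. a s p = ?\<theta> s g}) \<inter> man_space P"
        using \<tau> unique[OF _ True] by auto
      then show ?thesis
        using o finS by (cases "S = {}") (auto intro!: openin_Int openin_INT2)
    next
      case False
      then have "{p \<in> man_space P. \<tau> p = g} = {}" using \<tau>(1) by blast
      then show ?thesis by (simp only: openin_empty)
    qed
  qed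
  then show ?thesis by blast
qed

lemma trivial_nc_bundle_imp_trivial_bundle:
  assumes "comm_group \<Lambda>" and "finite (carrier \<Lambda>)" and P: "smooth_manifold P"
    and triv: "trivial_nc_principal_bundle (smooth_algebra P) \<Lambda> \<alpha>"
  shows "smooth_right_action P \<Lambda> (induced_action P \<alpha>)" "free_action P \<Lambda> (induced_action P \<alpha>)"
    "proper_action P \<Lambda> (induced_action P \<alpha>)"
    "trivial_principal_bundle P (orbit_manifold P \<Lambda> (induced_action P \<alpha>)) \<Lambda>
      (orbit_map \<Lambda> (induced_action P \<alpha>)) (induced_action P \<alpha>)"
proof -
  obtain \<tau> where "equivariant_action P \<Lambda> (induced_action P \<alpha>) \<tau>"
    using trivial_nc_bundle_equivariant_action[OF assms] by blast
  then interpret equivariant_action P \<Lambda> "induced_action P \<alpha>" \<tau> .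
  show "smooth_right_action P \<Lambda> (induced_action P \<alpha>)" by (rule act)
  show "proper_action P \<Lambda> (induced_action P \<alpha>)" by (rule proper_action_finite[OF assms(2)])
  show "free_action P \<Lambda> (induced_action P \<alpha>)" by (rule free)
  show "trivial_principal_bundle P (orbit_manifold P \<Lambda> (induced_action P \<alpha>)) \<Lambda>
      (orbit_map \<Lambda> (induced_action P \<alpha>)) (induced_action P \<alpha>)" by (rule trivial)
qed

section \<open>The locally convex topology on smooth functions\<close>

subsection \<open>Linearity and the Leibniz rule for iterated derivatives\<close>

lemma iter_deriv_add:
  assumes "open S" "smooth_on S f" "smooth_on S g" "x \<in> S"
  shows "iter_deriv vs (\<lambda>x. f x + g x) x = iter_deriv vs f x + iter_deriv vs g x"
  using assms(4)
proof (induction vs arbitrary: x)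
  case Nil
  then show ?case by simp
next
  case (Cons v vs)
  have "((\<lambda>x. iter_deriv vs f x + iter_deriv vs g x) has_derivative
      (\<lambda>v. frechet_derivative (iter_deriv vs f) (at x) v + frechet_derivative (iter_deriv vs g) (at x) v)) (at x)"
    using assms Cons.prems
    by (intro has_derivative_add smooth_on_imp_has_derivative[OF smooth_on_iter_deriv]) auto
  then have "frechet_derivative (\<lambda>x. iter_deriv vs f x + iter_deriv vs g x) (at x) =
      (\<lambda>v. frechet_derivative (iter_deriv vs f) (at x) v + frechet_derivative (iter_deriv vs g) (at x) v)"
    by (rule frechet_derivative_at[symmetric])
  then show ?case
    using frechet_derivative_cong_open[OF assms(1) Cons.prems Cons.IH] by simp
qed

lemma iter_deriv_linear_comp:
  assumes L: "bounded_linear L" and S: "open S" "smooth_on S f" "x \<in> S"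
  shows "iter_deriv vs (\<lambda>x. L (f x)) x = L (iter_deriv vs f x)"
  using S(3)
proof (induction vs arbitrary: x)
  case Nil
  then show ?case by simp
next
  case (Cons v vs)
  have "((\<lambda>x. L (iter_deriv vs f x)) has_derivative
      (\<lambda>v. L (frechet_derivative (iter_deriv vs f) (at x) v))) (at x)"
    using S Cons.prems
    by (intro bounded_linear.has_derivative[OF L] smooth_on_imp_has_derivative[OF smooth_on_iter_deriv]) auto
  then have "frechet_derivative (\<lambda>x. L (iter_deriv vs f x)) (at x) =
      (\<lambda>v. L (frechet_derivative (iter_deriv vs f) (at x) v))"
    by (rule frechet_derivative_at[symmetric])
  then show ?case
    using frechet_derivative_cong_open[OF S(1) Cons.prems Cons.IH] by simp
qed

text \<open>All ways of distributing the directions over two factors in the Leibniz rule. Lists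
  instead of sets keep multiplicities when directions repeat.\<close>

primrec splits :: "'v list \<Rightarrow> ('v list \<times> 'v list) list" where
  "splits [] = [([], [])]"
| "splits (v # vs) = map (\<lambda>(as, bs). (v # as, bs)) (splits vs) @ map (\<lambda>(as, bs). (as, v # bs)) (splits vs)"

lemma has_derivative_sum_list:
  assumes "\<And>i. i \<in> set xs \<Longrightarrow> (f i has_derivative f' i) F"
  shows "((\<lambda>x. \<Sum>i\<leftarrow>xs. f i x) has_derivative (\<lambda>v. \<Sum>i\<leftarrow>xs. f' i v)) F"
  using assms by (induction xs) (auto intro: has_derivative_add)

lemma norm_sum_list_le: "norm (\<Sum>i\<leftarrow>xs. f i) \<le> (\<Sum>i\<leftarrow>xs. norm (f i :: 'f::real_normed_vector))"
  by (induction xs) (auto intro: norm_triangle_le)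

lemma iter_deriv_mult:
  fixes f g :: "'e::real_normed_vector \<Rightarrow> 'f::real_normed_algebra"
  assumes "open S" "smooth_on S f" "smooth_on S g" "x \<in> S"
  shows "iter_deriv vs (\<lambda>x. f x * g x) x = (\<Sum>(as, bs)\<leftarrow>splits vs. iter_deriv as f x * iter_deriv bs g x)"
  using assms(4)
proof (induction vs arbitrary: x)
  case Nil
  then show ?case by simp
next
  case (Cons v vs)
  let ?D = "\<lambda>h us. frechet_derivative (iter_deriv us h) (at x)"
  have "((\<lambda>x. \<Sum>c\<leftarrow>splits vs. iter_deriv (fst c) f x * iter_deriv (snd c) g x) has_derivative
      (\<lambda>v. \<Sum>c\<leftarrow>splits vs. iter_deriv (fst c) f x * ?D g (snd c) v + ?D f (fst c) v * iter_deriv (snd c) g x)) (at x)"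
    using assms Cons.prems
    by (intro has_derivative_sum_list has_derivative_mult smooth_on_imp_has_derivative[OF smooth_on_iter_deriv]) auto
  then have "frechet_derivative (\<lambda>x. \<Sum>c\<leftarrow>splits vs. iter_deriv (fst c) f x * iter_deriv (snd c) g x) (at x) =
      (\<lambda>v. \<Sum>c\<leftarrow>splits vs. iter_deriv (fst c) f x * ?D g (snd c) v + ?D f (fst c) v * iter_deriv (snd c) g x)"
    by (rule frechet_derivative_at[symmetric])
  then have "iter_deriv (v # vs) (\<lambda>x. f x * g x) x =
      (\<Sum>c\<leftarrow>splits vs. iter_deriv (fst c) f x * ?D g (snd c) v + ?D f (fst c) v * iter_deriv (snd c) g x)"
    using frechet_derivative_cong_open[OF assms(1) Cons.prems Cons.IH] by (simp add: case_prod_beta)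
  also have "\<dots> = (\<Sum>(as, bs)\<leftarrow>splits (v # vs). iter_deriv as f x * iter_deriv bs g x)"
    by (simp add: case_prod_beta o_def sum_list_addf add.commute)
  finally show ?case .
qed

subsection \<open>Seminorms\<close>

definition chart_seminorm ::
  "'a set \<Rightarrow> ('a \<Rightarrow> 'e::real_inner) \<Rightarrow> 'e set \<Rightarrow> 'e list \<Rightarrow> ('a \<Rightarrow> complex) \<Rightarrow> real" where
  "chart_seminorm U \<phi> K vs f = (SUP y\<in>K. cmod (iter_deriv vs (f \<circ> inv_into U \<phi>) y))"

lemma smooth_seminorms_eq:
  "smooth_seminorms P = {chart_seminorm U \<phi> K vs | U \<phi> K vs.
     (U, \<phi>) \<in> atlas P \<and> compact K \<and> K \<noteq> {} \<and> K \<subseteq> \<phi> ` U}"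
  unfolding smooth_seminorms_def chart_seminorm_def[abs_def] by blast

lemma smooth_functions_smooth_on:
  "f \<in> smooth_functions P \<Longrightarrow> (U, \<phi>) \<in> atlas P \<Longrightarrow> smooth_on (\<phi> ` U) (f \<circ> inv_into U \<phi>)"
  unfolding smooth_functions_def by fast

text \<open>Compactness bounds the supremum in \<open>chart_seminorm\<close> for smooth functions,
  and nonemptiness makes it a least upper bound; \<open>sn_upper\<close> and \<open>sn_least\<close>
  are these two facts.\<close>

locale seminorm_data =
  fixes P :: "('a, 'e::real_inner) manifold" and U \<phi> K
  assumes P': "charted P" and U: "(U, \<phi>) \<in> atlas P" and K: "compact K" "K \<noteq> {}" "K \<subseteq> \<phi> ` U"
begin

abbreviation "sn \<equiv> chart_seminorm U \<phi> K"

lemma chart_open: "open (\<phi> ` U)"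
  using is_chartD(2)[OF charted_is_chart[OF P' U]] .

lemma inv_chart: "y \<in> \<phi> ` U \<Longrightarrow> inv_into U \<phi> y \<in> man_space P"
  using is_chartD(4)[OF charted_is_chart[OF P' U]] by (metis inv_into_into subsetD)

lemma sn_upper:
  assumes f: "f \<in> smooth_functions P" and y: "y \<in> K"
  shows "cmod (iter_deriv vs (f \<circ> inv_into U \<phi>) y) \<le> sn vs f"
proof -
  have "continuous_on K (iter_deriv vs (f \<circ> inv_into U \<phi>))"
    using smooth_on_imp_continuous_on[OF smooth_on_iter_deriv[OF smooth_functions_smooth_on[OF f U]]] K(3)
    by (rule continuous_on_subset)
  then have "compact ((\<lambda>y. cmod (iter_deriv vs (f \<circ> inv_into U \<phi>) y)) ` K)"
    by (intro compact_continuous_image continuous_on_norm K(1))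
  then have "bdd_above ((\<lambda>y. cmod (iter_deriv vs (f \<circ> inv_into U \<phi>) y)) ` K)"
    by (intro bounded_imp_bdd_above compact_imp_bounded)
  then show ?thesis
    unfolding chart_seminorm_def using y by (rule cSUP_upper2) auto
qed

lemma sn_least: "(\<And>y. y \<in> K \<Longrightarrow> cmod (iter_deriv vs (f \<circ> inv_into U \<phi>) y) \<le> c) \<Longrightarrow> sn vs f \<le> c"
  unfolding chart_seminorm_def using K(2) by (rule cSUP_least)

lemma sn_nonneg: "f \<in> smooth_functions P \<Longrightarrow> 0 \<le> sn vs f"
  using K(2) sn_upper norm_ge_zero order_trans by (metis ex_in_conv)

lemma iter_deriv_chart_cong:
  assumes "\<And>p. p \<in> man_space P \<Longrightarrow> f p = F p" "y \<in> K"
  shows "iter_deriv vs (f \<circ> inv_into U \<phi>) y = iter_deriv vs (\<lambda>y. F (inv_into U \<phi> y)) y"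
  using assms K(3) inv_chart by (intro iter_deriv_cong_open[OF chart_open]) auto

lemma sn_add:
  assumes "f \<in> smooth_functions P" "g \<in> smooth_functions P"
  shows "sn vs (\<lambda>p\<in>man_space P. f p + g p) \<le> sn vs f + sn vs g"
proof (rule sn_least)
  fix y assume y: "y \<in> K"
  have "iter_deriv vs ((\<lambda>p\<in>man_space P. f p + g p) \<circ> inv_into U \<phi>) y =
      iter_deriv vs (\<lambda>y. (f \<circ> inv_into U \<phi>) y + (g \<circ> inv_into U \<phi>) y) y"
    using iter_deriv_chart_cong[OF _ y, of _ "\<lambda>p. f p + g p"] by simp
  also have "\<dots> = iter_deriv vs (f \<circ> inv_into U \<phi>) y + iter_deriv vs (g \<circ> inv_into U \<phi>) y"
    using y K(3) by (intro iter_deriv_add[OF chart_open] smooth_functions_smooth_on[OF _ U] assms) auto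
  finally show "cmod (iter_deriv vs ((\<lambda>p\<in>man_space P. f p + g p) \<circ> inv_into U \<phi>) y) \<le> sn vs f + sn vs g"
    using norm_triangle_mono[OF sn_upper[OF assms(1) y, of vs] sn_upper[OF assms(2) y, of vs]] by simp
qed

lemma sn_scale:
  assumes f: "f \<in> smooth_functions P"
  shows "sn vs (\<lambda>p\<in>man_space P. c * f p) = cmod c * sn vs f"
proof -
  have eq: "cmod (iter_deriv vs ((\<lambda>p\<in>man_space P. c * f p) \<circ> inv_into U \<phi>) y) =
      cmod c * cmod (iter_deriv vs (f \<circ> inv_into U \<phi>) y)" if y: "y \<in> K" for y
  proof -
    have "iter_deriv vs ((\<lambda>p\<in>man_space P. c * f p) \<circ> inv_into U \<phi>) y =
        iter_deriv vs (\<lambda>y. c * (f \<circ> inv_into U \<phi>) y) y"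
      using iter_deriv_chart_cong[OF _ y, of _ "\<lambda>p. c * f p"] by simp
    also have "\<dots> = c * iter_deriv vs (f \<circ> inv_into U \<phi>) y"
      using y K(3)
      by (intro iter_deriv_linear_comp[OF bounded_linear_mult_right chart_open smooth_functions_smooth_on[OF f U]]) auto
    finally show ?thesis by (simp add: norm_mult)
  qed
  have le: "sn vs (\<lambda>p\<in>man_space P. c * f p) \<le> cmod c * sn vs f"
    by (rule sn_least) (simp only: eq sn_upper[OF f] mult_left_mono norm_ge_zero)
  have cf: "(\<lambda>p\<in>man_space P. c * f p) \<in> smooth_functions P" by (rule smooth_functions_scale[OF P' f])
  show ?thesis
  proof (cases "c = 0")
    case True
    then show ?thesis using le sn_nonneg[OF cf, of vs] by simp
  next
    case False
    have "sn vs f \<le> sn vs (\<lambda>p\<in>man_space P. c * f p) / cmod c"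
    proof (rule sn_least)
      fix y assume y: "y \<in> K"
      show "cmod (iter_deriv vs (f \<circ> inv_into U \<phi>) y) \<le> sn vs (\<lambda>p\<in>man_space P. c * f p) / cmod c"
        using sn_upper[OF cf y, of vs] False unfolding eq[OF y] by (simp add: field_simps)
    qed
    then show ?thesis using le False by (simp add: field_simps)
  qed
qed

lemma sn_zero: "sn vs (\<lambda>p\<in>man_space P. 0) = 0"
proof -
  have "(\<lambda>p\<in>man_space P. 0 * (\<lambda>p\<in>man_space P. 0) p) = (\<lambda>p\<in>man_space P. 0::complex)" by simp
  then show ?thesis using sn_scale[OF smooth_functions_const[OF P', of 0], of vs 0] by simp
qed

text \<open>A single seminorm need not be submultiplicative, but by the Leibniz rule finitely many
  products of seminorms on the same \<open>K\<close> bound the product. That is enough for joint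
  continuity.\<close>

lemma sn_mult:
  assumes "f \<in> smooth_functions P" "g \<in> smooth_functions P"
  shows "sn vs (\<lambda>p\<in>man_space P. f p * g p) \<le> (\<Sum>(as, bs)\<leftarrow>splits vs. sn as f * sn bs g)"
proof (rule sn_least)
  fix y assume y: "y \<in> K"
  let ?f = "f \<circ> inv_into U \<phi>" and ?g = "g \<circ> inv_into U \<phi>"
  have "iter_deriv vs ((\<lambda>p\<in>man_space P. f p * g p) \<circ> inv_into U \<phi>) y = iter_deriv vs (\<lambda>y. ?f y * ?g y) y"
    using iter_deriv_chart_cong[OF _ y, of _ "\<lambda>p. f p * g p"] by simp
  also have "\<dots> = (\<Sum>(as, bs)\<leftarrow>splits vs. iter_deriv as ?f y * iter_deriv bs ?g y)"
    using y K(3) by (intro iter_deriv_mult[OF chart_open] smooth_functions_smooth_on[OF _ U] assms) auto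
  also have "cmod \<dots> \<le> (\<Sum>(as, bs)\<leftarrow>splits vs. cmod (iter_deriv as ?f y * iter_deriv bs ?g y))"
    using norm_sum_list_le[of "\<lambda>(as, bs). iter_deriv as ?f y * iter_deriv bs ?g y" "splits vs"]
    by (simp add: case_prod_unfold)
  also have "\<dots> \<le> (\<Sum>(as, bs)\<leftarrow>splits vs. sn as f * sn bs g)"
    using sn_upper[OF assms(1) y] sn_upper[OF assms(2) y] sn_nonneg[OF assms(1)]
    by (intro sum_list_mono) (auto simp: norm_mult intro!: mult_mono)
  finally show "cmod (iter_deriv vs ((\<lambda>p\<in>man_space P. f p * g p) \<circ> inv_into U \<phi>) y) \<le>
      (\<Sum>(as, bs)\<leftarrow>splits vs. sn as f * sn bs g)" .
qed

end

lemma smooth_seminormsE: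
  assumes "charted P" "q \<in> smooth_seminorms P"
  obtains U \<phi> K vs where "seminorm_data P U \<phi> K" "q = chart_seminorm U \<phi> K vs"
  using assms unfolding smooth_seminorms_eq seminorm_data_def by blast

lemma smooth_seminormsI: "seminorm_data P U \<phi> K \<Longrightarrow> chart_seminorm U \<phi> K vs \<in> smooth_seminorms P"
  unfolding smooth_seminorms_eq seminorm_data_def by blast

lemma smooth_seminorms_seminorm:
  assumes P: "charted P" and q: "q \<in> smooth_seminorms P"
  shows "f \<in> smooth_functions P \<Longrightarrow> 0 \<le> q f"
    "f \<in> smooth_functions P \<Longrightarrow> g \<in> smooth_functions P \<Longrightarrow> q (\<lambda>p\<in>man_space P. f p + g p) \<le> q f + q g"
    "f \<in> smooth_functions P \<Longrightarrow> q (\<lambda>p\<in>man_space P. c * f p) = cmod c * q f"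
    "q (\<lambda>p\<in>man_space P. 0) = 0"
proof -
  obtain U \<phi> K vs where d: "seminorm_data P U \<phi> K" and [simp]: "q = chart_seminorm U \<phi> K vs"
    using smooth_seminormsE[OF P q] .
  interpret seminorm_data P U \<phi> K by (rule d)
  show "f \<in> smooth_functions P \<Longrightarrow> 0 \<le> q f"
    "f \<in> smooth_functions P \<Longrightarrow> g \<in> smooth_functions P \<Longrightarrow> q (\<lambda>p\<in>man_space P. f p + g p) \<le> q f + q g"
    "f \<in> smooth_functions P \<Longrightarrow> q (\<lambda>p\<in>man_space P. c * f p) = cmod c * q f"
    "q (\<lambda>p\<in>man_space P. 0) = 0"
    using sn_nonneg sn_add sn_scale sn_zero by simp_all
qed

abbreviation fun_diff :: "('a, 'e::real_inner) manifold \<Rightarrow> ('a \<Rightarrow> complex) \<Rightarrow> ('a \<Rightarrow> complex) \<Rightarrow> 'a \<Rightarrow> complex" where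
  "fun_diff P f g \<equiv> \<lambda>p\<in>man_space P. f p - g p"

lemma smooth_seminorms_diff_triangle:
  assumes P: "charted P" and q: "q \<in> smooth_seminorms P"
    and f: "f \<in> smooth_functions P" "g \<in> smooth_functions P" "h \<in> smooth_functions P"
  shows "q (fun_diff P f h) \<le> q (fun_diff P f g) + q (fun_diff P g h)"
    and "q (fun_diff P f g) = q (fun_diff P g f)"
proof -
  have "fun_diff P f h = (\<lambda>p\<in>man_space P. fun_diff P f g p + fun_diff P g h p)" by auto
  then show "q (fun_diff P f h) \<le> q (fun_diff P f g) + q (fun_diff P g h)"
    using smooth_seminorms_seminorm(2)[OF P q smooth_functions_diff[OF P f(1,2)] smooth_functions_diff[OF P f(2,3)]] by simp
  have "fun_diff P f g = (\<lambda>p\<in>man_space P. (- 1) * fun_diff P g f p)" by auto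
  then show "q (fun_diff P f g) = q (fun_diff P g f)"
    using smooth_seminorms_seminorm(3)[OF P q smooth_functions_diff[OF P f(2,1)], of "-1"] by simp
qed

subsection \<open>Continuity with respect to the seminorm topology\<close>

lemma topspace_smooth_algebra: "topspace (alg_top (smooth_algebra P)) = smooth_functions P"
  unfolding smooth_algebra_simps seminorm_topology_def by auto

lemma open_seminorm_ball:
  assumes P: "charted P" and q: "q \<in> smooth_seminorms P" and g: "g \<in> smooth_functions P" and e: "e > 0"
  shows "openin (alg_top (smooth_algebra P)) {f \<in> smooth_functions P. q (fun_diff P f g) < e}"
proof -
  let ?R = "smooth_function_ring P"
  have "{f \<in> smooth_functions P. q (fun_diff P f g) < e} = {f \<in> carrier ?R. q (f \<ominus>\<^bsub>?R\<^esub> g) < e}"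
    using g by (auto simp: smooth_function_ring_minus[OF P])
  moreover have "openin (alg_top (smooth_algebra P)) {f \<in> carrier ?R. q (f \<ominus>\<^bsub>?R\<^esub> g) < e}"
    unfolding smooth_algebra_simps seminorm_topology_def
    using q g e by (intro topology_generated_by_Basis insertI2 CollectI exI[of _ q] exI[of _ g] exI[of _ e]) auto
  ultimately show ?thesis by simp
qed

lemma continuous_map_real_localI:
  assumes "\<And>x e. x \<in> topspace X \<Longrightarrow> 0 < e \<Longrightarrow> \<exists>W. openin X W \<and> x \<in> W \<and> (\<forall>y\<in>W. \<bar>f y - f x\<bar> < (e::real))"
  shows "continuous_map X euclideanreal f"
  unfolding continuous_map_def
proof (intro conjI allI impI)
  fix T :: "real set" assume "openin euclideanreal T"
  then have T: "open T" by simp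
  show "openin X {x \<in> topspace X. f x \<in> T}"
  proof (subst openin_subopen, intro ballI)
    fix x assume "x \<in> {x \<in> topspace X. f x \<in> T}"
    then obtain e where e: "e > 0" "ball (f x) e \<subseteq> T" and x: "x \<in> topspace X" using T open_contains_ball by blast
    obtain W where W: "openin X W" "x \<in> W" "\<forall>y\<in>W. \<bar>f y - f x\<bar> < e" using assms[OF x e(1)] by blast
    then have "W \<subseteq> {x \<in> topspace X. f x \<in> T}"
      using e(2) openin_subset[OF W(1)] by (force simp: dist_real_def subset_iff abs_minus_commute)
    then show "\<exists>W. openin X W \<and> x \<in> W \<and> W \<subseteq> {x \<in> topspace X. f x \<in> T}" using W by blast
  qed
qed auto

lemma continuous_map_seminorm_diff:
  assumes P: "charted P" and q: "q \<in> smooth_seminorms P" and g: "g \<in> smooth_functions P"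
  shows "continuous_map (alg_top (smooth_algebra P)) euclideanreal (\<lambda>f. q (fun_diff P f g))"
proof (rule continuous_map_real_localI, unfold topspace_smooth_algebra)
  fix f and e :: real assume f: "f \<in> smooth_functions P" and e: "0 < e"
  let ?W = "{h \<in> smooth_functions P. q (fun_diff P h f) < e}"
  have "\<bar>q (fun_diff P h g) - q (fun_diff P f g)\<bar> < e" if "h \<in> ?W" for h
  proof -
    have h: "h \<in> smooth_functions P" "q (fun_diff P h f) < e" using that by auto
    show ?thesis
      unfolding abs_less_iff
      using h(2) smooth_seminorms_diff_triangle(1)[OF P q h(1) f g] smooth_seminorms_diff_triangle[OF P q f h(1) g]
      by linarith
  qed
  moreover have "f \<in> ?W" using f e smooth_seminorms_seminorm(4)[OF P q] by simp
  ultimately show "\<exists>W. openin (alg_top (smooth_algebra P)) W \<and> f \<in> W \<and>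
      (\<forall>y\<in>W. \<bar>q (fun_diff P y g) - q (fun_diff P f g)\<bar> < e)"
    using open_seminorm_ball[OF P q f e] by blast
qed

text \<open>Only subbasic balls have to be tested, and the triangle inequality recentres such a ball
  at \<open>F x0\<close>. What remains is a continuous majorant that vanishes at
  \<open>x0\<close>.\<close>

lemma continuous_map_into_smooth_algebra:
  assumes P: "charted P" and F: "\<And>x. x \<in> topspace X \<Longrightarrow> F x \<in> smooth_functions P"
    and bound: "\<And>q x0. q \<in> smooth_seminorms P \<Longrightarrow> x0 \<in> topspace X \<Longrightarrow>
      \<exists>h. continuous_map X euclideanreal h \<and> h x0 = 0 \<and> (\<forall>x\<in>topspace X. q (fun_diff P (F x) (F x0)) \<le> h x)"
  shows "continuous_map X (alg_top (smooth_algebra P)) F"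
  unfolding smooth_algebra_simps seminorm_topology_def
proof (rule continuous_on_generated_topo)
  let ?R = "smooth_function_ring P"
  fix B assume B: "B \<in> insert (carrier ?R)
      {{y \<in> carrier ?R. q (y \<ominus>\<^bsub>?R\<^esub> x) < e} | q x e. q \<in> smooth_seminorms P \<and> x \<in> carrier ?R \<and> 0 < e}"
  show "openin X (F -` B \<inter> topspace X)"
  proof (cases "B = carrier ?R")
    case True
    then have "F -` B \<inter> topspace X = topspace X" using F by auto
    then show ?thesis by simp
  next
    case False
    then obtain q z e where q: "q \<in> smooth_seminorms P" and z: "z \<in> smooth_functions P"
      and "B = {y \<in> smooth_functions P. q (y \<ominus>\<^bsub>?R\<^esub> z) < e}"
      using B unfolding smooth_function_ring_simps(1) by blast
    then have B_eq: "B = {y \<in> smooth_functions P. q (fun_diff P y z) < e}"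
      by (auto simp: smooth_function_ring_minus[OF P _ z])
    show ?thesis
    proof (subst openin_subopen, intro ballI)
      fix x0 assume "x0 \<in> F -` B \<inter> topspace X"
      then have x0: "x0 \<in> topspace X" "q (fun_diff P (F x0) z) < e" unfolding B_eq by auto
      obtain h where h: "continuous_map X euclideanreal h" "h x0 = 0"
        "\<And>x. x \<in> topspace X \<Longrightarrow> q (fun_diff P (F x) (F x0)) \<le> h x" using bound[OF q x0(1)] by blast
      let ?W = "{x \<in> topspace X. h x \<in> {..< e - q (fun_diff P (F x0) z)}}"
      have "openin X ?W" by (rule openin_continuous_map_preimage[OF h(1)]) auto
      moreover have "x0 \<in> ?W" using x0 h(2) by simp
      moreover have "?W \<subseteq> F -` B \<inter> topspace X"
      proof
        fix x assume "x \<in> ?W"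
        then have x: "x \<in> topspace X" "h x < e - q (fun_diff P (F x0) z)" by auto
        then show "x \<in> F -` B \<inter> topspace X"
          using F[OF x(1)] h(3)[OF x(1)] smooth_seminorms_diff_triangle(1)[OF P q F[OF x(1)] F[OF x0(1)] z]
          unfolding B_eq by auto
      qed
      ultimately show "\<exists>T. openin X T \<and> x0 \<in> T \<and> T \<subseteq> F -` B \<inter> topspace X" by blast
    qed
  qed
qed (use F in auto)

lemma continuous_map_sum_list:
  fixes f :: "'i \<Rightarrow> 'a \<Rightarrow> real"
  assumes "\<And>i. i \<in> set xs \<Longrightarrow> continuous_map X euclideanreal (f i)"
  shows "continuous_map X euclideanreal (\<lambda>x. \<Sum>i\<leftarrow>xs. f i x)"
  using assms by (induction xs) (auto intro: continuous_map_add)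

lemma continuous_map_smooth_algebra_mult:
  fixes P :: "('a, 'e::real_inner) manifold"
  assumes P: "charted P"
  defines "T \<equiv> alg_top (smooth_algebra P)"
  shows "continuous_map (prod_topology T T) T (\<lambda>(f, g). f \<otimes>\<^bsub>smooth_algebra P\<^esub> g)"
  unfolding T_def
proof (rule continuous_map_into_smooth_algebra[OF P])
  let ?T = "alg_top (smooth_algebra P)" and ?X = "prod_topology (alg_top (smooth_algebra P)) (alg_top (smooth_algebra P))"
  have top: "topspace ?X = smooth_functions P \<times> smooth_functions P"
    by (simp only: topspace_prod_topology topspace_smooth_algebra)
  show "(case x of (f, g) \<Rightarrow> f \<otimes>\<^bsub>smooth_algebra P\<^esub> g) \<in> smooth_functions P" if "x \<in> topspace ?X" for x
    using that unfolding top by (auto intro: smooth_functions_mult[OF P] simp del: restrict_apply)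
  fix q x0 assume q: "q \<in> smooth_seminorms P" and "x0 \<in> topspace ?X"
  then obtain f0 g0 where x0: "x0 = (f0, g0)" and f0: "f0 \<in> smooth_functions P" and g0: "g0 \<in> smooth_functions P"
    unfolding top by blast
  obtain U \<phi> K vs where d: "seminorm_data P U \<phi> K" and q_eq: "q = chart_seminorm U \<phi> K vs"
    using smooth_seminormsE[OF P q] .
  interpret seminorm_data P U \<phi> K by (rule d)
  \<comment> \<open>With u = f - f0 and v = g - g0 the difference of the products is u v + f0 v + u
    g0; each term is estimated by \<open>sn_mult\<close>.\<close>
  define h where "h x = (\<Sum>c\<leftarrow>splits vs. sn (fst c) (fun_diff P (fst x) f0) * sn (snd c) (fun_diff P (snd x) g0) +
      sn (fst c) f0 * sn (snd c) (fun_diff P (snd x) g0) + sn (fst c) (fun_diff P (fst x) f0) * sn (snd c) g0)" for x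
  have c1: "continuous_map ?X euclideanreal (\<lambda>x. sn us (fun_diff P (fst x) f0))" for us
    using continuous_map_compose[OF continuous_map_fst continuous_map_seminorm_diff[OF P smooth_seminormsI[OF d] f0]]
    by (simp only: o_def)
  have c2: "continuous_map ?X euclideanreal (\<lambda>x. sn us (fun_diff P (snd x) g0))" for us
    using continuous_map_compose[OF continuous_map_snd continuous_map_seminorm_diff[OF P smooth_seminormsI[OF d] g0]]
    by (simp only: o_def)
  have "continuous_map ?X euclideanreal h"
    unfolding h_def[abs_def]
    by (intro continuous_map_sum_list continuous_map_add continuous_map_real_mult c1 c2 continuous_map_const[THEN iffD2]) auto
  moreover have "h x0 = 0"
    unfolding h_def x0 using sn_zero by (simp add: case_prod_beta)
  moreover have "q (fun_diff P (case x of (f, g) \<Rightarrow> f \<otimes>\<^bsub>smooth_algebra P\<^esub> g) (case x0 of (f, g) \<Rightarrow> f \<otimes>\<^bsub>smooth_algebra P\<^esub> g)) \<le> h x"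
    if x: "x \<in> topspace ?X" for x
  proof -
    obtain f g where x_eq: "x = (f, g)" and f: "f \<in> smooth_functions P" and g: "g \<in> smooth_functions P"
      using x unfolding top by blast
    define u v where "u = fun_diff P f f0" and "v = fun_diff P g g0"
    have u: "u \<in> smooth_functions P" and v: "v \<in> smooth_functions P"
      unfolding u_def v_def using f g f0 g0 by (auto intro: smooth_functions_diff[OF P] simp del: restrict_apply)
    let ?m = "\<lambda>f g. \<lambda>p\<in>man_space P. f p * g p"
    have eq: "fun_diff P (?m f g) (?m f0 g0) =
        (\<lambda>p\<in>man_space P. (\<lambda>p\<in>man_space P. ?m u v p + ?m f0 v p) p + ?m u g0 p)"
      unfolding u_def v_def by (auto simp: restrict_def algebra_simps)
    have "sn vs (fun_diff P (?m f g) (?m f0 g0)) \<le> sn vs (?m u v) + sn vs (?m f0 v) + sn vs (?m u g0)"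
      unfolding eq using sn_add[OF smooth_functions_mult[OF P u v] smooth_functions_mult[OF P f0 v], of vs]
        sn_add[OF smooth_functions_add[OF P smooth_functions_mult[OF P u v] smooth_functions_mult[OF P f0 v]]
          smooth_functions_mult[OF P u g0], of vs] by linarith
    also have "\<dots> \<le> (\<Sum>(as, bs)\<leftarrow>splits vs. sn as u * sn bs v) + (\<Sum>(as, bs)\<leftarrow>splits vs. sn as f0 * sn bs v) +
        (\<Sum>(as, bs)\<leftarrow>splits vs. sn as u * sn bs g0)"
      by (intro add_mono sn_mult u v f0 g0)
    also have "\<dots> = h x"
      unfolding h_def x_eq u_def[symmetric] v_def[symmetric] fst_conv snd_conv
      by (simp add: case_prod_unfold sum_list_addf)
    finally show ?thesis unfolding q_eq x0 x_eq by simp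
  qed
  ultimately show "\<exists>h. continuous_map ?X euclideanreal h \<and> h x0 = 0 \<and> (\<forall>x\<in>topspace ?X.
      q (fun_diff P (case x of (f, g) \<Rightarrow> f \<otimes>\<^bsub>smooth_algebra P\<^esub> g) (case x0 of (f, g) \<Rightarrow> f \<otimes>\<^bsub>smooth_algebra P\<^esub> g)) \<le> h x)"
    by blast
qed

lemma cring_complex_ring: "cring complex_ring"
proof (rule cringI)
  show "abelian_group complex_ring"
    by (rule abelian_groupI) (auto simp: complex_ring_def intro: exI[of _ "- _"])
  show "comm_monoid complex_ring"
    by (rule comm_monoidI) (auto simp: complex_ring_def)
qed (auto simp: complex_ring_def algebra_simps)

lemma complex_algebra_smooth:
  assumes P: "charted P"
  shows "complex_algebra (smooth_algebra P)"
proof -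
  interpret A: cring "smooth_algebra P" by (rule cring_smooth_algebra[OF P])
  have "Module.module complex_ring (smooth_algebra P)"
  proof (rule moduleI[OF cring_complex_ring A.is_abelian_group])
    show "c \<odot>\<^bsub>smooth_algebra P\<^esub> f \<in> carrier (smooth_algebra P)"
      if "f \<in> carrier (smooth_algebra P)" for c f
      using that smooth_functions_scale[OF P] by (simp del: restrict_apply)
    show "\<one>\<^bsub>complex_ring\<^esub> \<odot>\<^bsub>smooth_algebra P\<^esub> f = f" if "f \<in> carrier (smooth_algebra P)" for f
      using that smooth_functions_extensional[of f P] by (auto simp: complex_ring_def restrict_def extensional_def)
  qed (auto simp: complex_ring_def restrict_def algebra_simps)
  then show ?thesis
    unfolding complex_algebra_def using A.ring_axioms by (auto simp: restrict_def algebra_simps)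
qed

lemma locally_convex_smooth_algebra:
  assumes P: "smooth_manifold P"
  shows "locally_convex_algebra (smooth_algebra P)"
  unfolding locally_convex_algebra_def
proof (intro conjI)
  note P' = smooth_manifold_charted[OF P]
  show "complex_algebra (smooth_algebra P)" by (rule complex_algebra_smooth[OF P'])
  have "alg_top (smooth_algebra P) = seminorm_topology (smooth_algebra P) (smooth_seminorms P)"
  proof -
    have "a_inv (smooth_algebra P) = a_inv (smooth_function_ring P)"
      unfolding a_inv_def m_inv_def by simp
    then have "x \<ominus>\<^bsub>smooth_algebra P\<^esub> y = x \<ominus>\<^bsub>smooth_function_ring P\<^esub> y" for x y
      by (simp add: a_minus_def)
    then show ?thesis
      by (simp only: seminorm_topology_def smooth_algebra_simps smooth_function_ring_simps(1))
  qed
  moreover have "\<forall>q\<in>smooth_seminorms P. seminorm_of (smooth_algebra P) q"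
    unfolding seminorm_of_def smooth_algebra_simps using smooth_seminorms_seminorm(1-3)[OF P'] by blast
  ultimately show "\<exists>Q. (\<forall>q\<in>Q. seminorm_of (smooth_algebra P) q) \<and>
      alg_top (smooth_algebra P) = seminorm_topology (smooth_algebra P) Q" by blast
  show "continuous_map (prod_topology (alg_top (smooth_algebra P)) (alg_top (smooth_algebra P)))
      (alg_top (smooth_algebra P)) (\<lambda>(x, y). x \<otimes>\<^bsub>smooth_algebra P\<^esub> y)"
    by (rule continuous_map_smooth_algebra_mult[OF P'])
  show "Hausdorff_space (alg_top (smooth_algebra P))"
    unfolding Hausdorff_space_def topspace_smooth_algebra
  proof (intro allI impI)
    fix f g assume *: "f \<in> smooth_functions P \<and> g \<in> smooth_functions P \<and> f \<noteq> g"
    then obtain p where p: "p \<in> man_space P" "f p \<noteq> g p" using smooth_functions_eqI by metis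
    obtain U \<phi> where U: "(U, \<phi>) \<in> atlas P" "p \<in> U" using charted_chart_at[OF P' p(1)] .
    \<comment> \<open>The modulus of the evaluation at \<open>p\<close>. Balls whose radius is half
      the distance of the two values are disjoint.\<close>
    define q where "q = chart_seminorm U \<phi> {\<phi> p} []"
    have q: "q \<in> smooth_seminorms P"
      unfolding q_def by (rule smooth_seminormsI) (use P' U in \<open>auto simp: seminorm_data_def\<close>)
    have q_eq: "q (fun_diff P h k) = cmod (h p - k p)" for h k
      unfolding q_def chart_seminorm_def using U p is_chartD(5)[OF charted_is_chart[OF P' U(1)]] by simp
    define e where "e = cmod (f p - g p) / 2"
    have e: "e > 0" unfolding e_def using p(2) by simp
    have f: "f \<in> smooth_functions P" and g: "g \<in> smooth_functions P" using * by auto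
    let ?A = "{h \<in> smooth_functions P. q (fun_diff P h f) < e}"
    let ?B = "{h \<in> smooth_functions P. q (fun_diff P h g) < e}"
    have "disjnt ?A ?B"
      unfolding disjnt_def
    proof (rule equals0I)
      fix h assume "h \<in> ?A \<inter> ?B"
      then have "cmod (h p - f p) < e" "cmod (h p - g p) < e" unfolding q_eq by auto
      then have "cmod (f p - g p) < e + e" by (metis norm_diff_triangle_less norm_minus_commute)
      then show False unfolding e_def by simp
    qed
    moreover have "f \<in> ?A" "g \<in> ?B" using f g e unfolding q_eq by auto
    ultimately show "\<exists>A B. openin (alg_top (smooth_algebra P)) A \<and> openin (alg_top (smooth_algebra P)) B \<and>
        f \<in> A \<and> g \<in> B \<and> disjnt A B"
      using open_seminorm_ball[OF P' q f e] open_seminorm_ball[OF P' q g e] by blast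
  qed
qed

section \<open>Continuity of pullbacks\<close>

lemma sum_list_concat_map: "(\<Sum>z\<leftarrow>concat (map k xs). g z) = (\<Sum>x\<leftarrow>xs. \<Sum>z\<leftarrow>k x. g z)"
  by (induction xs) auto

text \<open>A chain rule of arbitrary order without explicit coefficients. The list \<open>L\<close>
  is fixed before \<open>F\<close>, so the same coefficient functions serve all \<open>F\<close> and
  the resulting estimates are uniform.\<close>

definition expands_comp ::
  "'d::real_normed_vector set \<Rightarrow> ('d \<Rightarrow> 'e::real_inner) \<Rightarrow> 'd list \<Rightarrow> (('d \<Rightarrow> real) \<times> 'e list) list \<Rightarrow> bool" where
  "expands_comp S T vs L \<longleftrightarrow> (\<forall>z\<in>set L. smooth_on S (fst z)) \<and>
    (\<forall>S' (F::'e \<Rightarrow> complex). smooth_on S' F \<longrightarrow> T ` S \<subseteq> S' \<longrightarrow>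
      (\<forall>x\<in>S. iter_deriv vs (\<lambda>x. F (T x)) x = (\<Sum>z\<leftarrow>L. fst z x *\<^sub>R iter_deriv (snd z) F (T x))))"

lemma expands_compD:
  assumes "expands_comp S T vs L"
  shows "z \<in> set L \<Longrightarrow> smooth_on S (fst z)"
    "smooth_on S' (F::'e::real_inner \<Rightarrow> complex) \<Longrightarrow> T ` S \<subseteq> S' \<Longrightarrow> x \<in> S \<Longrightarrow>
      iter_deriv vs (\<lambda>x. F (T x)) x = (\<Sum>z\<leftarrow>L. fst z x *\<^sub>R iter_deriv (snd z) F (T x))"
  by (fact assms[unfolded expands_comp_def, THEN conjunct1, rule_format])
    (fact assms[unfolded expands_comp_def, THEN conjunct2, rule_format])

lemma expands_comp_exists:
  fixes T :: "'d::real_normed_vector \<Rightarrow> 'e::real_inner"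
  assumes fd: "\<exists>B::'e set. finite B \<and> span B = UNIV" and S: "open S" "smooth_on S T"
  shows "\<exists>L. expands_comp S T vs L"
proof (induction vs)
  case Nil
  have "expands_comp S T [] [(\<lambda>x. 1, [])]" by (simp add: expands_comp_def smooth_on_const)
  then show ?case by blast
next
  case (Cons v vs)
  then obtain L where "expands_comp S T vs L" by blast
  note L = expands_compD(1)[OF this] and exp = expands_compD(2)[OF this]
  obtain E :: "'e set" where E: "finite E" "\<And>v. (\<Sum>c\<in>E. (v \<bullet> c / (c \<bullet> c)) *\<^sub>R c) = v"
    using finite_dim_expansion[OF fd] by blast
  obtain cs where cs: "set cs = E" "distinct cs" using finite_distinct_list[OF E(1)] by blast
  let ?DT = "\<lambda>x. frechet_derivative T (at x) v"
  \<comment> \<open>The derivative of one term: either it falls on the coefficient, or it falls on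
    the composite and spreads over the basis vectors.\<close>
  define k where "k z = (\<lambda>x. frechet_derivative (fst z) (at x) v, snd z) #
      map (\<lambda>c. (\<lambda>x. fst z x * (?DT x \<bullet> c / (c \<bullet> c)), c # snd z)) cs" for z :: "('d \<Rightarrow> real) \<times> 'e list"
  have sm: "smooth_on S (fst z)" if z: "z \<in> set (concat (map k L))" for z
  proof -
    obtain y where y: "y \<in> set L" "z \<in> set (k y)" using z unfolding set_concat set_map by blast
    have bl: "bounded_linear (\<lambda>w. w \<bullet> c / (c \<bullet> c))" for c :: 'e
      by (rule bounded_linear_compose[OF bounded_linear_divide bounded_linear_inner_left])
    have "smooth_on S (\<lambda>x. fst y x * (?DT x \<bullet> c / (c \<bullet> c)))" for c
      by (intro smooth_on_bilinear[OF bounded_bilinear_mult S(1)] L[OF y(1)]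
          smooth_on_linear_comp[OF bl S(1)] smooth_on_frechet_derivative S(2))
    then show ?thesis
      using y(2) smooth_on_frechet_derivative[OF L[OF y(1)], of v] unfolding k_def by auto
  qed
  have "iter_deriv (v # vs) (\<lambda>x. F (T x)) x =
      (\<Sum>z\<leftarrow>concat (map k L). fst z x *\<^sub>R iter_deriv (snd z) F (T x))"
    if F: "smooth_on S' F" "T ` S \<subseteq> S'" and x: "x \<in> S" for S' and F :: "'e \<Rightarrow> complex" and x
  proof -
    let ?I = "\<lambda>ws. frechet_derivative (iter_deriv ws F) (at (T x))"
    have "((\<lambda>x. \<Sum>z\<leftarrow>L. fst z x *\<^sub>R iter_deriv (snd z) F (T x)) has_derivative
        (\<lambda>w. \<Sum>z\<leftarrow>L. fst z x *\<^sub>R (\<Sum>c\<in>E. (frechet_derivative T (at x) w \<bullet> c / (c \<bullet> c)) *\<^sub>R ?I (snd z) c) +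
          frechet_derivative (fst z) (at x) w *\<^sub>R iter_deriv (snd z) F (T x))) (at x)"
    proof (rule has_derivative_sum_list)
      fix z assume z: "z \<in> set L"
      have "iter_deriv (snd z) F differentiable (at (T x))"
        using smooth_on_imp_differentiable[OF smooth_on_iter_deriv[OF F(1)]] F(2) x by blast
      then show "((\<lambda>x. fst z x *\<^sub>R iter_deriv (snd z) F (T x)) has_derivative
          (\<lambda>w. fst z x *\<^sub>R (\<Sum>c\<in>E. (frechet_derivative T (at x) w \<bullet> c / (c \<bullet> c)) *\<^sub>R ?I (snd z) c) +
            frechet_derivative (fst z) (at x) w *\<^sub>R iter_deriv (snd z) F (T x))) (at x)"
        by (rule has_derivative_scaleR[OF smooth_on_imp_has_derivative[OF L[OF z] x]
              has_derivative_comp_expansion[OF E(2) smooth_on_imp_has_derivative[OF S(2) x]]])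
    qed
    note D = frechet_derivative_at[OF this, symmetric]
    have "iter_deriv (v # vs) (\<lambda>x. F (T x)) x =
        frechet_derivative (\<lambda>x. \<Sum>z\<leftarrow>L. fst z x *\<^sub>R iter_deriv (snd z) F (T x)) (at x) v"
      using frechet_derivative_cong_open[OF S(1) x exp[OF F]] by simp
    also have "\<dots> = (\<Sum>z\<leftarrow>L. fst z x *\<^sub>R (\<Sum>c\<in>E. (?DT x \<bullet> c / (c \<bullet> c)) *\<^sub>R ?I (snd z) c) +
          frechet_derivative (fst z) (at x) v *\<^sub>R iter_deriv (snd z) F (T x))"
      unfolding D ..
    also have "\<dots> = (\<Sum>z\<leftarrow>L. \<Sum>y\<leftarrow>k z. fst y x *\<^sub>R iter_deriv (snd y) F (T x))"
    proof (intro arg_cong[where f=sum_list] map_cong refl)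
      fix z :: "('d \<Rightarrow> real) \<times> 'e list"
      have "(\<Sum>c\<leftarrow>cs. (fst z x * (?DT x \<bullet> c / (c \<bullet> c))) *\<^sub>R ?I (snd z) c) =
          fst z x *\<^sub>R (\<Sum>c\<in>E. (?DT x \<bullet> c / (c \<bullet> c)) *\<^sub>R ?I (snd z) c)"
        unfolding sum_list_distinct_conv_sum_set[OF cs(2)] cs(1) by (simp add: scaleR_sum_right)
      then show "fst z x *\<^sub>R (\<Sum>c\<in>E. (?DT x \<bullet> c / (c \<bullet> c)) *\<^sub>R ?I (snd z) c) +
          frechet_derivative (fst z) (at x) v *\<^sub>R iter_deriv (snd z) F (T x) =
          (\<Sum>y\<leftarrow>k z. fst y x *\<^sub>R iter_deriv (snd y) F (T x))"
        unfolding k_def by (simp add: o_def add.commute)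
    qed
    finally show ?thesis by (simp only: sum_list_concat_map)
  qed
  then have "expands_comp S T (v # vs) (concat (map k L))"
    using sm by (simp only: expands_comp_def) simp
  then show ?case by blast
qed

text \<open>The majorants that \<open>continuous_map_into_smooth_algebra\<close> accepts after
  recentring. The seminorms are among them, and nonnegative combinations stay in the class.\<close>

definition tame :: "('a, 'e::real_inner) manifold \<Rightarrow> (('a \<Rightarrow> complex) \<Rightarrow> real) \<Rightarrow> bool" where
  "tame P h \<longleftrightarrow> (\<forall>f\<in>smooth_functions P. 0 \<le> h f) \<and> h (\<lambda>p\<in>man_space P. 0) = 0 \<and>
     (\<forall>g\<in>smooth_functions P. continuous_map (alg_top (smooth_algebra P)) euclideanreal (\<lambda>f. h (fun_diff P f g)))"

lemma tame_seminorm: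
  assumes P: "charted P" and q: "q \<in> smooth_seminorms P"
  shows "tame P q"
  unfolding tame_def
  by (intro conjI ballI smooth_seminorms_seminorm(1,4)[OF assms] continuous_map_seminorm_diff[OF assms])

lemma tame_scale: "0 \<le> c \<Longrightarrow> tame P h \<Longrightarrow> tame P (\<lambda>f. c * h f)"
  unfolding tame_def by (elim conjE, intro conjI ballI continuous_map_real_mult_left) (simp_all del: restrict_apply)

lemma tame_sum_list:
  assumes "\<And>i. i \<in> set xs \<Longrightarrow> tame P (h i)"
  shows "tame P (\<lambda>f. \<Sum>i\<leftarrow>xs. h i f)"
  unfolding tame_def
proof (intro conjI ballI)
  show "0 \<le> (\<Sum>i\<leftarrow>xs. h i f)" if "f \<in> smooth_functions P" for f
    using assms that unfolding tame_def by (intro sum_list_nonneg) auto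
  show "(\<Sum>i\<leftarrow>xs. h i (\<lambda>p\<in>man_space P. 0)) = 0"
    using assms unfolding tame_def by (induction xs) auto
  show "continuous_map (alg_top (smooth_algebra P)) euclideanreal (\<lambda>f. \<Sum>i\<leftarrow>xs. h i (fun_diff P f g))"
    if "g \<in> smooth_functions P" for g
    using assms that unfolding tame_def by (intro continuous_map_sum_list) blast
qed

text \<open>Near \<open>x\<close> the map stays inside one chart of the target. On a closed ball the
  chain rule coefficients are bounded and the image is compact, so finitely many seminorms of
  \<open>f\<close> bound the derivative of the pullback.\<close>

lemma pullback_local_bound:
  fixes P :: "('a, 'e::real_inner) manifold"
  assumes P: "smooth_manifold P" and s: "smooth_map P P s" and U: "(U, \<phi>) \<in> atlas P" and x: "x \<in> \<phi> ` U"
  shows "\<exists>N h. open N \<and> x \<in> N \<and> tame P h \<and> (\<forall>f\<in>smooth_functions P. \<forall>y\<in>N.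
    cmod (iter_deriv vs ((\<lambda>p\<in>man_space P. f (s p)) \<circ> inv_into U \<phi>) y) \<le> h f)"
proof -
  note P' = smooth_manifold_charted[OF P]
  note fd = smooth_manifold_finite_dim[OF P]
  note cU = charted_is_chart[OF P' U]
  have cont: "continuous_map (mtop P) (mtop P) s" using s by (simp add: smooth_map_def)
  obtain p where p: "p \<in> U" "x = \<phi> p" using x by blast
  have pP: "p \<in> man_space P" using p is_chartD(4)[OF cU] by blast
  have "s p \<in> man_space P" using cont pP continuous_map_image_subset_topspace by blast
  then obtain V \<psi> where V: "(V, \<psi>) \<in> atlas P" "s p \<in> V" by (rule charted_chart_at[OF P'])
  note cV = charted_is_chart[OF P' V(1)]
  have "smooth_at P (\<psi> \<circ> s) p" using s pP V unfolding smooth_map_iff[OF P' P'] by blast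
  then obtain T0 where T0: "open T0" "\<phi> p \<in> T0" "T0 \<subseteq> \<phi> ` U" "smooth_on T0 (\<psi> \<circ> s \<circ> inv_into U \<phi>)"
    by (rule smooth_atD[OF _ U p(1)])
  define W where "W = {x \<in> man_space P. s x \<in> V}"
  have W: "openin (mtop P) W" unfolding W_def by (rule openin_continuous_map_preimage[OF cont is_chartD(1)[OF cV]])
  define O' where "O' = T0 \<inter> \<phi> ` (W \<inter> U)"
  have "open (\<phi> ` (W \<inter> U))" using W is_chartD(1)[OF cU] by (intro chart_open_image[OF cU]) auto
  then have O': "open O'" "x \<in> O'" unfolding O'_def using T0 p V pP by (auto simp: W_def)
  define T where "T = \<psi> \<circ> s \<circ> inv_into U \<phi>"
  have T: "smooth_on O' T" unfolding T_def O'_def by (rule smooth_on_subset[OF T0(4)]) auto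
  have inO: "inv_into U \<phi> y \<in> W \<inter> U" if "y \<in> O'" for y
    using that is_chartD(5)[OF cU] unfolding O'_def by auto
  have TV: "T ` O' \<subseteq> \<psi> ` V" using inO unfolding T_def W_def by auto
  obtain r where r: "r > 0" "cball x r \<subseteq> O'" using O' open_contains_cball by blast
  define B where "B = cball x r"
  have B: "compact B" "B \<noteq> {}" unfolding B_def using compact_cball_finite_dim[OF fd] r(1) by auto
  have contT: "continuous_on B T"
    using smooth_on_imp_continuous_on[OF T] r(2) unfolding B_def by (rule continuous_on_subset)
  have TB: "seminorm_data P V \<psi> (T ` B)"
    using P' V compact_continuous_image[OF contT B(1)] B(2) TV r(2) unfolding B_def by unfold_locales auto
  obtain L where "expands_comp O' T vs L" using expands_comp_exists[OF fd O'(1) T] by blast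
  note L = expands_compD(1)[OF this] and exp = expands_compD(2)[OF this]
  have "\<exists>A\<ge>0. \<forall>y\<in>B. \<bar>fst z y\<bar> \<le> A" if z: "z \<in> set L" for z
  proof -
    have "continuous_on B (fst z)"
      using smooth_on_imp_continuous_on[OF L[OF z]] r(2) unfolding B_def by (rule continuous_on_subset)
    then have "bounded (fst z ` B)" by (intro compact_imp_bounded compact_continuous_image B(1))
    then obtain A where "\<forall>y\<in>B. \<bar>fst z y\<bar> \<le> A" unfolding bounded_iff by auto
    then show ?thesis by (intro exI[of _ "\<bar>A\<bar>"]) (auto intro: order_trans)
  qed
  then obtain A where A: "\<And>z. z \<in> set L \<Longrightarrow> 0 \<le> A z" "\<And>z y. z \<in> set L \<Longrightarrow> y \<in> B \<Longrightarrow> \<bar>fst z y\<bar> \<le> A z"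
    by metis
  define h where "h f = (\<Sum>z\<leftarrow>L. A z * chart_seminorm V \<psi> (T ` B) (snd z) f)" for f
  have "tame P h"
    unfolding h_def[abs_def] using A(1)
    by (intro tame_sum_list tame_scale tame_seminorm[OF P' smooth_seminormsI[OF TB]])
  moreover have "cmod (iter_deriv vs ((\<lambda>p\<in>man_space P. f (s p)) \<circ> inv_into U \<phi>) y) \<le> h f"
    if f: "f \<in> smooth_functions P" and y: "y \<in> ball x r" for f y
  proof -
    have yB: "y \<in> B" and yO: "y \<in> O'" using y r(2) unfolding B_def by auto
    let ?F = "f \<circ> inv_into V \<psi>"
    have "iter_deriv vs ((\<lambda>p\<in>man_space P. f (s p)) \<circ> inv_into U \<phi>) y = iter_deriv vs (\<lambda>x. ?F (T x)) y"
      using inO is_chartD(5)[OF cV] unfolding T_def W_def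
      by (intro iter_deriv_cong_open[OF O'(1) _ yO]) auto
    also have "\<dots> = (\<Sum>z\<leftarrow>L. fst z y *\<^sub>R iter_deriv (snd z) ?F (T y))"
      by (rule exp[OF smooth_functions_smooth_on[OF f V(1)] TV yO])
    also have "cmod \<dots> \<le> (\<Sum>z\<leftarrow>L. cmod (fst z y *\<^sub>R iter_deriv (snd z) ?F (T y)))"
      by (rule norm_sum_list_le)
    also have "\<dots> \<le> h f"
      unfolding h_def
    proof (rule sum_list_mono)
      fix z assume z: "z \<in> set L"
      show "cmod (fst z y *\<^sub>R iter_deriv (snd z) ?F (T y)) \<le> A z * chart_seminorm V \<psi> (T ` B) (snd z) f"
        using A[OF z] yB seminorm_data.sn_upper[OF TB f imageI[OF yB]] by (auto intro!: mult_mono)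
    qed
    finally show ?thesis .
  qed
  ultimately show ?thesis using r(1) by (intro exI[of _ "ball x r"] exI[of _ h]) auto
qed

text \<open>Finitely many of the local neighbourhoods cover \<open>K\<close>. The sum of their
  bounds dominates each of them because tame functionals are nonnegative on smooth
  functions.\<close>

lemma pullback_bound:
  fixes P :: "('a, 'e::real_inner) manifold"
  assumes P: "smooth_manifold P" and s: "smooth_map P P s" and q: "q \<in> smooth_seminorms P"
  shows "\<exists>h. tame P h \<and> (\<forall>f\<in>smooth_functions P. q (\<lambda>p\<in>man_space P. f (s p)) \<le> h f)"
proof -
  note P' = smooth_manifold_charted[OF P]
  obtain U \<phi> K vs where d: "seminorm_data P U \<phi> K" and q_eq: "q = chart_seminorm U \<phi> K vs"
    using smooth_seminormsE[OF P' q] .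
  interpret seminorm_data P U \<phi> K by (rule d)
  define R where "R x N h \<longleftrightarrow> open N \<and> x \<in> N \<and> tame P h \<and> (\<forall>f\<in>smooth_functions P. \<forall>y\<in>N.
    cmod (iter_deriv vs ((\<lambda>p\<in>man_space P. f (s p)) \<circ> inv_into U \<phi>) y) \<le> h f)" for x N h
  have "\<exists>N h. R x N h" if "x \<in> K" for x
    unfolding R_def using that K(3) by (intro pullback_local_bound[OF P s U]) auto
  then obtain N h where "\<And>x. x \<in> K \<Longrightarrow> R x (N x) (h x)" by metis
  then have N: "\<And>x. x \<in> K \<Longrightarrow> open (N x)" "\<And>x. x \<in> K \<Longrightarrow> x \<in> N x" "\<And>x. x \<in> K \<Longrightarrow> tame P (h x)"
    "\<And>x f y. x \<in> K \<Longrightarrow> f \<in> smooth_functions P \<Longrightarrow> y \<in> N x \<Longrightarrow>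
      cmod (iter_deriv vs ((\<lambda>p\<in>man_space P. f (s p)) \<circ> inv_into U \<phi>) y) \<le> h x f"
    unfolding R_def by blast+
  obtain I where I: "I \<subseteq> K" "finite I" "K \<subseteq> (\<Union>x\<in>I. N x)"
    using compactE_image[OF K(1), of K N] N(1,2) by blast
  obtain xs where xs: "set xs = I" using finite_list[OF I(2)] by blast
  define H where "H f = (\<Sum>x\<leftarrow>xs. h x f)" for f
  have "tame P H" unfolding H_def[abs_def] using N(3) I(1) xs by (intro tame_sum_list) auto
  moreover have "q (\<lambda>p\<in>man_space P. f (s p)) \<le> H f" if f: "f \<in> smooth_functions P" for f
    unfolding q_eq
  proof (rule sn_least)
    fix y assume "y \<in> K"
    then obtain x where x: "x \<in> I" "y \<in> N x" using I(3) by blast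
    have "h x f \<le> H f"
      unfolding H_def
      using N(3) I(1) xs x(1) f by (intro member_le_sum_list) (auto simp: tame_def)
    then show "cmod (iter_deriv vs ((\<lambda>p\<in>man_space P. f (s p)) \<circ> inv_into U \<phi>) y) \<le> H f"
      using N(4)[OF _ f x(2)] x(1) I(1) by fastforce
  qed
  ultimately show ?thesis by blast
qed

lemma pullback_smooth:
  assumes P: "smooth_manifold P" and s: "smooth_map P P s" and f: "f \<in> smooth_functions P"
  shows "(\<lambda>p\<in>man_space P. f (s p)) \<in> smooth_functions P"
proof -
  note P' = smooth_manifold_charted[OF P]
  have "s p \<in> man_space P" if "p \<in> man_space P" for p
    using s that continuous_map_image_subset_topspace unfolding smooth_map_def by blast
  then show ?thesis
    by (intro smooth_functionsI[OF P'] smooth_at_compose_smooth_map[OF P' P s] smooth_functions_smooth_at[OF P' f])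
qed

text \<open>Pulling back is linear, so \<open>pullback_bound\<close> applied to differences f - f0
  yields the required majorant.\<close>

lemma continuous_map_pullback:
  assumes P: "smooth_manifold P" and s: "smooth_map P P s"
  shows "continuous_map (alg_top (smooth_algebra P)) (alg_top (smooth_algebra P)) (\<lambda>f. \<lambda>p\<in>man_space P. f (s p))"
proof (rule continuous_map_into_smooth_algebra[OF smooth_manifold_charted[OF P]], unfold topspace_smooth_algebra)
  note P' = smooth_manifold_charted[OF P]
  have sP: "s p \<in> man_space P" if "p \<in> man_space P" for p
    using s that continuous_map_image_subset_topspace unfolding smooth_map_def by blast
  show "(\<lambda>p\<in>man_space P. f (s p)) \<in> smooth_functions P" if "f \<in> smooth_functions P" for f
    by (rule pullback_smooth[OF P s that])
  fix q f0 assume q: "q \<in> smooth_seminorms P" and f0: "f0 \<in> smooth_functions P"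
  obtain h where h: "tame P h" "\<And>f. f \<in> smooth_functions P \<Longrightarrow> q (\<lambda>p\<in>man_space P. f (s p)) \<le> h f"
    using pullback_bound[OF P s q] by blast
  have "continuous_map (alg_top (smooth_algebra P)) euclideanreal (\<lambda>f. h (fun_diff P f f0))"
    using h(1) f0 unfolding tame_def by blast
  moreover have "h (fun_diff P f0 f0) = 0"
    using h(1) unfolding tame_def by (simp del: restrict_apply)
  moreover have "q (fun_diff P (\<lambda>p\<in>man_space P. f (s p)) (\<lambda>p\<in>man_space P. f0 (s p))) \<le> h (fun_diff P f f0)"
    if f: "f \<in> smooth_functions P" for f
  proof -
    have "fun_diff P (\<lambda>p\<in>man_space P. f (s p)) (\<lambda>p\<in>man_space P. f0 (s p)) = (\<lambda>p\<in>man_space P. fun_diff P f f0 (s p))"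
      using sP by (auto simp: restrict_def)
    then show ?thesis using h(2)[OF smooth_functions_diff[OF P' f f0]] by (simp only:)
  qed
  ultimately show "\<exists>h. continuous_map (alg_top (smooth_algebra P)) euclideanreal h \<and> h f0 = 0 \<and>
      (\<forall>x\<in>smooth_functions P. q (fun_diff P (\<lambda>p\<in>man_space P. x (s p)) (\<lambda>p\<in>man_space P. f0 (s p))) \<le> h x)"
    by (intro exI[of _ "\<lambda>f. h (fun_diff P f f0)"]) blast
qed

section \<open>The dynamical system of a smooth action\<close>

context smooth_action
begin

interpretation L: group \<Lambda> by (rule \<Lambda>)

lemma pullback_action_apply: "f \<in> smooth_functions P \<Longrightarrow> pullback_action P \<sigma> g f = (\<lambda>p\<in>man_space P. f (\<sigma> (p, g)))"
  by (simp add: pullback_action_def)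

lemma pullback_action_closed:
  "g \<in> carrier \<Lambda> \<Longrightarrow> f \<in> smooth_functions P \<Longrightarrow> pullback_action P \<sigma> g f \<in> smooth_functions P"
  unfolding pullback_action_apply by (rule pullback_smooth[OF P \<sigma>_smooth_map])

text \<open>A right action on points gives a left action on functions: both sides evaluate
  \<open>f\<close> at the point moved first by \<open>g\<close> and then by
  \<open>h\<close>.\<close>

lemma pullback_action_mult:
  assumes "g \<in> carrier \<Lambda>" "h \<in> carrier \<Lambda>" "f \<in> smooth_functions P"
  shows "pullback_action P \<sigma> (g \<otimes>\<^bsub>\<Lambda>\<^esub> h) f = pullback_action P \<sigma> g (pullback_action P \<sigma> h f)"
  unfolding pullback_action_apply[OF assms(3)] pullback_action_apply[OF pullback_action_closed[OF assms(2,3), unfolded pullback_action_apply[OF assms(3)]]]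
  using assms by (auto simp: restrict_def \<sigma>_closed \<sigma>_mult)

lemma pullback_action_one:
  assumes "f \<in> smooth_functions P"
  shows "pullback_action P \<sigma> \<one>\<^bsub>\<Lambda>\<^esub> f = f"
  unfolding pullback_action_apply[OF assms]
  using smooth_functions_extensional[OF assms] by (auto simp: restrict_def extensional_def \<sigma>_one)

lemma pullback_action_Bij:
  assumes g: "g \<in> carrier \<Lambda>"
  shows "pullback_action P \<sigma> g \<in> Bij (smooth_functions P)"
proof -
  have "bij_betw (pullback_action P \<sigma> g) (smooth_functions P) (smooth_functions P)"
  proof (rule bij_betw_byWitness[where f'="pullback_action P \<sigma> (inv\<^bsub>\<Lambda>\<^esub> g)"])
    show "\<forall>f\<in>smooth_functions P. pullback_action P \<sigma> (inv\<^bsub>\<Lambda>\<^esub> g) (pullback_action P \<sigma> g f) = f"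
      using g pullback_action_mult[of "inv\<^bsub>\<Lambda>\<^esub> g" g] pullback_action_one by simp
    show "\<forall>f\<in>smooth_functions P. pullback_action P \<sigma> g (pullback_action P \<sigma> (inv\<^bsub>\<Lambda>\<^esub> g) f) = f"
      using g pullback_action_mult[of g "inv\<^bsub>\<Lambda>\<^esub> g"] pullback_action_one by simp
  qed (use g pullback_action_closed in auto)
  then show ?thesis by (simp add: Bij_def pullback_action_def)
qed

lemma pullback_action_aut:
  assumes g: "g \<in> carrier \<Lambda>"
  shows "pullback_action P \<sigma> g \<in> carrier (algebra_AutGroup (smooth_algebra P))"
proof -
  note c = smooth_functions_mult[OF P'] smooth_functions_add[OF P'] smooth_functions_scale[OF P'] smooth_functions_const[OF P']
  have "pullback_action P \<sigma> g \<in> ring_hom (smooth_algebra P) (smooth_algebra P)"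
  proof (rule ring_hom_memI)
    fix f k assume fk: "f \<in> carrier (smooth_algebra P)" "k \<in> carrier (smooth_algebra P)"
    then show "pullback_action P \<sigma> g (f \<otimes>\<^bsub>smooth_algebra P\<^esub> k) =
        pullback_action P \<sigma> g f \<otimes>\<^bsub>smooth_algebra P\<^esub> pullback_action P \<sigma> g k"
      using c(1)[of f k] g by (auto simp: pullback_action_apply \<sigma>_closed restrict_def)
    show "pullback_action P \<sigma> g (f \<oplus>\<^bsub>smooth_algebra P\<^esub> k) =
        pullback_action P \<sigma> g f \<oplus>\<^bsub>smooth_algebra P\<^esub> pullback_action P \<sigma> g k"
      using fk c(2)[of f k] g by (auto simp: pullback_action_apply \<sigma>_closed restrict_def)
  next
    show "pullback_action P \<sigma> g f \<in> carrier (smooth_algebra P)" if "f \<in> carrier (smooth_algebra P)" for f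
      using that pullback_action_closed[OF g] by simp
    show "pullback_action P \<sigma> g \<one>\<^bsub>smooth_algebra P\<^esub> = \<one>\<^bsub>smooth_algebra P\<^esub>"
      using c(4)[of 1] g by (auto simp: pullback_action_apply \<sigma>_closed restrict_def)
  qed
  moreover have "pullback_action P \<sigma> g (z \<odot>\<^bsub>smooth_algebra P\<^esub> f) = z \<odot>\<^bsub>smooth_algebra P\<^esub> pullback_action P \<sigma> g f"
    if "f \<in> smooth_functions P" for z f
    using that c(3)[OF that, of z] g by (auto simp: pullback_action_apply \<sigma>_closed restrict_def)
  ultimately show ?thesis
    using pullback_action_Bij[OF g] by (simp add: algebra_AutGroup_def)
qed

lemma pullback_dynamical_system: "dynamical_system (smooth_algebra P) \<Lambda> (pullback_action P \<sigma>)"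
  unfolding dynamical_system_def
proof (intro conjI)
  show "locally_convex_algebra (smooth_algebra P)" by (rule locally_convex_smooth_algebra[OF P])
  show "group \<Lambda>" by (rule \<Lambda>)
  show "pullback_action P \<sigma> \<in> hom \<Lambda> (algebra_AutGroup (smooth_algebra P))"
  proof (rule homI[OF pullback_action_aut])
    fix g h assume gh: "g \<in> carrier \<Lambda>" "h \<in> carrier \<Lambda>"
    have "pullback_action P \<sigma> (g \<otimes>\<^bsub>\<Lambda>\<^esub> h) = compose (smooth_functions P) (pullback_action P \<sigma> g) (pullback_action P \<sigma> h)"
    proof (rule extensionalityI[of _ "smooth_functions P"])
      show "pullback_action P \<sigma> (g \<otimes>\<^bsub>\<Lambda>\<^esub> h) \<in> extensional (smooth_functions P)" by (simp add: pullback_action_def)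
    qed (use pullback_action_mult[OF gh] in \<open>auto simp: compose_def\<close>)
    then show "pullback_action P \<sigma> (g \<otimes>\<^bsub>\<Lambda>\<^esub> h) =
        pullback_action P \<sigma> g \<otimes>\<^bsub>algebra_AutGroup (smooth_algebra P)\<^esub> pullback_action P \<sigma> h"
      using pullback_action_Bij gh by (simp add: algebra_AutGroup_def BijGroup_def)
  qed
  let ?T = "alg_top (smooth_algebra P)" and ?D = "discrete_topology (carrier \<Lambda>)"
  have "continuous_map ?T ?T (pullback_action P \<sigma> g)" if "g \<in> carrier \<Lambda>" for g
    by (rule continuous_map_eq[OF continuous_map_pullback[OF P \<sigma>_smooth_map[OF that]]])
      (simp only: topspace_smooth_algebra pullback_action_apply)
  \<comment> \<open>The discrete factor is put on the right, as
    \<open>continuous_map_from_prod_discrete\<close> expects; composing with the swap restores the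
    order.\<close>
  then have "continuous_map (prod_topology ?T ?D) ?T (\<lambda>(a, g). pullback_action P \<sigma> g a)"
    by (intro continuous_map_from_prod_discrete) simp
  moreover have "continuous_map (prod_topology ?D ?T) (prod_topology ?T ?D) (\<lambda>(g, a). (a, g))"
    by (metis homeomorphic_imp_continuous_map homeomorphic_map_swap)
  ultimately have "continuous_map (prod_topology ?D ?T) ?T ((\<lambda>(a, g). pullback_action P \<sigma> g a) \<circ> (\<lambda>(g, a). (a, g)))"
    using continuous_map_compose by blast
  then show "continuous_map (prod_topology ?D ?T) ?T (\<lambda>(g, a). pullback_action P \<sigma> g a)"
    by (simp only: o_def case_prod_unfold fst_conv snd_conv)
qed

end

section \<open>From a global trivialization to a trivial noncommutative bundle\<close>

lemma trivial_bundle_imp_trivial_nc_bundle: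
  fixes \<Lambda> :: "('g, 'z) monoid_scheme"
  assumes \<Lambda>: "comm_group \<Lambda>" and fin: "finite (carrier \<Lambda>)" and triv: "trivial_principal_bundle P M \<Lambda> q \<sigma>"
  shows "trivial_nc_principal_bundle (smooth_algebra P) \<Lambda> (pullback_action P \<sigma>)"
proof -
  interpret L: comm_group \<Lambda> by (rule \<Lambda>)
  have P: "smooth_manifold P" and M: "smooth_manifold M" and act: "smooth_right_action P \<Lambda> \<sigma>"
    using triv by (auto simp: trivial_principal_bundle_def principal_bundle_def)
  interpret smooth_action P \<Lambda> \<sigma> by unfold_locales (rule P, rule act)
  obtain \<Phi> where "bundle_equivalence \<Lambda> P q \<sigma> (prod_discrete M \<Lambda>) fst (product_action \<Lambda>) \<Phi>"
    using triv by (auto simp: trivial_principal_bundle_def)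
  then have \<Phi>: "smooth_map P (prod_discrete M \<Lambda>) \<Phi>"
    and eq: "\<And>p g. p \<in> man_space P \<Longrightarrow> g \<in> carrier \<Lambda> \<Longrightarrow> \<Phi> (\<sigma> (p, g)) = product_action \<Lambda> (\<Phi> p, g)"
    by (auto simp: bundle_equivalence_def diffeomorphism_def)
  have "continuous_map (mtop P) (prod_topology (mtop M) (discrete_topology (carrier \<Lambda>))) \<Phi>"
    using \<Phi> by (simp add: smooth_map_def mtop_prod_discrete)
  then have c: "continuous_map (mtop P) (discrete_topology (carrier \<Lambda>)) (\<lambda>p. snd (\<Phi> p))"
    using continuous_map_compose[OF _ continuous_map_snd] by (force simp: o_def)
  have sndL: "snd (\<Phi> p) \<in> carrier \<Lambda>" if "p \<in> man_space P" for p
    using continuous_map_image_subset_topspace[OF c] that by auto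
  have snd_act: "snd (\<Phi> (\<sigma> (p, g))) = snd (\<Phi> p) \<otimes>\<^bsub>\<Lambda>\<^esub> g" if "p \<in> man_space P" "g \<in> carrier \<Lambda>" for p g
    using eq[OF that] by (simp add: product_action_def case_prod_unfold)
  \<comment> \<open>The group component of \<open>\<Phi>\<close> is locally constant, so any
    function of it is smooth.\<close>
  have lc: "(\<lambda>p\<in>man_space P. k (snd (\<Phi> p))) \<in> smooth_functions P" for k :: "'g \<Rightarrow> complex"
  proof (rule smooth_functionsI[OF P'])
    fix p assume p: "p \<in> man_space P"
    have "openin (mtop P) {x \<in> man_space P. snd (\<Phi> x) \<in> {snd (\<Phi> p)}}"
      using sndL[OF p] by (intro openin_continuous_map_preimage[OF c]) auto
    then show "smooth_at P (\<lambda>p. k (snd (\<Phi> p))) p"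
      by (rule smooth_at_cong[OF P' smooth_at_const[OF P', of "k (snd (\<Phi> p))"]]) (use p in auto)
  qed
  obtain S where S: "adapted_generators \<Lambda> S" using L.adapted_generators_exist[OF fin] by blast
  have "\<exists>a\<in>isotypic_component (smooth_algebra P) \<Lambda> (pullback_action P \<sigma>) (dual_generator \<Lambda> S s).
      a \<in> Units (smooth_algebra P) \<and> a [^]\<^bsub>smooth_algebra P\<^esub> L.ord s = \<one>\<^bsub>smooth_algebra P\<^esub>" if s: "s \<in> S" for s
  proof -
    let ?\<theta> = "dual_generator \<Lambda> S s"
    note \<theta> = L.dual_generator(1)[OF fin S s]
    have nz: "?\<theta> g \<noteq> 0" if "g \<in> carrier \<Lambda>" for g
      using charactersD(2)[OF L.is_group \<theta> that] by auto
    \<comment> \<open>Equivariance of \<open>\<Phi>\<close> turns translation by g into the factor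
      \<open>?\<theta> g\<close>, and the values of \<open>?\<theta>\<close> are roots of unity of
      order \<open>ord s\<close>.\<close>
    define a where "a = (\<lambda>p\<in>man_space P. ?\<theta> (snd (\<Phi> p)))"
    define b where "b = (\<lambda>p\<in>man_space P. inverse (?\<theta> (snd (\<Phi> p))))"
    have a: "a \<in> smooth_functions P" unfolding a_def by (rule lc)
    have b: "b \<in> smooth_functions P" unfolding b_def using lc[of "\<lambda>g. inverse (?\<theta> g)"] .
    have "pullback_action P \<sigma> g a = ?\<theta> g \<odot>\<^bsub>smooth_algebra P\<^esub> a" if g: "g \<in> carrier \<Lambda>" for g
      unfolding pullback_action_apply[OF a] smooth_algebra_simps
      using g sndL by (intro restrict_ext) (simp add: a_def \<sigma>_closed snd_act charactersD(1)[OF L.is_group \<theta>])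
    then have "a \<in> isotypic_component (smooth_algebra P) \<Lambda> (pullback_action P \<sigma>) ?\<theta>"
      unfolding isotypic_component_def using a by simp
    moreover have "a \<otimes>\<^bsub>smooth_algebra P\<^esub> b = \<one>\<^bsub>smooth_algebra P\<^esub>" "b \<otimes>\<^bsub>smooth_algebra P\<^esub> a = \<one>\<^bsub>smooth_algebra P\<^esub>"
      unfolding smooth_algebra_simps using nz sndL by (auto simp: a_def b_def intro!: restrict_ext)
    then have "a \<in> Units (smooth_algebra P)"
      unfolding Units_def smooth_algebra_simps(1) using a b by blast
    moreover have "a [^]\<^bsub>smooth_algebra P\<^esub> L.ord s = \<one>\<^bsub>smooth_algebra P\<^esub>"
    proof (rule smooth_functions_eqI[of _ P])
      interpret A: cring "smooth_algebra P" by (rule cring_smooth_algebra[OF P'])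
      show "a [^]\<^bsub>smooth_algebra P\<^esub> L.ord s \<in> smooth_functions P" "\<one>\<^bsub>smooth_algebra P\<^esub> \<in> smooth_functions P"
        using A.nat_pow_closed[of a] A.one_closed a unfolding smooth_algebra_simps(1) by blast+
      show "(a [^]\<^bsub>smooth_algebra P\<^esub> L.ord s) p = \<one>\<^bsub>smooth_algebra P\<^esub> p" if p: "p \<in> man_space P" for p
        using L.dual_generator_power_ord[OF fin S s sndL[OF p]] p by (simp add: smooth_algebra_pow a_def)
    qed
    ultimately show ?thesis by blast
  qed
  then show ?thesis
    unfolding trivial_nc_principal_bundle_def using pullback_dynamical_system S by blast
qed

theorem theorem4p8:
  fixes \<Lambda> :: "('g, 'z) monoid_scheme"
    and P :: "('a, 'e::real_inner) manifold"
    and \<alpha> :: "'g \<Rightarrow> ('a \<Rightarrow> complex) \<Rightarrow> ('a \<Rightarrow> complex)"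
    and M :: "('m, 'f::real_inner) manifold"
    and q :: "'a \<Rightarrow> 'm"
    and \<sigma> :: "'a \<times> 'g \<Rightarrow> 'a"
  assumes "comm_group \<Lambda>" and "finite (carrier \<Lambda>)" and "smooth_manifold P"
  shows "(trivial_nc_principal_bundle (smooth_algebra P) \<Lambda> \<alpha> \<longrightarrow>
            (\<forall>p\<in>man_space P. \<forall>g\<in>carrier \<Lambda>. \<exists>!x. x \<in> man_space P \<and>
               point_evaluation P x = compose (smooth_functions P) (point_evaluation P p) (\<alpha> g)) \<and>
            smooth_right_action P \<Lambda> (induced_action P \<alpha>) \<and>
            free_action P \<Lambda> (induced_action P \<alpha>) \<and>
            proper_action P \<Lambda> (induced_action P \<alpha>) \<and>
            trivial_principal_bundle P (orbit_manifold P \<Lambda> (induced_action P \<alpha>)) \<Lambda>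
              (orbit_map \<Lambda> (induced_action P \<alpha>)) (induced_action P \<alpha>)) \<and>
         (trivial_principal_bundle P M \<Lambda> q \<sigma> \<longrightarrow>
            trivial_nc_principal_bundle (smooth_algebra P) \<Lambda> (pullback_action P \<sigma>))"
proof (intro conjI impI)
  assume triv: "trivial_nc_principal_bundle (smooth_algebra P) \<Lambda> \<alpha>"
  then have D: "dynamical_system (smooth_algebra P) \<Lambda> \<alpha>" by (simp add: trivial_nc_principal_bundle_def)
  show "\<forall>p\<in>man_space P. \<forall>g\<in>carrier \<Lambda>. \<exists>!x. x \<in> man_space P \<and>
      point_evaluation P x = compose (smooth_functions P) (point_evaluation P p) (\<alpha> g)"
    by (intro ballI induced_point_unique_existence[OF assms(3) D])
  show "smooth_right_action P \<Lambda> (induced_action P \<alpha>)" "free_action P \<Lambda> (induced_action P \<alpha>)"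
    "proper_action P \<Lambda> (induced_action P \<alpha>)"
    "trivial_principal_bundle P (orbit_manifold P \<Lambda> (induced_action P \<alpha>)) \<Lambda>
      (orbit_map \<Lambda> (induced_action P \<alpha>)) (induced_action P \<alpha>)"
    by (rule trivial_nc_bundle_imp_trivial_bundle[OF assms triv])+
next
  assume "trivial_principal_bundle P M \<Lambda> q \<sigma>"
  then show "trivial_nc_principal_bundle (smooth_algebra P) \<Lambda> (pullback_action P \<sigma>)"
    by (rule trivial_bundle_imp_trivial_nc_bundle[OF assms(1,2)])
qed

end
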